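(* Fix any $s\in\mathbb{R}_+$. In the league model described in the context (with the stated assumptions on $f$, $\mu$, $\nu$ and $\bm\xi$, including the mixing assumptions on the coefficients $\alpha_n$), for $\mu^{\mathbb{N}}$-almost every sequence $\vec{s}=(s_i)_{i\in\mathbb{N}}\in\mathbb{R}_+^{\mathbb{N}}$, under $\mathbb{P}_{\vec{s}}$, as $n\to\infty$, $$\frac{\bm W_n(s)-\mathbb{E}_{\vec{s}}[\bm W_n(s)]}{\sqrt{2n}}\xrightarrow{d}\mathcal{N}\left(0,\sigma(s)^2+\rho(s)^2\right),$$ where, for $F_s(x,y):=\mathbb{E}\left[f\left(s\cdot x,y\cdot\bm V'\right)\right]$ and $\tilde F_s(x,y):=F_s(x,y)-\mathbb{E}[F_s(\bm V,y)]$, $$\sigma(s)^2=\mathbb{E}\left[F_s(\bm V,\bm U)-\left(F_s(\bm V,\bm U)\right)^2\right]=\ell(s)-\mathbb{E}\left[\left(F_s(\bm V,\bm U)\right)^2\right],\qquad \ell(s):=\mathbb{E}\left[f(s\cdot\bm V,\bm U\cdot\bm V')\right],$$ and $$\rho(s)^2=\mathbb{E}\left[\tilde F_s(\bm V,\bm U)^2\right]+2\sum_{k=1}^\infty\mathbb{E}\left[\tilde F_s(\bm\xi_1,\bm U)\,\tilde F_s(\bm\xi_{1+k},\bm U')\right],$$ the last series being convergent. Here $\bm V,\bm V',\bm U,\bm U'$ are independent random variables, $\bm V,\bm V'$ have law $\nu$, $\bm U,\bm U'$ have law $\mu$, and $\bm U,\bm U'$ are independent of $\bm\xi$.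
   Context: Notation: $\mathbb{N}=\{1,2,\dots\}$, $[n]=\{1,\dots,n\}$, $[n]_0=\{0,1,\dots,n\}$, $\mathbb{R}_+=[0,\infty)$. Random quantities are in bold. $\mathcal{N}(0,v)$ is the centered Gaussian law with variance $v$. Assumptions on $f$: $f:\mathbb{R}_+^2\to[0,1]$ is measurable, weakly increasing in its first variable, weakly decreasing in its second variable, and $f(x,y)+f(y,x)=1$ for all $x,y\in\mathbb{R}_+$. Assumptions on $\mu,\nu,\bm\xi$: $\mu$ and $\nu$ are Borel probability measures on $\mathbb{R}_+$. $\bm\xi=(\bm\xi_\ell)_{\ell\in\mathbb{N}}$ is an $\mathbb{R}_+$-valued process such that: each $\bm\xi_\ell$ has law $\nu$; $(\bm\xi_\ell,\bm\xi_k)\stackrel{d}{=}(\bm\xi_{\ell+\tau},\bm\xi_{k+\tau})$ for all $\ell,k,\tau\in\mathbb{N}$; and $\bm\xi$ is weakly mixing, i.e. for every $A\in\sigma(\bm\xi_1)$ and every collection of sets $B_\ell\in\sigma(\bm\xi_\ell)$, $\frac1n\sum_{\ell=1}^n|\mathbb{P}(A\cap B_\ell)-\mathbb{P}(A)\mathbb{P}(B_\ell)|\to0$ as $n\to\infty$. Mixing assumptions: let $\mathcal{A}_1^k=\sigma(\bm\xi_1,\dots,\bm\xi_k)$, $\mathcal{A}_k^\infty=\sigma(\bm\xi_k,\bm\xi_{k+1},\dots)$ and $$\alpha_n=\sup_{k\in\mathbb{N},\,A\in\mathcal{A}_1^k,\,B\in\mathcal{A}_{k+n}^\infty}|\mathbb{P}(A\cap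 B)-\mathbb{P}(A)\mathbb{P}(B)|.$$ It is assumed that $\sum_{n=1}^\infty\alpha_n<\infty$ and that there exist two sequences $p=p(n)$, $q=q(n)$ of positive integers such that, as $n\to\infty$: $p\to+\infty$ and $q\to+\infty$; $q=o(p)$ and $p=o(n)$; $np^{-1}\alpha_q=o(1)$; $\frac{p}{n}\sum_{j=1}^p j\alpha_j=o(1)$. The league with $2n$ teams: the teams are $T_0,\dots,T_{2n-1}$. There are $2n-1$ days; the calendar is deterministic and fixed in advance (for each $n$), every team plays exactly one match each day, and over the $2n-1$ days each team plays every other team exactly once. Team $T_i$ has initial strength $\bm s_i\in\mathbb{R}_+$ and its strength on day $p$ is $\bm s_i\cdot\bm\xi^i_p$, where the processes $\bm\xi^i=(\bm\xi^i_p)_{p\in\mathbb{N}}$, $i\in[2n-1]_0$, are independent copies of $\bm\xi$. The initial strength of $T_0$ is deterministic, $\bm s_0=s$; the initial strengths $\bm s_i$, $i\geq1$, are i.i.d. with law $\mu$ and independent of all the processes $\bm\xi^i$ and of $\bm\xi$. If $T_i$ and $T_j$ play on day $p$, then, conditionally on the strengths, $T_i$ wins with probability $f(\bm s_i\bm\xi^i_p,\bm s_j\bm\xi^j_p)$ and otherwise $T_j$ wins (no draws); conditionally on the strengths of the teams, the results of different matches are independent. $\bm W_n(s)$ is the number of wins of $T_0$ at the end of the league with $2n$ teams. For a deterministic sequence $\vec{s}=(s_i)_{i\in\mathbb{N}}\in\mathbb{R}_+^{\mathbb{N}}$, $\mathbb{P}_{\vec{s}}$ (with expectation $\mathbb{E}_{\vec{s}}$)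 denotes the law in the model where the initial strengths of the teams $T_i$, $i\in[2n-1]$, are equal to the deterministic values $s_i$ (and $T_0$ has initial strength $s$). *)

theory Defs
  imports "HOL-Probability.Probability" "HOL-Library.Landau_Symbols"
begin

text \<open>
  The paper indexes sequences by the positive integers: a process \<open>\<xi> :: nat \<Rightarrow> 'a \<Rightarrow> real\<close> and a
  sequence of initial strengths are only ever used at indices in \<open>{1..}\<close>, and \<open>k\<close>, \<open>l\<close>, \<open>\<tau>\<close> and the
  number \<open>n\<close> below range over the positive integers.
\<close>

abbreviation borel_nonneg :: "real measure" where
  "borel_nonneg \<equiv> restrict_space borel {0..}"

definition win_function :: "(real \<Rightarrow> real \<Rightarrow> real) \<Rightarrow> bool" where
  "win_function f \<longleftrightarrow>
     (\<lambda>(x, y). f x y) \<in> borel_measurable (borel_nonneg \<Otimes>\<^sub>M borel_nonneg) \<and>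
     (\<forall>x\<ge>0. \<forall>y\<ge>0. f x y \<in> {0..1}) \<and>
     (\<forall>x\<ge>0. \<forall>x'\<ge>0. \<forall>y\<ge>0. x \<le> x' \<longrightarrow> f x y \<le> f x' y) \<and>
     (\<forall>x\<ge>0. \<forall>y\<ge>0. \<forall>y'\<ge>0. y \<le> y' \<longrightarrow> f x y' \<le> f x y) \<and>
     (\<forall>x\<ge>0. \<forall>y\<ge>0. f x y + f y x = 1)"


subsection \<open>The process\<close>

text \<open>The \<open>\<sigma>\<close>-algebra generated by the variables \<open>\<xi> l\<close>, \<open>l \<in> I\<close>.\<close>

definition process_algebra :: "'a measure \<Rightarrow> (nat \<Rightarrow> 'a \<Rightarrow> real) \<Rightarrow> nat set \<Rightarrow> 'a set set" where
  "process_algebra M \<xi> I =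
     sigma_sets (space M) {\<xi> l -` A \<inter> space M | l A. l \<in> I \<and> A \<in> sets borel_nonneg}"

definition weakly_mixing :: "'a measure \<Rightarrow> (nat \<Rightarrow> 'a \<Rightarrow> real) \<Rightarrow> bool" where
  "weakly_mixing M \<xi> \<longleftrightarrow>
     (\<forall>A B. A \<in> process_algebra M \<xi> {1} \<longrightarrow> (\<forall>l\<ge>1. B l \<in> process_algebra M \<xi> {l}) \<longrightarrow>
        (\<lambda>n. (\<Sum>l=1..n. \<bar>measure M (A \<inter> B l) - measure M A * measure M (B l)\<bar>) / real n)
          \<longlonglongrightarrow> 0)"

definition admissible_process ::
  "real measure \<Rightarrow> 'a measure \<Rightarrow> (nat \<Rightarrow> 'a \<Rightarrow> real) \<Rightarrow> bool" where
  "admissible_process \<nu> M \<xi> \<longleftrightarrow>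
     prob_space M \<and>
     (\<forall>l\<ge>1. \<xi> l \<in> measurable M borel_nonneg) \<and>
     (\<forall>l\<ge>1. distr M borel_nonneg (\<xi> l) = \<nu>) \<and>
     (\<forall>l\<ge>1. \<forall>k\<ge>1. \<forall>\<tau>\<ge>1.
        distr M (borel_nonneg \<Otimes>\<^sub>M borel_nonneg) (\<lambda>\<omega>. (\<xi> l \<omega>, \<xi> k \<omega>)) =
        distr M (borel_nonneg \<Otimes>\<^sub>M borel_nonneg) (\<lambda>\<omega>. (\<xi> (l + \<tau>) \<omega>, \<xi> (k + \<tau>) \<omega>))) \<and>
     weakly_mixing M \<xi>"

text \<open>The supremum is over a nonempty set of reals contained in \<open>{0..1}\<close>.\<close>

definition mixing_coeff :: "'a measure \<Rightarrow> (nat \<Rightarrow> 'a \<Rightarrow> real) \<Rightarrow> nat \<Rightarrow> real" where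
  "mixing_coeff M \<xi> n =
     Sup {\<bar>measure M (A \<inter> B) - measure M A * measure M B\<bar> | k A B.
       k \<ge> 1 \<and> A \<in> process_algebra M \<xi> {1..k} \<and> B \<in> process_algebra M \<xi> {k + n..}}"

definition mixing_rate :: "(nat \<Rightarrow> real) \<Rightarrow> bool" where
  "mixing_rate \<alpha> \<longleftrightarrow>
     summable (\<lambda>n. \<alpha> (Suc n)) \<and>
     (\<exists>p q :: nat \<Rightarrow> nat.
        (\<forall>n\<ge>1. p n \<ge> 1 \<and> q n \<ge> 1) \<and>
        filterlim p at_top sequentially \<and>
        filterlim q at_top sequentially \<and>
        (\<lambda>n. real (q n)) \<in> o(\<lambda>n. real (p n)) \<and>
        (\<lambda>n. real (p n)) \<in> o(\<lambda>n. real n) \<and>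
        (\<lambda>n. real n / real (p n) * \<alpha> (q n)) \<in> o(\<lambda>_. 1) \<and>
        (\<lambda>n. real (p n) / real n * (\<Sum>j=1..p n. real j * \<alpha> j)) \<in> o(\<lambda>_. 1))"


subsection \<open>The league\<close>

text \<open>
  The teams are \<open>{..<2 * n}\<close>, the days are \<open>{1..<2 * n}\<close>, and \<open>opp p i\<close> is the opponent of team \<open>i\<close>
  on day \<open>p\<close>.
\<close>

definition calendar :: "nat \<Rightarrow> (nat \<Rightarrow> nat \<Rightarrow> nat) \<Rightarrow> bool" where
  "calendar n opp \<longleftrightarrow>
     (\<forall>p\<in>{1..<2 * n}. \<forall>i<2 * n. opp p i < 2 * n \<and> opp p i \<noteq> i \<and> opp p (opp p i) = i) \<and>
     (\<forall>i<2 * n. \<forall>j<2 * n. i \<noteq> j \<longrightarrow> (\<exists>!p. p \<in> {1..<2 * n} \<and> opp p i = j))"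

text \<open>
  The triple \<open>(p, i, j)\<close> with \<open>i < j\<close> stands for the match between teams \<open>i\<close> and \<open>j\<close> on day \<open>p\<close>. A
  result function \<open>r\<close> maps it to \<open>True\<close> if \<open>i\<close> wins and to \<open>False\<close> if \<open>j\<close> wins; by convention \<open>r\<close> is
  \<open>False\<close> on triples that are not matches.
\<close>

definition matches :: "nat \<Rightarrow> (nat \<Rightarrow> nat \<Rightarrow> nat) \<Rightarrow> (nat \<times> nat \<times> nat) set" where
  "matches n opp = {(p, i, j). p \<in> {1..<2 * n} \<and> i < j \<and> j < 2 * n \<and> opp p i = j}"

definition results :: "nat \<Rightarrow> (nat \<Rightarrow> nat \<Rightarrow> nat) \<Rightarrow> (nat \<times> nat \<times> nat \<Rightarrow> bool) set" where
  "results n opp = {r. \<forall>m. m \<notin> matches n opp \<longrightarrow> \<not> r m}"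

definition wins ::
  "nat \<Rightarrow> (nat \<Rightarrow> nat \<Rightarrow> nat) \<Rightarrow> (nat \<times> nat \<times> nat \<Rightarrow> bool) \<Rightarrow> nat \<Rightarrow> nat" where
  "wins n opp r i =
     card {p \<in> {1..<2 * n}. if i < opp p i then r (p, i, opp p i) else \<not> r (p, opp p i, i)}"

text \<open>
  The conditional law of all results, given that team \<open>i\<close> has initial strength \<open>a i\<close> and that its
  process takes the value \<open>x i p\<close> on day \<open>p\<close>: independent Bernoulli variables.
\<close>

definition results_pmf ::
  "(real \<Rightarrow> real \<Rightarrow> real) \<Rightarrow> nat \<Rightarrow> (nat \<Rightarrow> nat \<Rightarrow> nat) \<Rightarrow> (nat \<Rightarrow> real) \<Rightarrow> (nat \<Rightarrow> nat \<Rightarrow> real) \<Rightarrow>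
     (nat \<times> nat \<times> nat \<Rightarrow> bool) pmf" where
  "results_pmf f n opp a x =
     Pi_pmf (matches n opp) False (\<lambda>(p, i, j). bernoulli_pmf (f (a i * x i p) (a j * x j p)))"

definition process_law :: "'a measure \<Rightarrow> (nat \<Rightarrow> 'a \<Rightarrow> real) \<Rightarrow> (nat \<Rightarrow> real) measure" where
  "process_law M \<xi> =
     distr M (Pi\<^sub>M {1..} (\<lambda>_. borel_nonneg)) (\<lambda>\<omega>. restrict (\<lambda>l. \<xi> l \<omega>) {1..})"

text \<open>
  The law of the pair \<open>(x, r)\<close> formed by the processes of all teams, which are independent copies of
  \<open>\<xi>\<close>, and the results of all matches, when the initial strengths are the deterministic values \<open>a\<close>.
  The conditional law of \<open>r\<close> given \<open>x\<close> lives on the finite set \<open>results n opp\<close>, so the joint law is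
  given by its density with respect to the product with the counting measure.
\<close>

definition league ::
  "(real \<Rightarrow> real \<Rightarrow> real) \<Rightarrow> 'a measure \<Rightarrow> (nat \<Rightarrow> 'a \<Rightarrow> real) \<Rightarrow> nat \<Rightarrow> (nat \<Rightarrow> nat \<Rightarrow> nat) \<Rightarrow>
     (nat \<Rightarrow> real) \<Rightarrow> ((nat \<Rightarrow> nat \<Rightarrow> real) \<times> (nat \<times> nat \<times> nat \<Rightarrow> bool)) measure" where
  "league f M \<xi> n opp a =
     density (Pi\<^sub>M {..<2 * n} (\<lambda>_. process_law M \<xi>) \<Otimes>\<^sub>M count_space (results n opp))
       (\<lambda>(x, r). ennreal (pmf (results_pmf f n opp a x) r))"

text \<open>The density is measurable and \<open>league\<close> is indeed a probability measure.\<close>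

lemma finite_matches: "finite (matches n opp)"
  by (rule finite_subset[of _ "{1..<2 * n} \<times> {..<2 * n} \<times> {..<2 * n}"]) (auto simp: matches_def)

lemma results_eq_PiE_dflt: "results n opp = PiE_dflt (matches n opp) False (\<lambda>_. UNIV)"
  by (auto simp: results_def PiE_dflt_def)

lemma finite_results: "finite (results n opp)"
  unfolding results_eq_PiE_dflt by (intro finite_PiE_dflt finite_matches) auto

lemma measurable_league_density:
  assumes f: "win_function f" and a: "\<And>i. i < 2 * n \<Longrightarrow> a i \<ge> 0"
  shows "(\<lambda>(x, r). ennreal (pmf (results_pmf f n opp a x) r)) \<in> borel_measurable
           (Pi\<^sub>M {..<2 * n} (\<lambda>_. process_law M \<xi>) \<Otimes>\<^sub>M count_space (results n opp))"
    (is "_ \<in> borel_measurable (?X \<Otimes>\<^sub>M _)")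
proof -
  have sets_X: "sets ?X = sets (Pi\<^sub>M {..<2 * n} (\<lambda>_. Pi\<^sub>M {1..} (\<lambda>_. borel_nonneg)))"
    by (intro sets_PiM_cong) (auto simp: process_law_def)
  note space_X = sets_eq_imp_space_eq[OF sets_X]
  have coord: "(\<lambda>x. a i * x i p) \<in> measurable ?X borel_nonneg" if "i < 2 * n" "p \<ge> 1" for i p
  proof -
    have "(\<lambda>x. x i p) \<in> measurable ?X borel_nonneg"
      unfolding measurable_cong_sets[OF sets_X refl]
      using that
      by (intro measurable_compose[OF measurable_component_singleton[of i]
            measurable_component_singleton[of p]]) auto
    with a[OF that(1)] show ?thesis
      by (auto simp: measurable_restrict_space2_iff space_restrict_space intro!: mult_nonneg_nonneg)
  qed
  have "(\<lambda>x. pmf (results_pmf f n opp a x) r) \<in> borel_measurable ?X" if r: "r \<in> results n opp" for r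
  proof -
    have p01: "f (a i * x i p) (a j * x j p) \<in> {0..1}"
      if "(p, i, j) \<in> matches n opp" "x \<in> space ?X" for x p i j
    proof -
      have "i < 2 * n" "j < 2 * n" "p \<ge> 1" using that(1) by (auto simp: matches_def)
      hence "a i * x i p \<ge> 0" "a j * x j p \<ge> 0"
        using measurable_space[OF coord that(2)] by (auto simp: space_restrict_space)
      moreover have "\<forall>x\<ge>0. \<forall>y\<ge>0. f x y \<in> {0..1}" using f by (simp add: win_function_def)
      ultimately show ?thesis by blast
    qed
    have "pmf (results_pmf f n opp a x) r =
        (\<Prod>(p, i, j)\<in>matches n opp. if r (p, i, j) then f (a i * x i p) (a j * x j p)
                                   else 1 - f (a i * x i p) (a j * x j p))"
      if "x \<in> space ?X" for x
      unfolding results_pmf_def using r p01[OF _ that]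
      by (subst pmf_Pi'[OF finite_matches]) (auto simp: results_def intro!: prod.cong)
    moreover have "(\<lambda>x. \<Prod>(p, i, j)\<in>matches n opp.
        if r (p, i, j) then f (a i * x i p) (a j * x j p) else 1 - f (a i * x i p) (a j * x j p))
        \<in> borel_measurable ?X"
    proof -
      have "(\<lambda>x. f (a i * x i p) (a j * x j p)) \<in> borel_measurable ?X"
        if "(p, i, j) \<in> matches n opp" for p i j
      proof -
        have *: "i < 2 * n" "j < 2 * n" "p \<ge> 1" using that by (auto simp: matches_def)
        have "(\<lambda>x. (a i * x i p, a j * x j p)) \<in> measurable ?X (borel_nonneg \<Otimes>\<^sub>M borel_nonneg)"
          by (intro measurable_Pair coord *)
        from measurable_compose[OF this, of "\<lambda>(x, y). f x y" borel] f show ?thesis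
          by (simp add: win_function_def)
      qed
      thus ?thesis
        by (intro borel_measurable_prod) (auto split: prod.splits)
    qed
    ultimately show ?thesis by (simp cong: measurable_cong)
  qed
  hence "(\<lambda>x. ennreal (pmf (results_pmf f n opp a x) r)) \<in> borel_measurable ?X"
    if "r \<in> results n opp" for r using that by simp
  hence "(\<lambda>z. ennreal (pmf (results_pmf f n opp a (fst z)) r)) \<in> borel_measurable
            (?X \<Otimes>\<^sub>M count_space (results n opp))" if "r \<in> results n opp" for r
    using that by (intro measurable_compose[OF measurable_fst]) auto
  from measurable_compose_countable'[OF this measurable_snd countable_finite[OF finite_results]]
  show ?thesis by (simp add: case_prod_beta')
qed

lemma prob_space_league:
  assumes f: "win_function f" and \<xi>: "admissible_process \<nu> M \<xi>"
    and a: "\<And>i. i < 2 * n \<Longrightarrow> a i \<ge> 0"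
  shows "prob_space (league f M \<xi> n opp a)"
proof
  let ?X = "Pi\<^sub>M {..<2 * n} (\<lambda>_. process_law M \<xi>)" and ?R = "count_space (results n opp)"
  have "prob_space (process_law M \<xi>)"
    unfolding process_law_def using \<xi>
    by (intro prob_space.prob_space_distr) (auto simp: admissible_process_def intro!: measurable_restrict)
  then interpret X: product_prob_space "\<lambda>_. process_law M \<xi>" "{..<2 * n}"
    by (simp add: product_prob_spaceI)
  interpret R: sigma_finite_measure ?R
    by (intro sigma_finite_measure_count_space_finite finite_results)
  have sum1: "(\<Sum>r\<in>results n opp. ennreal (pmf (results_pmf f n opp a x) r)) = 1" for x
  proof -
    have "set_pmf (results_pmf f n opp a x) \<subseteq> results n opp"
      unfolding results_pmf_def results_eq_PiE_dflt
      using set_Pi_pmf_subset'[OF finite_matches] by (fastforce simp: PiE_dflt_def)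
    hence "(\<Sum>r\<in>results n opp. pmf (results_pmf f n opp a x) r) = 1"
      by (intro sum_pmf_eq_1 finite_results)
    thus ?thesis by (simp add: sum_ennreal)
  qed
  let ?g = "\<lambda>(x, r). ennreal (pmf (results_pmf f n opp a x) r)"
  have g: "?g \<in> borel_measurable (?X \<Otimes>\<^sub>M ?R)"
    by (rule measurable_league_density[OF f a])
  have "emeasure (league f M \<xi> n opp a) (space (league f M \<xi> n opp a)) =
      (\<integral>\<^sup>+z. ?g z * indicator (space (?X \<Otimes>\<^sub>M ?R)) z \<partial>(?X \<Otimes>\<^sub>M ?R))"
    unfolding league_def space_density by (rule emeasure_density[OF g sets.top])
  also have "\<dots> = (\<integral>\<^sup>+z. ?g z \<partial>(?X \<Otimes>\<^sub>M ?R))"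
    by (rule nn_integral_cong) simp
  also have "\<dots> = (\<integral>\<^sup>+x. \<integral>\<^sup>+r. ?g (x, r) \<partial>?R \<partial>?X)"
    by (rule R.nn_integral_fst[OF g, symmetric])
  also have "\<dots> = (\<integral>\<^sup>+x. 1 \<partial>?X)"
    by (intro nn_integral_cong) (simp add: nn_integral_count_space_finite finite_results sum1)
  also have "\<dots> = 1" by (simp add: X.P.emeasure_space_1)
  finally show "emeasure (league f M \<xi> n opp a) (space (league f M \<xi> n opp a)) = 1" .
qed

text \<open>The number of wins of team 0, as a random variable on \<open>league\<close>.\<close>

definition W ::
  "nat \<Rightarrow> (nat \<Rightarrow> nat \<Rightarrow> nat) \<Rightarrow> (nat \<Rightarrow> nat \<Rightarrow> real) \<times> (nat \<times> nat \<times> nat \<Rightarrow> bool) \<Rightarrow> real" where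
  "W n opp = (\<lambda>(x, r). real (wins n opp r 0))"


subsection \<open>The limit law\<close>

text \<open>
  Expectations over the independent variables \<open>V\<close>, \<open>V'\<close> of law \<open>\<nu>\<close> and \<open>U\<close>, \<open>U'\<close> of law \<open>\<mu>\<close>, with
  \<open>U\<close>, \<open>U'\<close> independent of \<open>\<xi>\<close>, are integrals with respect to product measures.
\<close>

definition F :: "(real \<Rightarrow> real \<Rightarrow> real) \<Rightarrow> real measure \<Rightarrow> real \<Rightarrow> real \<Rightarrow> real \<Rightarrow> real" where
  "F f \<nu> s x y = (\<integral>v'. f (s * x) (y * v') \<partial>\<nu>)"

definition F_tilde :: "(real \<Rightarrow> real \<Rightarrow> real) \<Rightarrow> real measure \<Rightarrow> real \<Rightarrow> real \<Rightarrow> real \<Rightarrow> real" where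
  "F_tilde f \<nu> s x y = F f \<nu> s x y - (\<integral>v. F f \<nu> s v y \<partial>\<nu>)"

definition win_prob ::
  "(real \<Rightarrow> real \<Rightarrow> real) \<Rightarrow> real measure \<Rightarrow> real measure \<Rightarrow> real \<Rightarrow> real" where
  "win_prob f \<mu> \<nu> s = (\<integral>(v, u, v'). f (s * v) (u * v') \<partial>(\<nu> \<Otimes>\<^sub>M \<mu> \<Otimes>\<^sub>M \<nu>))"

definition sigma_sq ::
  "(real \<Rightarrow> real \<Rightarrow> real) \<Rightarrow> real measure \<Rightarrow> real measure \<Rightarrow> real \<Rightarrow> real" where
  "sigma_sq f \<mu> \<nu> s = (\<integral>(v, u). F f \<nu> s v u - (F f \<nu> s v u)\<^sup>2 \<partial>(\<nu> \<Otimes>\<^sub>M \<mu>))"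

definition rho_cov ::
  "(real \<Rightarrow> real \<Rightarrow> real) \<Rightarrow> real measure \<Rightarrow> real measure \<Rightarrow> 'a measure \<Rightarrow> (nat \<Rightarrow> 'a \<Rightarrow> real) \<Rightarrow>
     real \<Rightarrow> nat \<Rightarrow> real" where
  "rho_cov f \<mu> \<nu> M \<xi> s k =
     (\<integral>(\<omega>, u, u'). F_tilde f \<nu> s (\<xi> 1 \<omega>) u * F_tilde f \<nu> s (\<xi> (1 + k) \<omega>) u' \<partial>(M \<Otimes>\<^sub>M \<mu> \<Otimes>\<^sub>M \<mu>))"

definition rho_sq ::
  "(real \<Rightarrow> real \<Rightarrow> real) \<Rightarrow> real measure \<Rightarrow> real measure \<Rightarrow> 'a measure \<Rightarrow> (nat \<Rightarrow> 'a \<Rightarrow> real) \<Rightarrow>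
     real \<Rightarrow> real" where
  "rho_sq f \<mu> \<nu> M \<xi> s =
     (\<integral>(v, u). (F_tilde f \<nu> s v u)\<^sup>2 \<partial>(\<nu> \<Otimes>\<^sub>M \<mu>)) + 2 * (\<Sum>k. rho_cov f \<mu> \<nu> M \<xi> s (Suc k))"

text \<open>The variance may vanish, in which case the law is the Dirac mass at 0.\<close>

definition centered_gaussian :: "real \<Rightarrow> real measure" where
  "centered_gaussian v =
     (if v = 0 then return borel 0 else density lborel (normal_density 0 (sqrt v)))"

end

theory Submission
  imports Defs "HOL-Real_Asymp.Real_Asymp"
begin

text \<open>
  The opponents of \<open>T\<^sub>0\<close> on different days are different teams, so their processes can be
  integrated out: conditionally on its own process \<open>\<xi>\<close>, the results of \<open>T\<^sub>0\<close> are independent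
  Bernoulli variables whose parameter on day \<open>p\<close> is \<open>F\<^sub>s(\<xi>(p), s(o(p)))\<close>, where \<open>o(p)\<close> is the opponent.
  The centred results \<open>X\<^sub>p\<close> therefore inherit the mixing of \<open>\<xi>\<close>.

  Their sum is cut into Bernstein blocks of length \<open>e \<surd>n\<close> separated by gaps of
  length \<open>e\<^sup>2 \<surd>n\<close>, where \<open>e\<close> is fixed. The coefficients \<open>\<alpha>\<^sub>n\<close> are decreasing and summable, so
  \<open>n \<alpha>\<^sub>n \<rightarrow> 0\<close> and the blocks decouple as \<open>n \<rightarrow> \<infinity>\<close>; the gaps contribute \<open>O(\<surd>e)\<close>; and since a block
  sum is at most \<open>e \<surd>n\<close>, its third order Taylor remainder is controlled by its variance, which
  gives a total error \<open>O(e)\<close>. Finally \<open>e \<rightarrow> 0\<close>.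

  The variance of the sum is a sum over lags \<open>k\<close> of covariances \<open>C\<^sub>k(s(o(p)), s(o(p + k)))\<close>. The calendar may
  permute the strengths differently for each \<open>n\<close>, so the averages are taken over a triangular
  array; Hoeffding's inequality and the Borel-Cantelli lemma give their almost sure convergence,
  and Tannery's theorem sums over the lags.
\<close>

section \<open>Block decomposition of weakly dependent sums\<close>

text \<open>Mixing is a property of \<xi> on its own space \<open>M\<close>, whereas the results
  live on the league space. It is never lifted to events of the league: the limit theorem asks of a
  row only bounds on covariances and on the decoupling of characteristic functions, all of them
  expectations of products over days. For such products the opponents integrate out, because each of
  them is met on one day only and its process contributes a single variable of law \<nu>. Every
  factor becomes a function of \<xi>(p), and covariance inequalities on \<open>M\<close> apply.

  The block lengths are forced by a balance. There are of order sqrt n / e blocks, and decoupling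
  each costs \<alpha> at the gap length q; with q of order sqrt n the total is a constant depending
  on e times q \<alpha>_q, which tends to 0. Shorter blocks would be too many for this rate, longer
  ones would exceed the normalisation and spoil the Taylor expansion. The factor e^2 for the gaps,
  against e for the blocks, makes the gaps a fraction of about e of all days.\<close>

lemma (in prob_space) integrable_bounded:
  fixes f :: "'a \<Rightarrow> 'b::{banach, second_countable_topology}"
  assumes "f \<in> borel_measurable M" "\<And>\<omega>. \<omega> \<in> space M \<Longrightarrow> norm (f \<omega>) \<le> B"
  shows "integrable M f"
  using assms by (intro integrable_const_bound[of f B]) auto

lemma (in prob_space) norm_expectation_le:
  fixes f :: "'a \<Rightarrow> 'b::{banach, second_countable_topology}"
  assumes "f \<in> borel_measurable M" "\<And>\<omega>. \<omega> \<in> space M \<Longrightarrow> norm (f \<omega>) \<le> B"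
  shows "norm (expectation f) \<le> B"
proof -
  have "norm (expectation f) \<le> expectation (\<lambda>\<omega>. norm (f \<omega>))" by (rule integral_norm_bound)
  also have "\<dots> \<le> expectation (\<lambda>_. B)"
    using integrable_bounded[OF assms] assms(2) by (intro integral_mono) auto
  finally show ?thesis by (simp add: prob_space)
qed

text \<open>In natural numbers \<open>(i - j) + (j - i)\<close> is the distance of \<open>i\<close>
  and \<open>j\<close>. On either side of \<open>i\<close> every distance occurs at most once, so
  each side is bounded by the tail series; hence the factor 2.\<close>

lemma sum_distance_le:
  fixes c :: "nat \<Rightarrow> real"
  assumes c: "summable c" "\<And>k. c k \<ge> 0" and J: "finite J" "\<And>j. j \<in> J \<Longrightarrow> q \<le> (i - j) + (j - i)"
  shows "(\<Sum>j\<in>J. c ((i - j) + (j - i))) \<le> 2 * (\<Sum>k. c (k + q))"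
proof -
  have half: "(\<Sum>j\<in>J'. c ((i - j) + (j - i))) \<le> (\<Sum>k. c (k + q))"
    if "J' \<subseteq> J" and inj: "inj_on (\<lambda>j. (i - j) + (j - i)) J'" for J'
  proof -
    let ?d = "\<lambda>j. (i - j) + (j - i)"
    have fin: "finite J'" using that J finite_subset by blast
    have "(\<Sum>j\<in>J'. c (?d j)) = (\<Sum>j\<in>J'. c ((?d j - q) + q))"
      using that J(2) by (intro sum.cong refl arg_cong[of _ _ c]) (metis le_add_diff_inverse2 subsetD)
    also have "\<dots> = (\<Sum>k\<in>(\<lambda>j. ?d j - q) ` J'. c (k + q))"
    proof (subst sum.reindex)
      show "inj_on (\<lambda>j. ?d j - q) J'"
        using inj that(1) J(2) by (auto simp: inj_on_def) (smt (verit) eq_diff_iff subset_eq)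
    qed simp
    also have "\<dots> \<le> (\<Sum>k. c (k + q))"
      using c fin by (intro sum_le_suminf) (auto intro: summable_ignore_initial_segment)
    finally show ?thesis .
  qed
  have "(\<Sum>j\<in>J. c ((i - j) + (j - i))) =
      (\<Sum>j\<in>J \<inter> {..i}. c ((i - j) + (j - i))) + (\<Sum>j\<in>J - {..i}. c ((i - j) + (j - i)))"
    using J(1) by (rule sum.Int_Diff)
  also have "\<dots> \<le> (\<Sum>k. c (k + q)) + (\<Sum>k. c (k + q))"
    by (intro add_mono half) (auto simp: inj_on_def)
  finally show ?thesis by simp
qed

lemma abs_exp_minus_diff_le:
  fixes a b :: real assumes "a \<ge> 0" "b \<ge> 0"
  shows "\<bar>exp (- a) - exp (- b)\<bar> \<le> \<bar>a - b\<bar>"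
proof -
  have *: "\<bar>exp (- a) - exp (- b)\<bar> \<le> \<bar>a - b\<bar>" if "a \<le> b" "a \<ge> 0" for a b :: real
  proof -
    have "exp (- a) - exp (- b) = exp (- a) * (1 - exp (- (b - a)))"
      by (simp add: algebra_simps flip: exp_add)
    also have "\<dots> \<le> 1 * (b - a)"
      using exp_ge_add_one_self[of "a - b"] that by (intro mult_mono) (auto simp: algebra_simps)
    finally show ?thesis using that by simp
  qed
  show ?thesis using *[of a b] *[of b a] assms by linarith
qed

lemma exp_minus_taylor:
  fixes x :: real assumes "x \<ge> 0"
  shows "\<bar>exp (- x) - (1 - x)\<bar> \<le> x\<^sup>2 / 2"
proof -
  have "exp (-x) \<le> 1 - x + x\<^sup>2 / 2"
  proof -
    have "\<exists>y. \<bar>y\<bar> \<le> \<bar>-x\<bar> \<and> exp (-x) = (\<Sum>m<3. (-x) ^ m / fact m) + exp y / fact 3 * (-x) ^ 3"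
      by (rule Maclaurin_exp_le)
    then obtain y where y: "exp (-x) = (\<Sum>m<3. (-x) ^ m / fact m) + exp y / fact 3 * (-x) ^ 3" by blast
    have "exp y / fact 3 * (-x) ^ 3 \<le> 0"
      using assms by (intro mult_nonneg_nonpos) (auto simp: power3_eq_cube)
    with y show ?thesis by (simp add: eval_nat_numeral)
  qed
  moreover have "1 - x \<le> exp (- x)" using exp_ge_add_one_self[of "-x"] by simp
  ultimately show ?thesis by simp
qed

text \<open>This is the nonnegativity of the variance of
  \<open>\<bar>f \<omega>\<bar>\<close>.\<close>

lemma (in prob_space) expectation_abs_le_sqrt:
  assumes [measurable]: "f \<in> borel_measurable M" and B: "\<And>\<omega>. \<omega> \<in> space M \<Longrightarrow> \<bar>f \<omega>\<bar> \<le> B"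
  shows "expectation (\<lambda>\<omega>. \<bar>f \<omega>\<bar>) \<le> sqrt (expectation (\<lambda>\<omega>. (f \<omega>)\<^sup>2))"
proof (rule real_le_rsqrt)
  have int: "integrable M (\<lambda>\<omega>. \<bar>f \<omega>\<bar>)" using B by (intro integrable_bounded[where B=B]) auto
  have "(f \<omega>)\<^sup>2 \<le> B\<^sup>2" if "\<omega> \<in> space M" for \<omega>
    using B[OF that] by (simp add: abs_le_square_iff[symmetric])
  then have int2: "integrable M (\<lambda>\<omega>. (f \<omega>)\<^sup>2)" by (intro integrable_bounded[where B="B\<^sup>2"]) auto
  have "0 \<le> variance (\<lambda>\<omega>. \<bar>f \<omega>\<bar>)" by simp
  also have "\<dots> = expectation (\<lambda>\<omega>. (f \<omega>)\<^sup>2) - (expectation (\<lambda>\<omega>. \<bar>f \<omega>\<bar>))\<^sup>2"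
    using int int2 by (subst variance_eq) auto
  finally show "(expectation (\<lambda>\<omega>. \<bar>f \<omega>\<bar>))\<^sup>2 \<le> expectation (\<lambda>\<omega>. (f \<omega>)\<^sup>2)" by simp
qed

text \<open>All that the limit theorem needs to know about one row. Dependence enters only through
  covariances and characteristic functions of separated index sets; \<open>d \<ge> 1\<close> makes
  these sets disjoint. The sequence \<open>c\<close> is meant to be common to all rows, and
  \<open>c 0\<close> bounds the variance of a single variable.\<close>

locale mixing_row = prob_space P for P :: "'b measure" +
  fixes X :: "nat \<Rightarrow> 'b \<Rightarrow> real" and N :: nat and c :: "nat \<Rightarrow> real"
  assumes X_meas: "i \<in> {1..N} \<Longrightarrow> X i \<in> borel_measurable P"
    and X_le: "i \<in> {1..N} \<Longrightarrow> \<omega> \<in> space P \<Longrightarrow> \<bar>X i \<omega>\<bar> \<le> 1"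
    and X_mean: "i \<in> {1..N} \<Longrightarrow> expectation (X i) = 0"
    and cov_le: "i \<in> {1..N} \<Longrightarrow> j \<in> {1..N} \<Longrightarrow> i \<le> j \<Longrightarrow>
      \<bar>expectation (\<lambda>\<omega>. X i \<omega> * X j \<omega>)\<bar> \<le> c (j - i)"
    and decorrelate: "I \<subseteq> {1..N} \<Longrightarrow> J \<subseteq> {1..N} \<Longrightarrow> d \<ge> 1 \<Longrightarrow> (\<And>i j. i \<in> I \<Longrightarrow> j \<in> J \<Longrightarrow> i + d \<le> j) \<Longrightarrow>
      norm (expectation (\<lambda>\<omega>. iexp (t * (\<Sum>i\<in>I \<union> J. X i \<omega>)))
        - expectation (\<lambda>\<omega>. iexp (t * (\<Sum>i\<in>I. X i \<omega>))) * expectation (\<lambda>\<omega>. iexp (t * (\<Sum>i\<in>J. X i \<omega>)))) \<le> c d"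
    and c_summable: "summable c" and c_nonneg: "\<And>k. c k \<ge> 0"
begin

definition S :: "nat set \<Rightarrow> 'b \<Rightarrow> real" where "S J \<omega> = (\<Sum>i\<in>J. X i \<omega>)"

definition V :: "nat set \<Rightarrow> real" where "V J = expectation (\<lambda>\<omega>. (S J \<omega>)\<^sup>2)"

text \<open>Bounds the sum of the covariances with one fixed variable; the factor 2 accounts for the
  lags on both sides of it.\<close>

definition \<kappa> :: real where "\<kappa> = 2 * suminf c"

lemma \<kappa>_nonneg: "\<kappa> \<ge> 0"
  unfolding \<kappa>_def using c_summable c_nonneg by (simp add: suminf_nonneg)

lemma finite_row: "J \<subseteq> {1..N} \<Longrightarrow> finite J"
  using finite_subset by blast

lemma S_meas [measurable]: "J \<subseteq> {1..N} \<Longrightarrow> S J \<in> borel_measurable P"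
  unfolding S_def by (intro borel_measurable_sum X_meas) auto

lemma S_le: "J \<subseteq> {1..N} \<Longrightarrow> \<omega> \<in> space P \<Longrightarrow> \<bar>S J \<omega>\<bar> \<le> real (card J)"
proof -
  assume *: "J \<subseteq> {1..N}" "\<omega> \<in> space P"
  have "\<bar>S J \<omega>\<bar> \<le> (\<Sum>i\<in>J. 1)"
    unfolding S_def using * X_le by (intro order_trans[OF sum_abs] sum_mono) auto
  then show ?thesis by simp
qed

lemma S_power_integrable: "J \<subseteq> {1..N} \<Longrightarrow> integrable P (\<lambda>\<omega>. S J \<omega> ^ k)"
  using S_le by (intro integrable_bounded[where B="real (card J) ^ k"])
    (auto simp: power_abs intro!: power_mono)

lemma S_integrable: "J \<subseteq> {1..N} \<Longrightarrow> integrable P (S J)"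
  using S_power_integrable[of J 1] by simp

lemma XX_integrable:
  "i \<in> {1..N} \<Longrightarrow> j \<in> {1..N} \<Longrightarrow> integrable P (\<lambda>\<omega>. X i \<omega> * X j \<omega>)"
  using X_le by (intro integrable_bounded[where B=1] borel_measurable_times X_meas)
    (auto simp: abs_mult intro!: mult_le_one)

lemma S_mean: "J \<subseteq> {1..N} \<Longrightarrow> expectation (S J) = 0"
proof -
  assume J: "J \<subseteq> {1..N}"
  have "integrable P (X i)" if "i \<in> J" for i
    using J that X_le by (intro integrable_bounded[where B=1] X_meas) auto
  then show ?thesis
    unfolding S_def using J X_mean by (subst Bochner_Integration.integral_sum) (auto intro!: sum.neutral)
qed

lemma cov_abs_le: "i \<in> {1..N} \<Longrightarrow> j \<in> {1..N} \<Longrightarrow>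
    \<bar>expectation (\<lambda>\<omega>. X i \<omega> * X j \<omega>)\<bar> \<le> c ((i - j) + (j - i))"
  using cov_le[of i j] cov_le[of j i] by (cases "i \<le> j") (auto simp: mult.commute)

lemma V_eq: "J \<subseteq> {1..N} \<Longrightarrow> V J = (\<Sum>i\<in>J. \<Sum>j\<in>J. expectation (\<lambda>\<omega>. X i \<omega> * X j \<omega>))"
proof -
  assume J: "J \<subseteq> {1..N}"
  have int: "integrable P (\<lambda>\<omega>. X i \<omega> * X j \<omega>)" if "i \<in> J" "j \<in> J" for i j
    using J that by (intro XX_integrable) auto
  have "V J = expectation (\<lambda>\<omega>. \<Sum>i\<in>J. \<Sum>j\<in>J. X i \<omega> * X j \<omega>)"
    unfolding V_def S_def by (simp add: power2_eq_square sum_product)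
  also have "\<dots> = (\<Sum>i\<in>J. \<Sum>j\<in>J. expectation (\<lambda>\<omega>. X i \<omega> * X j \<omega>))"
    using int by (subst Bochner_Integration.integral_sum)
      (auto intro!: sum.cong Bochner_Integration.integral_sum)
  finally show ?thesis .
qed

lemma V_nonneg: "V J \<ge> 0"
  unfolding V_def by simp

text \<open>For \<open>q = 0\<close> the bound is \<open>\<kappa>\<close>; for larger
  \<open>q\<close> it controls the interaction of an index with the other blocks.\<close>

lemma sum_cov_far_le:
  assumes "i \<in> {1..N}" "J \<subseteq> {1..N}" "\<And>j. j \<in> J \<Longrightarrow> q \<le> (i - j) + (j - i)"
  shows "\<bar>\<Sum>j\<in>J. expectation (\<lambda>\<omega>. X i \<omega> * X j \<omega>)\<bar> \<le> 2 * (\<Sum>k. c (k + q))"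
proof -
  have "\<bar>\<Sum>j\<in>J. expectation (\<lambda>\<omega>. X i \<omega> * X j \<omega>)\<bar> \<le> (\<Sum>j\<in>J. c ((i - j) + (j - i)))"
    using assms by (intro order_trans[OF sum_abs] sum_mono cov_abs_le) auto
  also have "\<dots> \<le> 2 * (\<Sum>k. c (k + q))"
    using assms finite_row c_summable c_nonneg by (intro sum_distance_le) auto
  finally show ?thesis .
qed

lemma sum_cov_le:
  assumes "i \<in> {1..N}" "J \<subseteq> {1..N}"
  shows "\<bar>\<Sum>j\<in>J. expectation (\<lambda>\<omega>. X i \<omega> * X j \<omega>)\<bar> \<le> \<kappa>"
  using sum_cov_far_le[OF assms, of 0] by (simp add: \<kappa>_def)

lemma V_le: "J \<subseteq> {1..N} \<Longrightarrow> V J \<le> real (card J) * \<kappa>"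
proof -
  assume J: "J \<subseteq> {1..N}"
  have "V J \<le> (\<Sum>i\<in>J. \<kappa>)"
    unfolding V_eq[OF J]
  proof (intro sum_mono)
    fix i assume "i \<in> J"
    then show "(\<Sum>j\<in>J. expectation (\<lambda>\<omega>. X i \<omega> * X j \<omega>)) \<le> \<kappa>"
      using sum_cov_le[of i J] J by auto
  qed
  then show ?thesis by simp
qed

lemma iexp_integrable: "J \<subseteq> {1..N} \<Longrightarrow> integrable P (\<lambda>\<omega>. iexp (t * S J \<omega>))"
  by (intro integrable_bounded[where B=1]) auto

lemma norm_char_le: "J \<subseteq> {1..N} \<Longrightarrow> norm (expectation (\<lambda>\<omega>. iexp (t * S J \<omega>))) \<le> 1"
  by (intro norm_expectation_le) auto

text \<open>\<open>iexp\<close> is 1-Lipschitz, so the error is at most the mean absolute value of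
  the dropped sum, hence at most its L2 norm, and the variance grows at most linearly in the number
  of indices.\<close>

lemma drop_indices:
  assumes J: "J \<subseteq> {1..N}" and I: "I \<subseteq> J"
  shows "norm (expectation (\<lambda>\<omega>. iexp (t * S J \<omega>)) - expectation (\<lambda>\<omega>. iexp (t * S I \<omega>)))
    \<le> \<bar>t\<bar> * sqrt (real (card (J - I)) * \<kappa>)"
proof -
  have D: "J - I \<subseteq> {1..N}" "I \<subseteq> {1..N}" using assms by auto
  have "norm (expectation (\<lambda>\<omega>. iexp (t * S J \<omega>)) - expectation (\<lambda>\<omega>. iexp (t * S I \<omega>)))
      = norm (expectation (\<lambda>\<omega>. iexp (t * S J \<omega>) - iexp (t * S I \<omega>)))"
    using iexp_integrable[OF J] iexp_integrable[OF D(2)] by simp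
  also have "\<dots> \<le> expectation (\<lambda>\<omega>. norm (iexp (t * S J \<omega>) - iexp (t * S I \<omega>)))"
    by (rule integral_norm_bound)
  also have "\<dots> \<le> expectation (\<lambda>\<omega>. \<bar>t\<bar> * \<bar>S (J - I) \<omega>\<bar>)"
  proof (intro integral_mono)
    fix \<omega>
    have "S J \<omega> = S I \<omega> + S (J - I) \<omega>"
      unfolding S_def using I J finite_row[OF J] by (simp add: sum.subset_diff add.commute)
    then have "iexp (t * S J \<omega>) - iexp (t * S I \<omega>) = iexp (t * S I \<omega>) * (iexp (t * S (J - I) \<omega>) - 1)"
      by (simp add: algebra_simps flip: exp_add)
    also have "norm \<dots> = norm (iexp (t * S (J - I) \<omega>) - 1)" by (simp add: norm_mult)
    also have "\<dots> \<le> \<bar>t * S (J - I) \<omega>\<bar>"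
      using iexp_approx1[of "t * S (J - I) \<omega>" 0] by simp
    finally show "norm (iexp (t * S J \<omega>) - iexp (t * S I \<omega>)) \<le> \<bar>t\<bar> * \<bar>S (J - I) \<omega>\<bar>"
      by (simp add: abs_mult)
  next
    show "integrable P (\<lambda>\<omega>. norm (iexp (t * S J \<omega>) - iexp (t * S I \<omega>)))"
      using iexp_integrable[OF J] iexp_integrable[OF D(2)] by simp
    show "integrable P (\<lambda>\<omega>. \<bar>t\<bar> * \<bar>S (J - I) \<omega>\<bar>)"
      using S_integrable[OF D(1)] by simp
  qed
  also have "\<dots> = \<bar>t\<bar> * expectation (\<lambda>\<omega>. \<bar>S (J - I) \<omega>\<bar>)" by simp
  also have "\<dots> \<le> \<bar>t\<bar> * sqrt (V (J - I))"
    unfolding V_def using D S_le[OF D(1)] by (intro mult_left_mono expectation_abs_le_sqrt) auto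
  also have "\<dots> \<le> \<bar>t\<bar> * sqrt (real (card (J - I)) * \<kappa>)"
    using V_le[OF D(1)] by (intro mult_left_mono) auto
  finally show ?thesis .
qed

text \<open>The cubic remainder is bounded through \<bar>S\<bar>^3 \<le> p S^2, which costs p times
  the variance, of order \<open>p\<^sup>2\<close>, instead of \<open>p ^ 3\<close>. The second error
  term is the price of replacing \<open>1 - x\<close> by \<open>exp (- x)\<close> at
  \<open>x = t\<^sup>2 * V J / 2\<close>.\<close>

lemma char_taylor:
  assumes J: "J \<subseteq> {1..N}" and card: "card J \<le> p"
  shows "norm (expectation (\<lambda>\<omega>. iexp (t * S J \<omega>)) - exp (- (t\<^sup>2 * V J / 2)))
    \<le> \<bar>t\<bar> ^ 3 * real p ^ 2 * \<kappa> / 6 + t ^ 4 * real p ^ 2 * \<kappa>\<^sup>2 / 8"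
proof -
  have VJ: "V J \<le> real p * \<kappa>"
    using V_le[OF J] card \<kappa>_nonneg by (meson mult_right_mono of_nat_le_iff order_trans)
  have int1: "integrable P (\<lambda>\<omega>. complex_of_real (S J \<omega>))" using S_integrable[OF J] by simp
  have int2: "integrable P (\<lambda>\<omega>. complex_of_real ((S J \<omega>)\<^sup>2))"
    using S_power_integrable[OF J, of 2] by (simp only: integrable_of_real)
  have E: "expectation (\<lambda>\<omega>. 1 + \<i> * t * S J \<omega> - t\<^sup>2 / 2 * complex_of_real ((S J \<omega>)\<^sup>2)) = 1 - t\<^sup>2 * V J / 2"
    using int1 int2 S_mean[OF J] by (simp add: prob_space V_def del: of_real_power)
  have intE: "integrable P (\<lambda>\<omega>. 1 + \<i> * t * S J \<omega> - t\<^sup>2 / 2 * complex_of_real ((S J \<omega>)\<^sup>2))"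
    using int1 int2 by simp
  have "norm (expectation (\<lambda>\<omega>. iexp (t * S J \<omega>)) - (1 - t\<^sup>2 * V J / 2))
     = norm (expectation (\<lambda>\<omega>. iexp (t * S J \<omega>) - (1 + \<i> * t * S J \<omega> - t\<^sup>2 / 2 * complex_of_real ((S J \<omega>)\<^sup>2))))"
    unfolding E[symmetric] using iexp_integrable[OF J] intE by (subst Bochner_Integration.integral_diff) auto
  also have "\<dots> \<le> expectation (\<lambda>\<omega>. norm (iexp (t * S J \<omega>) - (1 + \<i> * t * S J \<omega> - t\<^sup>2 / 2 * complex_of_real ((S J \<omega>)\<^sup>2))))"
    by (rule integral_norm_bound)
  also have "\<dots> \<le> expectation (\<lambda>\<omega>. \<bar>t\<bar> ^ 3 * real p / 6 * (S J \<omega>)\<^sup>2)"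
  proof (rule integral_mono)
    show "integrable P (\<lambda>\<omega>. norm (iexp (t * S J \<omega>) - (1 + \<i> * t * S J \<omega> - t\<^sup>2 / 2 * complex_of_real ((S J \<omega>)\<^sup>2))))"
      using iexp_integrable[OF J] intE by simp
    show "integrable P (\<lambda>\<omega>. \<bar>t\<bar> ^ 3 * real p / 6 * (S J \<omega>)\<^sup>2)"
      using S_power_integrable[OF J, of 2] by simp
    fix \<omega> assume \<omega>: "\<omega> \<in> space P"
    have "norm (iexp (t * S J \<omega>) - (1 + \<i> * t * S J \<omega> - t\<^sup>2 / 2 * complex_of_real ((S J \<omega>)\<^sup>2)))
        \<le> \<bar>t * S J \<omega>\<bar> ^ 3 / 6"
      using iexp_approx1[of "t * S J \<omega>" 2]
      by (simp add: eval_nat_numeral algebra_simps)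
    also have "\<dots> = \<bar>t\<bar> ^ 3 * (\<bar>S J \<omega>\<bar> * (S J \<omega>)\<^sup>2) / 6"
    proof -
      have "\<bar>S J \<omega>\<bar> ^ 3 = \<bar>S J \<omega>\<bar> * (S J \<omega>)\<^sup>2" by (simp add: power3_eq_cube power2_eq_square)
      then show ?thesis by (simp add: abs_mult power_mult_distrib)
    qed
    also have "\<dots> \<le> \<bar>t\<bar> ^ 3 * (real p * (S J \<omega>)\<^sup>2) / 6"
      using S_le[OF J \<omega>] card by (intro divide_right_mono mult_left_mono mult_right_mono) auto
    finally show "norm (iexp (t * S J \<omega>) - (1 + \<i> * t * S J \<omega> - t\<^sup>2 / 2 * complex_of_real ((S J \<omega>)\<^sup>2)))
        \<le> \<bar>t\<bar> ^ 3 * real p / 6 * (S J \<omega>)\<^sup>2" by simp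
  qed
  also have "\<dots> = \<bar>t\<bar> ^ 3 * real p / 6 * V J" by (simp add: V_def)
  also have "\<dots> \<le> \<bar>t\<bar> ^ 3 * real p / 6 * (real p * \<kappa>)" using VJ by (intro mult_left_mono) auto
  finally have 1: "norm (expectation (\<lambda>\<omega>. iexp (t * S J \<omega>)) - (1 - t\<^sup>2 * V J / 2)) \<le> \<bar>t\<bar> ^ 3 * real p ^ 2 * \<kappa> / 6"
    by (simp add: power2_eq_square mult_ac)
  have "\<bar>exp (- (t\<^sup>2 * V J / 2)) - (1 - t\<^sup>2 * V J / 2)\<bar> \<le> (t\<^sup>2 * V J / 2)\<^sup>2 / 2"
    using V_nonneg by (intro exp_minus_taylor) auto
  also have "\<dots> \<le> (t\<^sup>2 * (real p * \<kappa>) / 2)\<^sup>2 / 2"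
    using VJ V_nonneg by (intro divide_right_mono power_mono mult_left_mono) auto
  also have "\<dots> = t ^ 4 * real p ^ 2 * \<kappa>\<^sup>2 / 8"
    by (simp add: power_mult_distrib power_divide flip: power_mult)
  finally have 2: "norm (complex_of_real (exp (- (t\<^sup>2 * V J / 2))) - (1 - t\<^sup>2 * V J / 2)) \<le> t ^ 4 * real p ^ 2 * \<kappa>\<^sup>2 / 8"
    by (metis norm_of_real of_real_1 of_real_diff)
  have "norm (expectation (\<lambda>\<omega>. iexp (t * S J \<omega>)) - complex_of_real (exp (- (t\<^sup>2 * V J / 2)))) \<le>
    norm (expectation (\<lambda>\<omega>. iexp (t * S J \<omega>)) - (1 - t\<^sup>2 * V J / 2)) +
    norm ((1 - t\<^sup>2 * V J / 2) - complex_of_real (exp (- (t\<^sup>2 * V J / 2))))"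
    by norm
  with 1 2 show ?thesis by (simp add: norm_minus_commute)
qed


section \<open>Bernstein blocks and their decoupling\<close>

definition block :: "nat \<Rightarrow> nat \<Rightarrow> nat \<Rightarrow> nat set" where
  "block p q b = {b * (p + q) + 1..b * (p + q) + p}"

lemma block_separated:
  assumes "i \<in> block p q a" "j \<in> block p q b" "a < b"
  shows "i + q \<le> j"
proof -
  have "Suc a * (p + q) \<le> b * (p + q)" using assms(3) by (intro mult_right_mono) auto
  then show ?thesis using assms(1,2) by (auto simp: block_def)
qed

lemma block_subset: "K * (p + q) \<le> N \<Longrightarrow> b < K \<Longrightarrow> block p q b \<subseteq> {1..N}"
proof -
  assume *: "K * (p + q) \<le> N" "b < K"
  then have "Suc b * (p + q) \<le> K * (p + q)" by (intro mult_right_mono) auto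
  with * show ?thesis by (auto simp: block_def)
qed

lemma card_block: "card (block p q b) = p"
  by (simp add: block_def)

lemma blocks_disjoint:
  assumes "q \<ge> 1" "a \<noteq> b" shows "block p q a \<inter> block p q b = {}"
  using assms block_separated[of _ p q a _ b] block_separated[of _ p q b _ a]
  by (cases a b rule: linorder_cases) fastforce+

lemma sum_blocks:
  fixes g :: "nat \<Rightarrow> real"
  assumes "q \<ge> 1" shows "(\<Sum>i\<in>(\<Union>b<K. block p q b). g i) = (\<Sum>b<K. \<Sum>i\<in>block p q b. g i)"
  using blocks_disjoint[OF assms] by (intro sum.UNION_disjoint) (auto simp: block_def)

lemma card_blocks:
  assumes "q \<ge> 1" shows "card (\<Union>b<K. block p q b) = K * p"
  using blocks_disjoint[OF assms]
  by (subst card_UN_disjoint) (auto simp: card_block, auto simp: block_def)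

text \<open>Splitting off the last block costs \<open>c q\<close>. The error accumulated before is
  multiplied by the characteristic function of that block, whose norm is at most 1, so the costs
  only add up.\<close>

lemma char_blocks:
  assumes q: "q \<ge> 1" and K: "K * (p + q) \<le> N"
  shows "norm (expectation (\<lambda>\<omega>. iexp (t * S (\<Union>b<K. block p q b) \<omega>))
    - (\<Prod>b<K. expectation (\<lambda>\<omega>. iexp (t * S (block p q b) \<omega>)))) \<le> real K * c q"
  using K
proof (induction K)
  case 0
  then show ?case by (simp add: S_def prob_space)
next
  case (Suc K)
  let ?B = "\<Union>b<K. block p q b" and ?E = "\<lambda>J. expectation (\<lambda>\<omega>. iexp (t * S J \<omega>))"
  have IH: "norm (?E ?B - (\<Prod>b<K. ?E (block p q b))) \<le> real K * c q"
    using Suc by simp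
  have sub: "?B \<subseteq> {1..N}" "block p q K \<subseteq> {1..N}"
    using block_subset[OF Suc.prems] by (blast intro: less_SucI)+
  have UN: "(\<Union>b<Suc K. block p q b) = ?B \<union> block p q K" by (auto simp: lessThan_Suc)
  have "norm (?E (\<Union>b<Suc K. block p q b) - ?E ?B * ?E (block p q K)) \<le> c q"
    unfolding UN S_def
  proof (rule decorrelate[OF sub q])
    fix i j assume "i \<in> ?B" "j \<in> block p q K"
    then show "i + q \<le> j" using block_separated by auto
  qed
  moreover have "norm (?E ?B * ?E (block p q K) - (\<Prod>b<K. ?E (block p q b)) * ?E (block p q K)) \<le> real K * c q"
  proof -
    have "norm (?E ?B * ?E (block p q K) - (\<Prod>b<K. ?E (block p q b)) * ?E (block p q K))
      = norm (?E ?B - (\<Prod>b<K. ?E (block p q b))) * norm (?E (block p q K))"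
      by (simp add: norm_mult flip: left_diff_distrib)
    also have "\<dots> \<le> (real K * c q) * 1"
      using IH norm_char_le[OF sub(2)] c_nonneg by (intro mult_mono) auto
    finally show ?thesis by simp
  qed
  ultimately have "norm (?E (\<Union>b<Suc K. block p q b) - (\<Prod>b<K. ?E (block p q b)) * ?E (block p q K))
      \<le> c q + real K * c q"
    by (rule norm_diff_triangle_le)
  then show ?case by (simp add: algebra_simps)
qed

text \<open>The pairs of indices that the block variances miss are of two kinds. Those with an index
  outside the blocks are covered twice by symmetry and cost \<open>\<kappa>\<close> per such index.
  Those from two different blocks have lag at least \<open>q\<close>, so only the tail of
  \<open>c\<close> enters.\<close>

lemma V_blocks:
  assumes q: "q \<ge> 1" and K: "K * (p + q) \<le> N"
  shows "\<bar>V {1..N} - (\<Sum>b<K. V (block p q b))\<bar>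
    \<le> 2 * real (N - K * p) * \<kappa> + real N * (2 * (\<Sum>k. c (k + q)))"
proof -
  let ?J = "{1..N}" and ?B = "\<Union>b<K. block p q b" and ?e = "\<lambda>i j. expectation (\<lambda>\<omega>. X i \<omega> * X j \<omega>)"
  have sub: "?B \<subseteq> ?J" using block_subset[OF K] by blast
  have fB: "finite ?B" using sub finite_row by blast
  have card: "card (?J - ?B) = N - K * p" "card ?B \<le> N"
    using card_Diff_subset[OF fB sub] card_blocks[OF q, of p K] card_mono[OF _ sub] by simp_all
  have sym: "?e i j = ?e j i" for i j by (simp add: mult.commute)
  have T: "(\<Sum>k. c (k + q)) \<ge> 0"
    using c_summable c_nonneg by (intro suminf_nonneg summable_ignore_initial_segment)
  have splitJ: "(\<Sum>j\<in>?J. g j) = (\<Sum>j\<in>?J - ?B. g j) + (\<Sum>j\<in>?B. g j)" for g :: "nat \<Rightarrow> real"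
    using sub by (intro sum.subset_diff) auto
  have "V ?J = (\<Sum>i\<in>?J - ?B. \<Sum>j\<in>?J. ?e i j) + (\<Sum>i\<in>?B. \<Sum>j\<in>?J. ?e i j)"
    unfolding V_eq[OF subset_refl] by (rule splitJ)
  also have "(\<Sum>i\<in>?B. \<Sum>j\<in>?J. ?e i j) = (\<Sum>i\<in>?B. \<Sum>j\<in>?J - ?B. ?e i j) + (\<Sum>i\<in>?B. \<Sum>j\<in>?B. ?e i j)"
    by (simp only: splitJ sum.distrib)
  also have "(\<Sum>i\<in>?B. \<Sum>j\<in>?J - ?B. ?e i j) = (\<Sum>i\<in>?J - ?B. \<Sum>j\<in>?B. ?e i j)"
    by (subst sum.swap, intro sum.cong refl sym)
  also have "(\<Sum>i\<in>?B. \<Sum>j\<in>?B. ?e i j) = (\<Sum>b<K. V (block p q b)) +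
      (\<Sum>b<K. \<Sum>i\<in>block p q b. \<Sum>j\<in>?B - block p q b. ?e i j)"
  proof -
    have "(\<Sum>i\<in>?B. \<Sum>j\<in>?B. ?e i j) = (\<Sum>b<K. \<Sum>i\<in>block p q b. \<Sum>j\<in>?B. ?e i j)"
      by (rule sum_blocks[OF q])
    also have "\<dots> = (\<Sum>b<K. \<Sum>i\<in>block p q b. (\<Sum>j\<in>?B - block p q b. ?e i j) + (\<Sum>j\<in>block p q b. ?e i j))"
      using fB by (intro sum.cong refl sum.subset_diff) auto
    also have "\<dots> = (\<Sum>b<K. V (block p q b)) +
      (\<Sum>b<K. \<Sum>i\<in>block p q b. \<Sum>j\<in>?B - block p q b. ?e i j)"
      using block_subset[OF K] by (simp add: V_eq sum.distrib)
    finally show ?thesis .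
  qed
  finally have "\<bar>V ?J - (\<Sum>b<K. V (block p q b))\<bar> \<le> \<bar>\<Sum>i\<in>?J - ?B. \<Sum>j\<in>?J. ?e i j\<bar>
      + \<bar>\<Sum>i\<in>?J - ?B. \<Sum>j\<in>?B. ?e i j\<bar> + \<bar>\<Sum>b<K. \<Sum>i\<in>block p q b. \<Sum>j\<in>?B - block p q b. ?e i j\<bar>"
    by linarith
  also have "\<bar>\<Sum>i\<in>?J - ?B. \<Sum>j\<in>?J. ?e i j\<bar> \<le> (\<Sum>i\<in>?J - ?B. \<kappa>)"
    by (intro order_trans[OF sum_abs] sum_mono sum_cov_le) auto
  also have "\<bar>\<Sum>i\<in>?J - ?B. \<Sum>j\<in>?B. ?e i j\<bar> \<le> (\<Sum>i\<in>?J - ?B. \<kappa>)"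
    using sub by (intro order_trans[OF sum_abs] sum_mono sum_cov_le) auto
  also have "\<bar>\<Sum>b<K. \<Sum>i\<in>block p q b. \<Sum>j\<in>?B - block p q b. ?e i j\<bar>
      \<le> (\<Sum>b<K. \<Sum>i\<in>block p q b. 2 * (\<Sum>k. c (k + q)))"
  proof (rule order_trans[OF sum_abs], rule sum_mono, rule order_trans[OF sum_abs], rule sum_mono)
    fix b i assume *: "b \<in> {..<K}" "i \<in> block p q b"
    show "\<bar>\<Sum>j\<in>?B - block p q b. ?e i j\<bar> \<le> 2 * (\<Sum>k. c (k + q))"
    proof (rule sum_cov_far_le)
      fix j assume "j \<in> ?B - block p q b"
      then obtain b' where "j \<in> block p q b'" "b \<noteq> b'" by auto
      then show "q \<le> (i - j) + (j - i)"
        using block_separated[of i p q b j b'] block_separated[of j p q b' i b] *(2)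
        by (cases b b' rule: linorder_cases) auto
    qed (use sub * in blast)+
  qed
  also have "\<dots> = real (K * p) * (2 * (\<Sum>k. c (k + q)))" by (simp add: card_block)
  also have "\<dots> \<le> real N * (2 * (\<Sum>k. c (k + q)))"
    using card(2) card_blocks[OF q, of p K] T by (intro mult_right_mono) (auto simp del: of_nat_mult)
  finally show ?thesis unfolding sum_constant card(1) by (simp only: mult.assoc mult_2 distrib_right add.assoc)
qed

text \<open>
  The four error terms come from dropping the indices outside the blocks, from decoupling the
  blocks, from the Taylor expansion in each block, and from replacing the sum of the variances of
  the blocks by the total variance.
\<close>

lemma char_bound:
  assumes p: "p \<ge> 1" and q: "q \<ge> 1"
  defines "K \<equiv> N div (p + q)"
  defines "r \<equiv> real (K * q + (p + q))"
  shows "norm (expectation (\<lambda>\<omega>. iexp (t * S {1..N} \<omega>)) - exp (- (t\<^sup>2 * V {1..N} / 2)))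
    \<le> \<bar>t\<bar> * sqrt (r * \<kappa>) + real K * c q
      + real K * (\<bar>t\<bar> ^ 3 * real p ^ 2 * \<kappa> / 6 + t ^ 4 * real p ^ 2 * \<kappa>\<^sup>2 / 8)
      + t\<^sup>2 / 2 * (2 * r * \<kappa> + real N * (2 * (\<Sum>k. c (k + q))))"
proof -
  let ?B = "\<Union>b<K. block p q b" and ?E = "\<lambda>J. expectation (\<lambda>\<omega>. iexp (t * S J \<omega>))"
  have K: "K * (p + q) \<le> N" unfolding K_def by simp
  \<comment> \<open>After \<open>K\<close> full periods less than one period is left. The indices
    outside the blocks are therefore the \<open>K\<close> gaps and this remainder, which
    \<open>r\<close> bounds.\<close>
  have "N < K * (p + q) + (p + q)"
    unfolding K_def using p by (metis add.commute add_is_0 div_mult_mod_eq mod_less_divisor nat_add_left_cancel_less neq0_conv not_one_le_zero)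
  then have "N - K * p \<le> K * q + (p + q)" by (simp add: algebra_simps)
  then have rest: "real (N - K * p) \<le> r" unfolding r_def by (simp only: of_nat_le_iff)
  have sub: "?B \<subseteq> {1..N}" using block_subset[OF K] by blast
  have "card ({1..N} - ?B) = N - K * p"
    using card_Diff_subset[OF finite_row[OF sub] sub] card_blocks[OF q, of p K] by simp
  then have "norm (?E {1..N} - ?E ?B) \<le> \<bar>t\<bar> * sqrt (real (N - K * p) * \<kappa>)"
    using drop_indices[OF subset_refl sub, of t] by simp
  also have "\<dots> \<le> \<bar>t\<bar> * sqrt (r * \<kappa>)"
    using rest \<kappa>_nonneg by (intro mult_left_mono real_sqrt_le_mono mult_right_mono) auto
  finally have 1: "norm (?E {1..N} - ?E ?B) \<le> \<bar>t\<bar> * sqrt (r * \<kappa>)" .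
  have 2: "norm (?E ?B - (\<Prod>b<K. ?E (block p q b))) \<le> real K * c q"
    by (rule char_blocks[OF q K])
  \<comment> \<open>All factors have norm at most 1, so the difference of the products is at most
    the sum of the differences of the factors.\<close>
  have "norm ((\<Prod>b<K. ?E (block p q b)) - (\<Prod>b<K. complex_of_real (exp (- (t\<^sup>2 * V (block p q b) / 2)))))
      \<le> (\<Sum>b<K. norm (?E (block p q b) - complex_of_real (exp (- (t\<^sup>2 * V (block p q b) / 2)))))"
    using block_subset[OF K] V_nonneg by (intro norm_prod_diff norm_char_le) auto
  also have "\<dots> \<le> (\<Sum>b<K. \<bar>t\<bar> ^ 3 * real p ^ 2 * \<kappa> / 6 + t ^ 4 * real p ^ 2 * \<kappa>\<^sup>2 / 8)"
    using block_subset[OF K] by (intro sum_mono char_taylor) (auto simp: card_block)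
  also have "(\<Prod>b<K. complex_of_real (exp (- (t\<^sup>2 * V (block p q b) / 2)))) =
      complex_of_real (exp (- (t\<^sup>2 * (\<Sum>b<K. V (block p q b)) / 2)))"
  proof -
    have "- (t\<^sup>2 * (\<Sum>b<K. V (block p q b)) / 2) = (\<Sum>b<K. - (t\<^sup>2 * V (block p q b) / 2))"
      by (simp add: sum_distrib_left sum_divide_distrib sum_negf)
    then show ?thesis by (simp only: exp_sum finite_lessThan of_real_prod)
  qed
  finally have 3: "norm ((\<Prod>b<K. ?E (block p q b)) - complex_of_real (exp (- (t\<^sup>2 * (\<Sum>b<K. V (block p q b)) / 2))))
      \<le> real K * (\<bar>t\<bar> ^ 3 * real p ^ 2 * \<kappa> / 6 + t ^ 4 * real p ^ 2 * \<kappa>\<^sup>2 / 8)"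
    by simp
  have "\<bar>exp (- (t\<^sup>2 * (\<Sum>b<K. V (block p q b)) / 2)) - exp (- (t\<^sup>2 * V {1..N} / 2))\<bar>
     \<le> \<bar>t\<^sup>2 * (\<Sum>b<K. V (block p q b)) / 2 - t\<^sup>2 * V {1..N} / 2\<bar>"
    using V_nonneg by (intro abs_exp_minus_diff_le) (auto intro!: sum_nonneg mult_nonneg_nonneg)
  also have "\<dots> = t\<^sup>2 / 2 * \<bar>V {1..N} - (\<Sum>b<K. V (block p q b))\<bar>"
  proof -
    have "t\<^sup>2 * (\<Sum>b<K. V (block p q b)) / 2 - t\<^sup>2 * V {1..N} / 2
        = - (t\<^sup>2 / 2 * (V {1..N} - (\<Sum>b<K. V (block p q b))))" by (simp add: algebra_simps)
    then show ?thesis by (simp only: abs_minus abs_mult abs_of_nonneg[of "t\<^sup>2 / 2"] zero_le_power2 divide_nonneg_pos zero_less_numeral)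
  qed
  also have "\<dots> \<le> t\<^sup>2 / 2 * (2 * real (N - K * p) * \<kappa> + real N * (2 * (\<Sum>k. c (k + q))))"
    by (intro mult_left_mono V_blocks q K) auto
  also have "\<dots> \<le> t\<^sup>2 / 2 * (2 * r * \<kappa> + real N * (2 * (\<Sum>k. c (k + q))))"
    using rest \<kappa>_nonneg by (intro mult_left_mono add_right_mono mult_right_mono) auto
  finally have 4: "norm (complex_of_real (exp (- (t\<^sup>2 * (\<Sum>b<K. V (block p q b)) / 2)))
      - complex_of_real (exp (- (t\<^sup>2 * V {1..N} / 2))))
      \<le> t\<^sup>2 / 2 * (2 * r * \<kappa> + real N * (2 * (\<Sum>k. c (k + q))))"
    by (metis norm_of_real of_real_diff)
  have tri: "norm (a - e) \<le> norm (a - b) + norm (b - c') + norm (c' - d) + norm (d - e)" for a b c' d e :: complex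
    by norm
  show ?thesis
    by (rule order_trans[OF tri add_mono[OF add_mono[OF add_mono[OF 1 2] 3] 4]])
qed

end

section \<open>The central limit theorem for mixing rows\<close>

lemma char_centered_gaussian:
  assumes "v \<ge> 0"
  shows "char (centered_gaussian v) t = exp (- (t\<^sup>2 * v / 2))"
proof (cases "v = 0")
  case True
  then show ?thesis by (simp add: centered_gaussian_def char_def integral_return)
next
  case False
  then have v: "sqrt v > 0" using assms by simp
  interpret std: prob_space std_normal_distribution by (rule prob_space_normal_density) simp
  have "distributed std_normal_distribution lborel (\<lambda>x. x) std_normal_density"
    by (auto simp: distributed_def distr_id2 simp flip: sets_lborel)
  from std.normal_density_affine[OF this, of "sqrt v" 0] v
  have *: "distributed std_normal_distribution lborel (\<lambda>x. sqrt v * x) (normal_density 0 (sqrt v))"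
    by simp
  have "centered_gaussian v = distr std_normal_distribution borel (\<lambda>x. sqrt v * x)"
    using distributed_distr_eq_density[OF *] False by (simp add: centered_gaussian_def cong: distr_cong)
  then have "char (centered_gaussian v) t = (CLINT x | std_normal_distribution. iexp (t * (sqrt v * x)))"
    unfolding char_def by (simp add: integral_distr)
  also have "\<dots> = char std_normal_distribution (t * sqrt v)"
    unfolding char_def by (simp add: mult.assoc)
  also have "\<dots> = exp (- (t\<^sup>2 * v / 2))"
    using assms unfolding char_std_normal_distribution by (simp add: power_mult_distrib)
  finally show ?thesis .
qed

lemma real_distribution_centered_gaussian: "v \<ge> 0 \<Longrightarrow> real_distribution (centered_gaussian v)"
proof -
  assume "v \<ge> 0"
  then have "prob_space (centered_gaussian v)"
    unfolding centered_gaussian_def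
    by (auto intro!: prob_space_return prob_space_normal_density)
  then show ?thesis
    by (auto simp: real_distribution_def real_distribution_axioms_def centered_gaussian_def)
qed

text \<open>
  Evaluates \<open>mixing_row.char_bound\<close> for blocks of length about \<open>e \<surd>n\<close> with gaps of length about
  \<open>e\<^sup>2 \<surd>n\<close>: as \<open>n \<rightarrow> \<infinity>\<close> with \<open>e\<close> fixed, the limit of the right-hand side is of order \<open>\<surd>e\<close>.
\<close>

lemma block_rate_bounds:
  fixes e \<kappa> t cq T :: real and n N p q :: nat
  assumes e: "0 < e" "e \<le> 1" and n: "n \<ge> 1" and N: "N \<le> 2 * n" and \<kappa>: "\<kappa> \<ge> 0" and cq: "cq \<ge> 0" and T: "T \<ge> 0"
    and p: "e * sqrt n \<le> p" "p \<le> e * sqrt n + 1" and q: "e\<^sup>2 * sqrt n \<le> q" "q \<le> e\<^sup>2 * sqrt n + 1"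
  defines "K \<equiv> N div (p + q)" and "\<tau> \<equiv> t / sqrt (2 * real n)"
  defines "r \<equiv> real (K * q + (p + q))" and "B \<equiv> e + (1 / e + 2) / sqrt n + 1 / n"
  shows "\<bar>\<tau>\<bar> * sqrt (r * \<kappa>) + real K * cq
      + real K * (\<bar>\<tau>\<bar> ^ 3 * real p ^ 2 * \<kappa> / 6 + \<tau> ^ 4 * real p ^ 2 * \<kappa>\<^sup>2 / 8)
      + \<tau>\<^sup>2 / 2 * (2 * r * \<kappa> + real N * (2 * T))
    \<le> \<bar>t\<bar> * sqrt (B * \<kappa>) + 2 / e ^ 3 * (q * cq)
      + (\<bar>t\<bar> ^ 3 * \<kappa> / 6 * (e + 1 / sqrt n) + t ^ 4 * \<kappa>\<^sup>2 / 8 * ((e + 1 / sqrt n) / sqrt n))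
      + t\<^sup>2 * (B * \<kappa> + T)"
proof -
  define x where "x = sqrt n"
  have x: "x \<ge> 1" "x * x = n" "x > 0" "x\<^sup>2 = n" using n by (auto simp: x_def)
  have ppos: "real p > 0" using p(1) e x by (smt (verit) mult_pos_pos x_def)
  have "real K * (real p + real q) \<le> real N"
    unfolding K_def using of_nat_mono[OF div_times_less_eq_dividend[of N "p + q"], where ?'a = real] by simp
  then have KN: "real K * (real p + real q) \<le> 2 * n" using N by linarith
  have Kp: "real K * p \<le> 2 * n" using KN by (smt (verit) mult_left_mono of_nat_0_le_iff)
  have Kx: "real K \<le> 2 * x / e"
  proof -
    have "real K * (e * x) \<le> real K * p" using p by (intro mult_left_mono) (auto simp: x_def)
    also have "\<dots> \<le> 2 * (x * x)" using Kp x by simp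
    finally have "(real K * e) * x \<le> (2 * x) * x" by (simp add: mult_ac)
    then have "real K * e \<le> 2 * x" using x by (simp add: mult_le_cancel_right)
    then show ?thesis using e by (simp add: field_simps)
  qed
  \<comment> \<open>The gaps fill a fraction of about \<open>e\<close> of the row: at most
    \<open>2 * x / e\<close> of them, each of length about \<open>e\<^sup>2 * x\<close>. The other
    terms of \<open>B\<close> absorb the rounding of the lengths and the incomplete last
    period.\<close>
  have r: "r \<le> 2 * n * B"
  proof -
    have "real K * q \<le> 2 * x / e * (e\<^sup>2 * x + 1)"
      using Kx q e x by (intro mult_mono) (auto simp: x_def)
    also have "\<dots> = 2 * e * (x * x) + 2 * x / e" using e by (simp add: field_simps power2_eq_square)
    finally have "r \<le> 2 * e * (x * x) + 2 * x / e + (e * x + 1) + (e\<^sup>2 * x + 1)"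
      unfolding r_def using p q by (simp add: x_def)
    also have "e * x \<le> 1 * x" using e x by (intro mult_right_mono) auto
    also have "e\<^sup>2 * x \<le> 1 * x" using e x by (intro mult_right_mono) (auto simp: power_le_one)
    finally have "r \<le> 2 * e * (x * x) + 2 * x / e + 2 * x + 2" by simp
    also have "\<dots> \<le> 2 * e * (x * x) + 2 * x / e + 4 * x + 2" using x by simp
    also have "\<dots> = 2 * (x * x) * (e + (1 / e + 2) / x + 1 / (x * x))"
      using x(3) by (simp add: field_simps)
    finally show ?thesis unfolding B_def x_def[symmetric] using x by (simp add: mult.assoc)
  qed
  have B: "B \<ge> 0" using e by (auto simp: B_def)
  have sq: "sqrt (2 * real n) \<ge> x" "sqrt (2 * real n) > 0" "(sqrt (2 * real n))\<^sup>2 = 2 * n" "\<tau>\<^sup>2 = t\<^sup>2 / (2 * n)"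
    using n by (auto simp: x_def \<tau>_def power_divide)
  have r0: "r \<ge> 0" by (simp add: r_def)
  have "\<bar>\<tau>\<bar> * sqrt (r * \<kappa>) \<le> \<bar>\<tau>\<bar> * sqrt (2 * n * B * \<kappa>)"
    using r \<kappa> by (intro mult_left_mono real_sqrt_le_mono mult_right_mono) auto
  also have "\<dots> = \<bar>t\<bar> * sqrt (B * \<kappa>)"
    using sq n by (simp add: \<tau>_def abs_divide real_sqrt_mult)
  finally have 1: "\<bar>\<tau>\<bar> * sqrt (r * \<kappa>) \<le> \<bar>t\<bar> * sqrt (B * \<kappa>)" .
  \<comment> \<open>The number of blocks is expressed through the gap length, so that the decoupling
    cost takes the form \<open>q * cq\<close>, to which the hypothesis that \<open>k * c k\<close>
    vanishes applies.\<close>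
  have "real K \<le> 2 / e ^ 3 * q"
  proof -
    have "real K \<le> 2 / e ^ 3 * (e\<^sup>2 * x)" using Kx e by (simp add: field_simps eval_nat_numeral)
    also have "\<dots> \<le> 2 / e ^ 3 * q" using q e by (intro mult_left_mono) (auto simp: x_def)
    finally show ?thesis .
  qed
  then have 2: "real K * cq \<le> 2 / e ^ 3 * (q * cq)"
    using mult_right_mono[of _ _ cq] cq by (simp only: mult.assoc[symmetric])
  have pn: "p / x \<le> e + 1 / x" using p x by (simp add: field_simps x_def)
  \<comment> \<open>Of the two factors \<open>p\<close>, one combines with \<open>K\<close> into at
    most \<open>2 * n\<close>, which cancels against \<open>\<tau>\<^sup>2\<close>. What remains is
    of order \<bar>\<tau>\<bar> p, that is \<open>e\<close>, for the cubic term, and of order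
    \<open>e / x\<close> for the quartic one.\<close>
  have 3: "real K * (\<bar>\<tau>\<bar> ^ 3 * real p ^ 2 * \<kappa> / 6 + \<tau> ^ 4 * real p ^ 2 * \<kappa>\<^sup>2 / 8)
    \<le> (\<bar>t\<bar> ^ 3 * \<kappa> / 6 * (e + 1 / x) + t ^ 4 * \<kappa>\<^sup>2 / 8 * ((e + 1 / x) / x))"
  proof -
    have "real K * (\<bar>\<tau>\<bar> ^ 3 * real p ^ 2 * \<kappa> / 6 + \<tau> ^ 4 * real p ^ 2 * \<kappa>\<^sup>2 / 8)
       = (real K * p) * (p * (\<bar>\<tau>\<bar> ^ 3 * \<kappa> / 6 + \<tau> ^ 4 * \<kappa>\<^sup>2 / 8))"
      by (simp add: algebra_simps power2_eq_square)
    also have "\<dots> \<le> (2 * n) * (p * (\<bar>\<tau>\<bar> ^ 3 * \<kappa> / 6 + \<tau> ^ 4 * \<kappa>\<^sup>2 / 8))"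
      using Kp \<kappa> by (intro mult_right_mono) auto
    also have "\<dots> = (2 * n * \<tau>\<^sup>2) * (\<bar>\<tau>\<bar> * p * \<kappa> / 6) + (2 * n * \<tau>\<^sup>2) * (\<tau>\<^sup>2 * p * \<kappa>\<^sup>2 / 8)"
      by (simp add: algebra_simps eval_nat_numeral)
    also have "2 * n * \<tau>\<^sup>2 = t\<^sup>2" using n sq by simp
    also have "t\<^sup>2 * (\<bar>\<tau>\<bar> * p * \<kappa> / 6) + t\<^sup>2 * (\<tau>\<^sup>2 * p * \<kappa>\<^sup>2 / 8)
      \<le> t\<^sup>2 * (\<bar>t\<bar> * (e + 1 / x) * \<kappa> / 6) + t\<^sup>2 * (t\<^sup>2 * ((e + 1 / x) / x) * \<kappa>\<^sup>2 / 8)"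
    proof (intro add_mono mult_left_mono)
      have "\<bar>\<tau>\<bar> * p \<le> \<bar>t\<bar> / x * p"
        using sq x unfolding \<tau>_def by (intro mult_right_mono) (auto simp: abs_divide intro!: divide_left_mono)
      also have "\<dots> = \<bar>t\<bar> * (p / x)" by simp
      also have "\<dots> \<le> \<bar>t\<bar> * (e + 1 / x)" using pn by (intro mult_left_mono) auto
      finally show "\<bar>\<tau>\<bar> * p * \<kappa> / 6 \<le> \<bar>t\<bar> * (e + 1 / x) * \<kappa> / 6"
        using \<kappa> by (intro divide_right_mono mult_right_mono) auto
      have "\<tau>\<^sup>2 * p \<le> t\<^sup>2 / (x * x) * p"
        using sq x n by (intro mult_right_mono) (auto intro!: divide_left_mono)
      also have "\<dots> = t\<^sup>2 * ((p / x) / x)" by simp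
      also have "\<dots> \<le> t\<^sup>2 * ((e + 1 / x) / x)" using pn x by (intro mult_left_mono divide_right_mono) auto
      finally show "\<tau>\<^sup>2 * p * \<kappa>\<^sup>2 / 8 \<le> t\<^sup>2 * ((e + 1 / x) / x) * \<kappa>\<^sup>2 / 8"
        by (intro divide_right_mono mult_right_mono) auto
    qed auto
    also have "\<dots> = \<bar>t\<bar> ^ 3 * \<kappa> / 6 * (e + 1 / x) + t ^ 4 * \<kappa>\<^sup>2 / 8 * ((e + 1 / x) / x)"
    proof -
      have "t\<^sup>2 * \<bar>t\<bar> = \<bar>t\<bar> ^ 3" "t\<^sup>2 * t\<^sup>2 = t ^ 4" by (simp_all add: power2_eq_square power3_eq_cube power4_eq_xxxx)
      moreover have "t\<^sup>2 * (\<bar>t\<bar> * A * \<kappa> / 6) + t\<^sup>2 * (t\<^sup>2 * Q * \<kappa>\<^sup>2 / 8)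
          = (t\<^sup>2 * \<bar>t\<bar>) * \<kappa> / 6 * A + (t\<^sup>2 * t\<^sup>2) * \<kappa>\<^sup>2 / 8 * Q" for A Q
        by (simp add: mult_ac)
      ultimately show ?thesis by (simp only:)
    qed
    finally show ?thesis .
  qed
  have 4: "\<tau>\<^sup>2 / 2 * (2 * r * \<kappa> + real N * (2 * T)) \<le> t\<^sup>2 * (B * \<kappa> + T)"
  proof -
    have "\<tau>\<^sup>2 / 2 * (2 * r * \<kappa> + real N * (2 * T)) \<le> \<tau>\<^sup>2 / 2 * (2 * (2 * n * B) * \<kappa> + (2 * n) * (2 * T))"
      using r \<kappa> T N by (intro mult_left_mono add_mono mult_right_mono) auto
    also have "\<dots> = (2 * n * \<tau>\<^sup>2) * (B * \<kappa> + T)" by (simp add: algebra_simps)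
    finally show ?thesis using sq n by simp
  qed
  show ?thesis using 1 2 3 4 unfolding x_def by linarith
qed


text \<open>Each row is compared with the Gaussian law of the variance of that same row; the limit
  of the variances is needed only once this is done. \<open>e\<close> is not chosen as a function of
  \<open>n\<close>: for fixed \<open>e\<close> the error has an explicit limit, and this limit is
  then made small.\<close>

lemma char_rows_tendsto:
  fixes P :: "nat \<Rightarrow> 'b measure" and X :: "nat \<Rightarrow> nat \<Rightarrow> 'b \<Rightarrow> real" and N :: "nat \<Rightarrow> nat"
  assumes rows: "\<And>n. n \<ge> 1 \<Longrightarrow> mixing_row (P n) (X n) (N n) c"
    and N: "\<And>n. N n \<le> 2 * n"
    and c0: "(\<lambda>k. real k * c k) \<longlonglongrightarrow> 0"
    and var: "(\<lambda>n. mixing_row.V (P n) (X n) {1..N n} / (2 * real n)) \<longlonglongrightarrow> v"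
  shows "(\<lambda>n. \<integral>\<omega>. iexp (t / sqrt (2 * real n) * (\<Sum>i\<in>{1..N n}. X n i \<omega>)) \<partial>P n)
    \<longlonglongrightarrow> complex_of_real (exp (- (t\<^sup>2 * v / 2)))"
proof -
  interpret r1: mixing_row "P 1" "X 1" "N 1" c by (rule rows) simp
  define \<eta> where "\<eta> = 2 * suminf c"
  define T where "T q = (\<Sum>k. c (k + q))" for q
  define U where "U n = mixing_row.V (P n) (X n) {1..N n}" for n
  define \<phi> where "\<phi> n = (\<integral>\<omega>. iexp (t / sqrt (2 * real n) * (\<Sum>i\<in>{1..N n}. X n i \<omega>)) \<partial>P n)" for n
  define p q where "p e n = nat \<lceil>e * sqrt (real n)\<rceil>" and "q e n = nat \<lceil>e\<^sup>2 * sqrt (real n)\<rceil>" for e :: real and n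
  define B where "B e n = e + (1 / e + 2) / sqrt (real n) + 1 / real n" for e n
  define R where "R e n = \<bar>t\<bar> * sqrt (B e n * \<eta>) + 2 / e ^ 3 * (q e n * c (q e n))
      + (\<bar>t\<bar> ^ 3 * \<eta> / 6 * (e + 1 / sqrt n) + t ^ 4 * \<eta>\<^sup>2 / 8 * ((e + 1 / sqrt n) / sqrt n))
      + t\<^sup>2 * (B e n * \<eta> + T (q e n))" for e n
  have \<eta>: "\<eta> \<ge> 0" using r1.\<kappa>_nonneg by (simp add: r1.\<kappa>_def \<eta>_def)
  have T: "T q \<ge> 0" for q
    unfolding T_def using r1.c_summable r1.c_nonneg by (intro suminf_nonneg summable_ignore_initial_segment)
  have bound: "norm (\<phi> n - exp (- (t\<^sup>2 * (U n / (2 * real n)) / 2))) \<le> R e n"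
    if e: "0 < e" "e \<le> 1" and n: "n \<ge> 1" for e n
  proof -
    interpret mixing_row "P n" "X n" "N n" c by (rule rows[OF n])
    have pos: "0 < e * sqrt n" "0 < e\<^sup>2 * sqrt n" using e n by auto
    have p: "e * sqrt n \<le> p e n" "p e n \<le> e * sqrt n + 1" "p e n \<ge> 1"
      using pos unfolding p_def by linarith+
    have q: "e\<^sup>2 * sqrt n \<le> q e n" "q e n \<le> e\<^sup>2 * sqrt n + 1" "q e n \<ge> 1"
      using pos unfolding q_def by linarith+
    have eq: "t\<^sup>2 * (U n / (2 * real n)) / 2 = (t / sqrt (2 * real n))\<^sup>2 * mixing_row.V (P n) (X n) {1..N n} / 2"
      using n by (simp add: U_def power_divide del: One_nat_def)
    have "norm (\<phi> n - exp (- (t\<^sup>2 * (U n / (2 * real n)) / 2)))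
        \<le> \<bar>t / sqrt (2 * real n)\<bar> * sqrt (real (N n div (p e n + q e n) * q e n + (p e n + q e n)) * \<eta>)
          + real (N n div (p e n + q e n)) * c (q e n)
          + real (N n div (p e n + q e n)) * (\<bar>t / sqrt (2 * real n)\<bar> ^ 3 * real (p e n) ^ 2 * \<eta> / 6
              + (t / sqrt (2 * real n)) ^ 4 * real (p e n) ^ 2 * \<eta>\<^sup>2 / 8)
          + (t / sqrt (2 * real n))\<^sup>2 / 2 * (2 * real (N n div (p e n + q e n) * q e n + (p e n + q e n)) * \<eta>
              + real (N n) * (2 * T (q e n)))"
      using char_bound[OF p(3) q(3), of "t / sqrt (2 * real n)"]
      unfolding eq \<phi>_def S_def \<kappa>_def \<eta>_def[symmetric] T_def[symmetric]
      by (simp only: of_real_exp of_real_minus)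
    also have "\<dots> \<le> R e n"
      unfolding R_def B_def
      by (rule block_rate_bounds[OF e n N \<eta> c_nonneg T p(1,2) q(1,2)])
    finally show ?thesis .
  qed
  \<comment> \<open>What survives of the bound as \<open>n\<close> grows: the indices dropped with
    the gaps, the cubic Taylor remainder, and the variance carried by the gaps.\<close>
  define H where "H e = \<bar>t\<bar> * sqrt (e * \<eta>) + \<bar>t\<bar> ^ 3 * \<eta> / 6 * e + t\<^sup>2 * (e * \<eta>)" for e
  have RH: "R e \<longlonglongrightarrow> H e" if e: "e > 0" for e
  proof -
    have s0: "(\<lambda>n. 1 / sqrt (real n)) \<longlonglongrightarrow> 0" and i0: "(\<lambda>n. 1 / real n) \<longlonglongrightarrow> 0"
      by real_asymp+
    have q_top: "filterlim (q e) at_top sequentially"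
      unfolding filterlim_at_top
    proof
      fix Z
      have "filterlim (\<lambda>n. e\<^sup>2 * sqrt (real n)) at_top sequentially" using e by real_asymp
      then have "\<forall>\<^sub>F n in sequentially. real Z \<le> e\<^sup>2 * sqrt (real n)" unfolding filterlim_at_top by blast
      then show "\<forall>\<^sub>F n in sequentially. Z \<le> q e n" by eventually_elim (unfold q_def, linarith)
    qed
    have qc: "(\<lambda>n. real (q e n) * c (q e n)) \<longlonglongrightarrow> 0"
      by (rule filterlim_compose[OF c0 q_top])
    have Tq: "(\<lambda>n. T (q e n)) \<longlonglongrightarrow> 0"
      unfolding T_def by (rule filterlim_compose[OF suminf_exist_split2[OF r1.c_summable] q_top])
    have Be: "B e \<longlonglongrightarrow> e + (1 / e + 2) * 0 + 0"
      unfolding B_def using tendsto_add[OF tendsto_add[OF tendsto_const tendsto_mult[OF tendsto_const s0]] i0] by simp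
    have "R e \<longlonglongrightarrow> \<bar>t\<bar> * sqrt ((e + (1 / e + 2) * 0 + 0) * \<eta>) + 2 / e ^ 3 * 0
      + (\<bar>t\<bar> ^ 3 * \<eta> / 6 * (e + 0) + t ^ 4 * \<eta>\<^sup>2 / 8 * ((e + 0) * 0))
      + t\<^sup>2 * ((e + (1 / e + 2) * 0 + 0) * \<eta> + 0)"
      unfolding R_def divide_inverse[of "e + 1 / sqrt _"] inverse_eq_divide[of "sqrt _"]
      by (intro tendsto_intros Be qc Tq s0)
    then show ?thesis by (simp add: H_def)
  qed
  have "(H \<longlongrightarrow> \<bar>t\<bar> * sqrt (0 * \<eta>) + \<bar>t\<bar> ^ 3 * \<eta> / 6 * 0 + t\<^sup>2 * (0 * \<eta>)) (at_right 0)"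
    unfolding H_def by (intro tendsto_intros)
  then have H0: "(H \<longlongrightarrow> 0) (at_right 0)" by simp
  have "(\<lambda>n. norm (\<phi> n - exp (- (t\<^sup>2 * (U n / (2 * real n)) / 2)))) \<longlonglongrightarrow> 0"
  proof (rule tendstoI)
    fix \<epsilon> :: real assume "\<epsilon> > 0"
    then have "\<forall>\<^sub>F e in at_right 0. H e < \<epsilon>" using order_tendstoD(2)[OF H0] by blast
    moreover have "\<forall>\<^sub>F e in at_right 0. e \<in> {0<..<(1::real)}" by (rule eventually_at_right_real) simp
    ultimately have "\<forall>\<^sub>F e in at_right 0. H e < \<epsilon> \<and> 0 < e \<and> e \<le> 1"
      by eventually_elim auto
    then obtain e where e: "H e < \<epsilon>" "0 < e" "e \<le> 1"
      using eventually_happens'[OF trivial_limit_at_right_real] by blast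
    have "\<forall>\<^sub>F n in sequentially. R e n < \<epsilon>" by (rule order_tendstoD(2)[OF RH[OF e(2)] e(1)])
    then show "\<forall>\<^sub>F n in sequentially. dist (norm (\<phi> n - exp (- (t\<^sup>2 * (U n / (2 * real n)) / 2)))) 0 < \<epsilon>"
    proof (rule eventually_mono[OF eventually_conj[OF _ eventually_ge_at_top[of 1]]])
      fix n :: nat assume *: "R e n < \<epsilon> \<and> 1 \<le> n"
      then have "norm (\<phi> n - exp (- (t\<^sup>2 * (U n / (2 * real n)) / 2))) \<le> R e n" using bound[OF e(2,3)] by blast
      with * show "dist (norm (\<phi> n - exp (- (t\<^sup>2 * (U n / (2 * real n)) / 2)))) 0 < \<epsilon>"
        unfolding dist_real_def diff_0_right abs_norm_cancel by linarith
    qed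
  qed
  then have "(\<lambda>n. \<phi> n - exp (- (t\<^sup>2 * (U n / (2 * real n)) / 2))) \<longlonglongrightarrow> 0"
    by (rule tendsto_norm_zero_cancel)
  moreover have "(\<lambda>n. complex_of_real (exp (- (t\<^sup>2 * (U n / (2 * real n)) / 2)))) \<longlonglongrightarrow> complex_of_real (exp (- (t\<^sup>2 * v / 2)))"
    using var unfolding U_def[symmetric] by (intro tendsto_intros) auto
  ultimately have "(\<lambda>n. (\<phi> n - exp (- (t\<^sup>2 * (U n / (2 * real n)) / 2))) + exp (- (t\<^sup>2 * (U n / (2 * real n)) / 2)))
      \<longlonglongrightarrow> 0 + complex_of_real (exp (- (t\<^sup>2 * v / 2)))"
    by (rule tendsto_add)
  then show ?thesis unfolding \<phi>_def by simp
qed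

text \<open>The continuity theorem wants every member of the sequence to be a distribution, so
  \<open>Z 0\<close> must be one as well, although it is identified with a normalised sum only from
  \<open>n = 1\<close> on.\<close>

theorem mixing_rows_weak_conv:
  fixes P :: "nat \<Rightarrow> 'b measure" and X :: "nat \<Rightarrow> nat \<Rightarrow> 'b \<Rightarrow> real" and N :: "nat \<Rightarrow> nat"
  assumes rows: "\<And>n. n \<ge> 1 \<Longrightarrow> mixing_row (P n) (X n) (N n) c"
    and N: "\<And>n. N n \<le> 2 * n"
    and c0: "(\<lambda>k. real k * c k) \<longlonglongrightarrow> 0"
    and var: "(\<lambda>n. mixing_row.V (P n) (X n) {1..N n} / (2 * real n)) \<longlonglongrightarrow> v"
    and Z: "\<And>n. real_distribution (Z n)"
    and Z_eq: "\<And>n. n \<ge> 1 \<Longrightarrow> Z n = distr (P n) borel (\<lambda>\<omega>. (\<Sum>i\<in>{1..N n}. X n i \<omega>) / sqrt (2 * real n))"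
  shows "weak_conv_m Z (centered_gaussian v)"
proof (rule levy_continuity[OF Z])
  have "v \<ge> 0"
  proof (rule tendsto_lowerbound[OF var])
    show "\<forall>\<^sub>F n in sequentially. 0 \<le> mixing_row.V (P n) (X n) {1..N n} / (2 * real n)"
      by (intro eventually_mono[OF eventually_ge_at_top[of 1]]) (simp add: mixing_row.V_nonneg[OF rows])
  qed simp
  then show "real_distribution (centered_gaussian v)" by (rule real_distribution_centered_gaussian)
  fix t
  have "char (Z n) t = (\<integral>\<omega>. iexp (t / sqrt (2 * real n) * (\<Sum>i\<in>{1..N n}. X n i \<omega>)) \<partial>P n)" if "n \<ge> 1" for n
  proof -
    interpret mixing_row "P n" "X n" "N n" c by (rule rows[OF that])
    have "(\<lambda>\<omega>. (\<Sum>i\<in>{1..N n}. X n i \<omega>) / sqrt (2 * real n)) \<in> borel_measurable (P n)"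
      by (intro borel_measurable_divide borel_measurable_sum X_meas borel_measurable_const)
    then show ?thesis unfolding Z_eq[OF that] char_def by (subst integral_distr) simp_all
  qed
  then have "\<forall>\<^sub>F n in sequentially. (\<integral>\<omega>. iexp (t / sqrt (2 * real n) * (\<Sum>i\<in>{1..N n}. X n i \<omega>)) \<partial>P n) = char (Z n) t"
    by (intro eventually_mono[OF eventually_ge_at_top[of 1]]) simp
  from Lim_transform_eventually[OF char_rows_tendsto[OF rows N c0 var] this] \<open>v \<ge> 0\<close>
  show "(\<lambda>n. char (Z n) t) \<longlonglongrightarrow> char (centered_gaussian v) t"
    by (simp add: char_centered_gaussian)
qed

section \<open>Covariance inequalities\<close>

lemma sum_of_bool_le_eq_floor:
  fixes y :: real assumes "0 \<le> y" "y \<le> real m"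
  shows "(\<Sum>j\<in>{1..m}. of_bool (real j \<le> y)) = real (nat \<lfloor>y\<rfloor>)"
proof -
  have "{j\<in>{1..m}. real j \<le> y} = {1..nat \<lfloor>y\<rfloor>}"
  proof (intro set_eqI iffI)
    fix j assume "j \<in> {1..nat \<lfloor>y\<rfloor>}"
    then have "1 \<le> j" "real j \<le> y" using assms by (auto simp: le_nat_floor le_nat_iff le_floor_iff)
    moreover from this have "j \<le> m" using assms(2) by linarith
    ultimately show "j \<in> {j\<in>{1..m}. real j \<le> y}" by simp
  qed (auto simp: le_nat_floor)
  moreover have "(\<Sum>j\<in>{1..m}. of_bool (real j \<le> y)) = (\<Sum>j\<in>{j\<in>{1..m}. real j \<le> y}. 1::real)"
    by (intro sum.mono_neutral_cong_right) auto
  ultimately show ?thesis by simp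
qed

text \<open>Here \<open>z\<close> is the value of \<open>x\<close> rounded down to a multiple of
  \<open>1 / m\<close>. Written as an average of \<open>m\<close> indicators of upper level sets, it
  reduces random variables to events.\<close>

lemma staircase_approx:
  fixes x :: real assumes "0 \<le> x" "x \<le> 1" "m \<ge> 1"
  defines "z \<equiv> (\<Sum>j\<in>{1..m}. of_bool (real j \<le> real m * x)) / real m"
  shows "0 \<le> z" "z \<le> 1" "\<bar>x - z\<bar> \<le> 1 / real m"
proof -
  have m: "real m > 0" using assms by simp
  have z: "z = real (nat \<lfloor>real m * x\<rfloor>) / real m"
    unfolding z_def using assms by (subst sum_of_bool_le_eq_floor) (auto intro: mult_left_le)
  have 0: "0 \<le> real m * x" using assms by simp
  then have *: "real (nat \<lfloor>real m * x\<rfloor>) \<le> real m * x" "real m * x \<le> real (nat \<lfloor>real m * x\<rfloor>) + 1"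
    by linarith+
  show "0 \<le> z" by (simp add: z)
  have zx: "z \<le> x" using * m by (simp add: z field_simps)
  then show "z \<le> 1" using assms(2) by (rule order_trans)
  have "x \<le> z + 1 / real m" using * m by (simp add: z field_simps)
  with zx show "\<bar>x - z\<bar> \<le> 1 / real m" by linarith
qed

lemma abs_mult_diff_le:
  fixes a b a' b' :: real
  assumes "\<bar>a - a'\<bar> \<le> e" "\<bar>b - b'\<bar> \<le> e" "0 \<le> b" "b \<le> 1" "0 \<le> a'" "a' \<le> 1"
  shows "\<bar>a * b - a' * b'\<bar> \<le> 2 * e"
proof -
  have "a * b - a' * b' = (a - a') * b + a' * (b - b')" by (simp add: algebra_simps)
  also have "\<bar>\<dots>\<bar> \<le> \<bar>a - a'\<bar> * \<bar>b\<bar> + \<bar>a'\<bar> * \<bar>b - b'\<bar>"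
    using abs_triangle_ineq[of "(a - a') * b" "a' * (b - b')"] by (simp add: abs_mult)
  also have "\<dots> \<le> e * 1 + 1 * e" using assms by (intro add_mono mult_mono) auto
  finally show ?thesis by simp
qed

context prob_space begin

lemma abs_expectation_diff_le:
  fixes f g :: "'a \<Rightarrow> real"
  assumes "integrable M f" "integrable M g" "\<And>\<omega>. \<omega> \<in> space M \<Longrightarrow> \<bar>f \<omega> - g \<omega>\<bar> \<le> B"
  shows "\<bar>expectation f - expectation g\<bar> \<le> B"
  using norm_expectation_le[of "\<lambda>\<omega>. f \<omega> - g \<omega>" B] assms by simp

end

locale sub_algebras = prob_space M for M :: "'a measure" +
  fixes G H :: "'a measure" and \<alpha> :: real
  assumes sub_G: "subalgebra M G" and sub_H: "subalgebra M H"
    and mixing: "A \<in> sets G \<Longrightarrow> B \<in> sets H \<Longrightarrow> \<bar>prob (A \<inter> B) - prob A * prob B\<bar> \<le> \<alpha>"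
begin

text \<open>Both variables are replaced by averages of indicators of their upper level sets.
  Covariance is bilinear, so that of the approximations is an average of \<open>m * m\<close>
  differences, each at most \<open>\<alpha>\<close> by mixing; no constant is lost except the
  rounding error, which vanishes with growing \<open>m\<close>.\<close>

lemma covariance_unit_le:
  assumes X: "X \<in> borel_measurable G" and Y: "Y \<in> borel_measurable H"
    and X01: "\<And>\<omega>. \<omega> \<in> space M \<Longrightarrow> 0 \<le> X \<omega> \<and> X \<omega> \<le> 1"
    and Y01: "\<And>\<omega>. \<omega> \<in> space M \<Longrightarrow> 0 \<le> Y \<omega> \<and> Y \<omega> \<le> (1::real)"
  shows "\<bar>expectation (\<lambda>\<omega>. X \<omega> * Y \<omega>) - expectation X * expectation Y\<bar> \<le> \<alpha>"
proof -
  have [measurable]: "X \<in> borel_measurable M" "Y \<in> borel_measurable M"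
    using measurable_from_subalg[OF sub_G X] measurable_from_subalg[OF sub_H Y] by auto
  have bound: "\<bar>expectation (\<lambda>\<omega>. X \<omega> * Y \<omega>) - expectation X * expectation Y\<bar> \<le> \<alpha> + 4 / real m"
    if m: "m \<ge> 1" for m
  proof -
    define A where "A j = {\<omega> \<in> space M. real j \<le> real m * X \<omega>}" for j :: nat
    define B where "B j = {\<omega> \<in> space M. real j \<le> real m * Y \<omega>}" for j :: nat
    have "A j = {\<omega> \<in> space G. real j \<le> real m * X \<omega>}" for j
      using sub_G by (simp add: A_def subalgebra_def)
    then have AG: "A j \<in> sets G" for j
      using borel_measurable_le[OF borel_measurable_const borel_measurable_times[OF borel_measurable_const X]] by simp
    have "B j = {\<omega> \<in> space H. real j \<le> real m * Y \<omega>}" for j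
      using sub_H by (simp add: B_def subalgebra_def)
    then have BH: "B j \<in> sets H" for j
      using borel_measurable_le[OF borel_measurable_const borel_measurable_times[OF borel_measurable_const Y]] by simp
    have [measurable]: "A j \<in> events" "B j \<in> events" for j
      using AG[of j] BH[of j] sub_G sub_H by (auto simp: subalgebra_def)
    define X' where "X' \<omega> = (\<Sum>j\<in>{1..m}. indicat_real (A j) \<omega>) / real m" for \<omega>
    define Y' where "Y' \<omega> = (\<Sum>j\<in>{1..m}. indicat_real (B j) \<omega>) / real m" for \<omega>
    have [measurable]: "X' \<in> borel_measurable M" "Y' \<in> borel_measurable M"
      unfolding X'_def[abs_def] Y'_def[abs_def] by measurable
    have X': "0 \<le> X' \<omega>" "X' \<omega> \<le> 1" "\<bar>X \<omega> - X' \<omega>\<bar> \<le> 1 / real m" if "\<omega> \<in> space M" for \<omega>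
      using staircase_approx[of "X \<omega>" m] X01[OF that] m that
      by (simp_all add: X'_def A_def indicator_def of_bool_def)
    have Y': "0 \<le> Y' \<omega>" "Y' \<omega> \<le> 1" "\<bar>Y \<omega> - Y' \<omega>\<bar> \<le> 1 / real m" if "\<omega> \<in> space M" for \<omega>
      using staircase_approx[of "Y \<omega>" m] Y01[OF that] m that
      by (simp_all add: Y'_def B_def indicator_def of_bool_def)
    have int: "integrable M X" "integrable M Y" "integrable M X'" "integrable M Y'"
      using X01 Y01 X' Y' by (auto intro!: integrable_bounded[where B=1])
    have int2: "integrable M (\<lambda>\<omega>. X \<omega> * Y \<omega>)" "integrable M (\<lambda>\<omega>. X' \<omega> * Y' \<omega>)"
      using X01 Y01 X' Y' by (auto intro!: integrable_bounded[where B=1] mult_le_one simp: abs_mult)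
    have 1: "\<bar>expectation (\<lambda>\<omega>. X \<omega> * Y \<omega>) - expectation (\<lambda>\<omega>. X' \<omega> * Y' \<omega>)\<bar> \<le> 2 * (1 / real m)"
      using int2 X' Y' X01 Y01 by (intro abs_expectation_diff_le abs_mult_diff_le) auto
    have unit: "0 \<le> expectation Z \<and> expectation Z \<le> 1"
      if "integrable M Z" "\<And>\<omega>. \<omega> \<in> space M \<Longrightarrow> 0 \<le> Z \<omega> \<and> Z \<omega> \<le> 1" for Z :: "'a \<Rightarrow> real"
      using that integral_le_const[OF that(1), of 1] integral_ge_const[OF that(1), of 0] by auto
    have 2: "\<bar>expectation X * expectation Y - expectation X' * expectation Y'\<bar> \<le> 2 * (1 / real m)"
      using int X' Y' X01 Y01 unit[of Y] unit[of X']
      by (intro abs_mult_diff_le abs_expectation_diff_le) auto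
    have ind: "integrable M (indicat_real C)" "expectation (indicat_real C) = prob C" if "C \<in> events" for C
      using that by (simp_all add: emeasure_eq_measure)
    have EX: "expectation X' = (\<Sum>j\<in>{1..m}. prob (A j)) / real m"
      unfolding X'_def integral_divide_zero by (subst Bochner_Integration.integral_sum) (simp_all only: ind \<open>\<And>j. A j \<in> events\<close>)
    have EY: "expectation Y' = (\<Sum>j\<in>{1..m}. prob (B j)) / real m"
      unfolding Y'_def integral_divide_zero by (subst Bochner_Integration.integral_sum) (simp_all only: ind \<open>\<And>j. B j \<in> events\<close>)
    have "expectation (\<lambda>\<omega>. X' \<omega> * Y' \<omega>)
        = expectation (\<lambda>\<omega>. (\<Sum>i\<in>{1..m}. \<Sum>j\<in>{1..m}. indicat_real (A i \<inter> B j) \<omega>) / (real m * real m))"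
      unfolding X'_def Y'_def by (simp add: sum_product indicator_inter_arith)
    also have "\<dots> = (\<Sum>i\<in>{1..m}. \<Sum>j\<in>{1..m}. prob (A i \<inter> B j)) / (real m * real m)"
      unfolding integral_divide_zero
      by (subst Bochner_Integration.integral_sum,
          force intro!: Bochner_Integration.integrable_sum simp: emeasure_eq_measure,
          subst Bochner_Integration.integral_sum)
        (simp_all only: ind sets.Int \<open>\<And>j. A j \<in> events\<close> \<open>\<And>j. B j \<in> events\<close>)
    finally have "expectation (\<lambda>\<omega>. X' \<omega> * Y' \<omega>) - expectation X' * expectation Y'
        = (\<Sum>i\<in>{1..m}. \<Sum>j\<in>{1..m}. prob (A i \<inter> B j) - prob (A i) * prob (B j)) / (real m * real m)"
      unfolding EX EY by (simp add: sum_product sum_subtractf diff_divide_distrib)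
    also have "\<bar>\<dots>\<bar> = \<bar>\<Sum>i\<in>{1..m}. \<Sum>j\<in>{1..m}. prob (A i \<inter> B j) - prob (A i) * prob (B j)\<bar> / (real m * real m)"
      by simp
    also have "\<dots> \<le> (\<Sum>i\<in>{1..m}. \<Sum>j\<in>{1..m}. \<alpha>) / (real m * real m)"
      using AG BH mixing
      by (intro divide_right_mono order_trans[OF sum_abs sum_mono[OF order_trans[OF sum_abs sum_mono]]]) auto
    also have "\<dots> = \<alpha>" using m by simp
    finally show ?thesis using 1 2 by linarith
  qed
  have "(\<lambda>m. \<alpha> + 4 / real m) \<longlonglongrightarrow> \<alpha> + 0"
    by (intro tendsto_intros lim_const_over_n)
  then show ?thesis
    using bound by (intro LIMSEQ_le_const[of "\<lambda>m. \<alpha> + 4 / real m"]) auto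
qed

text \<open>The affine map from [-1, 1] onto [0, 1] halves each variable and thus divides the
  covariance by 4.\<close>

lemma covariance_real_le:
  fixes X Y :: "'a \<Rightarrow> real"
  assumes X: "X \<in> borel_measurable G" and Y: "Y \<in> borel_measurable H"
    and X1: "\<And>\<omega>. \<omega> \<in> space M \<Longrightarrow> \<bar>X \<omega>\<bar> \<le> 1" and Y1: "\<And>\<omega>. \<omega> \<in> space M \<Longrightarrow> \<bar>Y \<omega>\<bar> \<le> 1"
  shows "\<bar>expectation (\<lambda>\<omega>. X \<omega> * Y \<omega>) - expectation X * expectation Y\<bar> \<le> 4 * \<alpha>"
proof -
  have [measurable]: "X \<in> borel_measurable M" "Y \<in> borel_measurable M"
    using measurable_from_subalg[OF sub_G X] measurable_from_subalg[OF sub_H Y] by auto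
  have int: "integrable M X" "integrable M Y" "integrable M (\<lambda>\<omega>. X \<omega> * Y \<omega>)"
    using X1 Y1 by (auto intro!: integrable_bounded[where B=1] mult_le_one simp: abs_mult)
  let ?X = "\<lambda>\<omega>. (X \<omega> + 1) / 2" and ?Y = "\<lambda>\<omega>. (Y \<omega> + 1) / 2"
  have "\<bar>expectation (\<lambda>\<omega>. ?X \<omega> * ?Y \<omega>) - expectation ?X * expectation ?Y\<bar> \<le> \<alpha>"
    using X Y X1 Y1 by (intro covariance_unit_le) (fastforce simp: abs_le_iff)+
  moreover have "expectation ?X = (expectation X + 1) / 2" "expectation ?Y = (expectation Y + 1) / 2"
    using int by (simp_all add: prob_space)
  moreover have "expectation (\<lambda>\<omega>. ?X \<omega> * ?Y \<omega>)
      = (expectation (\<lambda>\<omega>. X \<omega> * Y \<omega>) + expectation X + expectation Y + 1) / 4"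
  proof -
    have "(\<lambda>\<omega>. ?X \<omega> * ?Y \<omega>) = (\<lambda>\<omega>. (X \<omega> * Y \<omega> + X \<omega> + Y \<omega> + 1) / 4)" by (auto simp: field_simps)
    then show ?thesis using int by (simp add: prob_space)
  qed
  ultimately have "\<bar>(expectation (\<lambda>\<omega>. X \<omega> * Y \<omega>) + expectation X + expectation Y + 1) / 4
      - (expectation X + 1) / 2 * ((expectation Y + 1) / 2)\<bar> \<le> \<alpha>" by simp
  also have "(expectation (\<lambda>\<omega>. X \<omega> * Y \<omega>) + expectation X + expectation Y + 1) / 4
      - (expectation X + 1) / 2 * ((expectation Y + 1) / 2)
      = (expectation (\<lambda>\<omega>. X \<omega> * Y \<omega>) - expectation X * expectation Y) / 4"
    by (simp add: field_simps)
  finally show ?thesis by (simp add: abs_divide)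
qed

text \<open>Real and imaginary parts yield four real covariances of at most
  \<open>4 * \<alpha>\<close> each.\<close>

lemma covariance_complex_le:
  fixes X Y :: "'a \<Rightarrow> complex"
  assumes X: "X \<in> borel_measurable G" and Y: "Y \<in> borel_measurable H"
    and X1: "\<And>\<omega>. \<omega> \<in> space M \<Longrightarrow> norm (X \<omega>) \<le> 1" and Y1: "\<And>\<omega>. \<omega> \<in> space M \<Longrightarrow> norm (Y \<omega>) \<le> 1"
  shows "norm (expectation (\<lambda>\<omega>. X \<omega> * Y \<omega>) - expectation X * expectation Y) \<le> 16 * \<alpha>"
proof -
  have [measurable]: "X \<in> borel_measurable M" "Y \<in> borel_measurable M"
    using measurable_from_subalg[OF sub_G X] measurable_from_subalg[OF sub_H Y] by auto
  have int: "integrable M X" "integrable M Y" "integrable M (\<lambda>\<omega>. X \<omega> * Y \<omega>)"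
    using X1 Y1 by (auto intro!: integrable_bounded[where B=1] mult_le_one simp: norm_mult)
  let ?c = "\<lambda>U V :: 'a \<Rightarrow> real. expectation (\<lambda>\<omega>. U \<omega> * V \<omega>) - expectation U * expectation V"
  have parts: "\<bar>Re (X \<omega>)\<bar> \<le> 1" "\<bar>Im (X \<omega>)\<bar> \<le> 1" "\<bar>Re (Y \<omega>)\<bar> \<le> 1" "\<bar>Im (Y \<omega>)\<bar> \<le> 1" if "\<omega> \<in> space M" for \<omega>
    using X1[OF that] Y1[OF that] abs_Re_le_cmod[of "X \<omega>"] abs_Im_le_cmod[of "X \<omega>"]
      abs_Re_le_cmod[of "Y \<omega>"] abs_Im_le_cmod[of "Y \<omega>"] by linarith+
  have c: "\<bar>?c (\<lambda>\<omega>. Re (X \<omega>)) (\<lambda>\<omega>. Re (Y \<omega>))\<bar> \<le> 4 * \<alpha>" "\<bar>?c (\<lambda>\<omega>. Im (X \<omega>)) (\<lambda>\<omega>. Im (Y \<omega>))\<bar> \<le> 4 * \<alpha>"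
     "\<bar>?c (\<lambda>\<omega>. Re (X \<omega>)) (\<lambda>\<omega>. Im (Y \<omega>))\<bar> \<le> 4 * \<alpha>" "\<bar>?c (\<lambda>\<omega>. Im (X \<omega>)) (\<lambda>\<omega>. Re (Y \<omega>))\<bar> \<le> 4 * \<alpha>"
    by (rule covariance_real_le; use X Y parts in measurable)+
  have int4: "integrable M (\<lambda>\<omega>. Re (X \<omega>) * Re (Y \<omega>))" "integrable M (\<lambda>\<omega>. Im (X \<omega>) * Im (Y \<omega>))"
      "integrable M (\<lambda>\<omega>. Re (X \<omega>) * Im (Y \<omega>))" "integrable M (\<lambda>\<omega>. Im (X \<omega>) * Re (Y \<omega>))"
    using parts by (auto intro!: integrable_bounded[where B=1] mult_le_one simp: abs_mult)
  let ?D = "expectation (\<lambda>\<omega>. X \<omega> * Y \<omega>) - expectation X * expectation Y"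
  have "Re ?D = ?c (\<lambda>\<omega>. Re (X \<omega>)) (\<lambda>\<omega>. Re (Y \<omega>)) - ?c (\<lambda>\<omega>. Im (X \<omega>)) (\<lambda>\<omega>. Im (Y \<omega>))"
    using int int4 by (simp flip: integral_Re integral_Im)
  moreover have "Im ?D = ?c (\<lambda>\<omega>. Re (X \<omega>)) (\<lambda>\<omega>. Im (Y \<omega>)) + ?c (\<lambda>\<omega>. Im (X \<omega>)) (\<lambda>\<omega>. Re (Y \<omega>))"
    using int int4 by (simp flip: integral_Re integral_Im)
  ultimately have "\<bar>Re ?D\<bar> + \<bar>Im ?D\<bar> \<le> 16 * \<alpha>" using c by linarith
  then show ?thesis using cmod_le[of ?D] by linarith
qed

end

section \<open>The strong mixing coefficients\<close>

text \<open>At least half of the indices below \<open>n\<close> lie in the range from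
  \<open>n div 2\<close> on, and there every term is at least \<open>a n\<close>. So
  \<open>n * a n\<close> is at most twice a tail of the series.\<close>

lemma decreasing_summable_imp_smallo:
  fixes a :: "nat \<Rightarrow> real"
  assumes dec: "\<And>m n. m \<le> n \<Longrightarrow> a n \<le> a m" and nonneg: "\<And>n. a n \<ge> 0" and sum: "summable a"
  shows "(\<lambda>n. real n * a n) \<longlonglongrightarrow> 0"
proof (rule tendsto_sandwich[OF _ _ tendsto_const])
  have "filterlim (\<lambda>n::nat. n div 2) at_top sequentially"
    unfolding filterlim_at_top
  proof
    fix Z show "\<forall>\<^sub>F n in sequentially. Z \<le> n div 2"
      by (rule eventually_mono[OF eventually_ge_at_top[of "2 * Z"]]) linarith
  qed
  then have "(\<lambda>n. \<Sum>k. a (k + n div 2)) \<longlonglongrightarrow> 0"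
    by (rule filterlim_compose[OF suminf_exist_split2[OF sum]])
  from tendsto_mult[OF tendsto_const[of 2] this] show "(\<lambda>n. 2 * (\<Sum>k. a (k + n div 2))) \<longlonglongrightarrow> 0" by simp
  show "\<forall>\<^sub>F n in sequentially. real n * a n \<le> 2 * (\<Sum>k. a (k + n div 2))"
  proof (intro always_eventually allI)
    fix n :: nat
    have "real n * a n \<le> 2 * (real (n - n div 2) * a n)"
    proof -
      have "real n \<le> 2 * real (n - n div 2)" by linarith
      from mult_right_mono[OF this nonneg[of n]] show ?thesis by (simp only: mult.assoc)
    qed
    also have "real (n - n div 2) * a n = (\<Sum>k<n - n div 2. a n)" by simp
    also have "\<dots> \<le> (\<Sum>k<n - n div 2. a (k + n div 2))"
      by (intro sum_mono dec) auto
    also have "\<dots> \<le> (\<Sum>k. a (k + n div 2))"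
      using sum nonneg by (intro sum_le_suminf) (auto intro: summable_ignore_initial_segment)
    finally show "real n * a n \<le> 2 * (\<Sum>k. a (k + n div 2))" by simp
  qed
  show "\<forall>\<^sub>F n in sequentially. 0 \<le> real n * a n" using nonneg by simp
qed

text \<open>The set system \<open>process_algebra\<close> as a measure space, so that measurability
  of functions with respect to past and future can be expressed.\<close>

definition process_sigma :: "'a measure \<Rightarrow> (nat \<Rightarrow> 'a \<Rightarrow> real) \<Rightarrow> nat set \<Rightarrow> 'a measure" where
  "process_sigma M \<xi> I = sigma (space M) {\<xi> l -` A \<inter> space M | l A. l \<in> I \<and> A \<in> sets borel_nonneg}"

lemma space_process_sigma [simp]: "space (process_sigma M \<xi> I) = space M"
  unfolding process_sigma_def by (rule space_measure_of) auto

lemma sets_process_sigma: "sets (process_sigma M \<xi> I) = process_algebra M \<xi> I"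
  unfolding process_sigma_def process_algebra_def by (rule sets_measure_of) auto

lemma process_algebra_mono: "I \<subseteq> J \<Longrightarrow> process_algebra M \<xi> I \<subseteq> process_algebra M \<xi> J"
  unfolding process_algebra_def by (rule sigma_sets_mono') blast

lemma measurable_process_sigma:
  assumes "l \<in> I" "\<xi> l \<in> measurable M borel_nonneg"
  shows "\<xi> l \<in> measurable (process_sigma M \<xi> I) borel_nonneg"
proof (rule measurableI)
  fix A assume "A \<in> sets borel_nonneg"
  then show "\<xi> l -` A \<inter> space (process_sigma M \<xi> I) \<in> sets (process_sigma M \<xi> I)"
    unfolding sets_process_sigma space_process_sigma process_algebra_def using assms(1)
    by (intro sigma_sets.Basic) blast
qed (use assms(2) in \<open>auto dest: measurable_space\<close>)

locale mixing_process = prob_space M for M :: "'a measure" +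
  fixes \<nu> :: "real measure" and \<xi> :: "nat \<Rightarrow> 'a \<Rightarrow> real"
  assumes admissible: "admissible_process \<nu> M \<xi>"
    and rate: "mixing_rate (mixing_coeff M \<xi>)"
begin

abbreviation \<alpha> :: "nat \<Rightarrow> real" where "\<alpha> \<equiv> mixing_coeff M \<xi>"

lemma \<xi>_meas: "l \<ge> 1 \<Longrightarrow> \<xi> l \<in> measurable M borel_nonneg"
  using admissible unfolding admissible_process_def by blast

lemma \<xi>_distr: "l \<ge> 1 \<Longrightarrow> distr M borel_nonneg (\<xi> l) = \<nu>"
  using admissible unfolding admissible_process_def by blast

lemma \<xi>_nonneg: "l \<ge> 1 \<Longrightarrow> \<omega> \<in> space M \<Longrightarrow> \<xi> l \<omega> \<ge> 0"
  using measurable_space[OF \<xi>_meas] by (simp add: space_restrict_space)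

text \<open>Stationarity moves day 1 to day \<open>i\<close> by the shift \<open>i - 1\<close>; it
  is assumed for positive shifts only, which singles out \<open>i = 1\<close>.\<close>

lemma \<xi>_pair:
  assumes "i \<ge> 1"
  shows "distr M (borel_nonneg \<Otimes>\<^sub>M borel_nonneg) (\<lambda>\<omega>. (\<xi> i \<omega>, \<xi> (i + k) \<omega>)) =
    distr M (borel_nonneg \<Otimes>\<^sub>M borel_nonneg) (\<lambda>\<omega>. (\<xi> 1 \<omega>, \<xi> (1 + k) \<omega>))"
proof (cases "i = 1")
  case False
  have "\<forall>l\<ge>1. \<forall>k\<ge>1. \<forall>\<tau>\<ge>1.
        distr M (borel_nonneg \<Otimes>\<^sub>M borel_nonneg) (\<lambda>\<omega>. (\<xi> l \<omega>, \<xi> k \<omega>)) =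
        distr M (borel_nonneg \<Otimes>\<^sub>M borel_nonneg) (\<lambda>\<omega>. (\<xi> (l + \<tau>) \<omega>, \<xi> (k + \<tau>) \<omega>))"
    using admissible unfolding admissible_process_def by blast
  from this[rule_format, of 1 "1 + k" "i - 1"] False assms show ?thesis
    by (simp add: add.commute)
qed simp

lemma subalgebra_process_sigma: "I \<subseteq> {1..} \<Longrightarrow> subalgebra M (process_sigma M \<xi> I)"
  unfolding subalgebra_def sets_process_sigma process_algebra_def
proof (intro conjI sets.sigma_sets_subset)
  assume "I \<subseteq> {1..}"
  then show "{\<xi> l -` A \<inter> space M | l A. l \<in> I \<and> A \<in> sets borel_nonneg} \<subseteq> sets M"
    using measurable_sets[OF \<xi>_meas] by fastforce
qed simp

abbreviation dependence_set :: "nat \<Rightarrow> real set" where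
  "dependence_set n \<equiv> {\<bar>measure M (A \<inter> B) - measure M A * measure M B\<bar> | k A B.
       k \<ge> 1 \<and> A \<in> process_algebra M \<xi> {1..k} \<and> B \<in> process_algebra M \<xi> {k + n..}}"

lemma dependence_le_1: "\<bar>prob A - prob B * prob C\<bar> \<le> 1"
proof -
  have "0 \<le> prob B * prob C" "prob B * prob C \<le> 1" by (auto intro: mult_le_one)
  then show ?thesis using prob_le_1[of A] measure_nonneg[of M A] by linarith
qed

text \<open>\<open>Sup\<close> on the reals is a least upper bound only for a nonempty set that is
  bounded above; this fact and the next one ensure it.\<close>

lemma bdd_dependence_set: "bdd_above (dependence_set n)"
proof (rule bdd_aboveI[of _ 1])
  fix x assume "x \<in> dependence_set n"
  then obtain A B where "x = \<bar>prob (A \<inter> B) - prob A * prob B\<bar>" by blast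
  then show "x \<le> 1" using dependence_le_1 by simp
qed

lemma zero_in_dependence_set: "0 \<in> dependence_set n"
proof -
  have "{} \<in> process_algebra M \<xi> I" for I by (simp add: process_algebra_def sigma_sets.Empty)
  then have "\<exists>k A B. 0 = \<bar>prob (A \<inter> B) - prob A * prob B\<bar> \<and>
      1 \<le> k \<and> A \<in> process_algebra M \<xi> {1..k} \<and> B \<in> process_algebra M \<xi> {k + n..}"
    by (intro exI[of _ 1] exI[of _ "{}"]) simp
  then show ?thesis by blast
qed

lemma \<alpha>_nonneg: "\<alpha> n \<ge> 0"
  unfolding mixing_coeff_def by (rule cSup_upper[OF zero_in_dependence_set bdd_dependence_set])

lemma \<alpha>_le_1: "\<alpha> n \<le> 1"
  unfolding mixing_coeff_def
proof (rule cSup_least)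
  show "dependence_set n \<noteq> {}" using zero_in_dependence_set[of n] by blast
  fix x assume "x \<in> dependence_set n"
  then obtain A B where "x = \<bar>prob (A \<inter> B) - prob A * prob B\<bar>" by blast
  then show "x \<le> 1" using dependence_le_1 by simp
qed

lemma \<alpha>_antimono: "m \<le> n \<Longrightarrow> \<alpha> n \<le> \<alpha> m"
  unfolding mixing_coeff_def
proof (rule cSup_subset_mono[OF _ bdd_dependence_set])
  assume "m \<le> n"
  then have "process_algebra M \<xi> {k + n..} \<subseteq> process_algebra M \<xi> {k + m..}" for k
    by (intro process_algebra_mono) auto
  then show "dependence_set n \<subseteq> dependence_set m" by blast
  show "dependence_set n \<noteq> {}" using zero_in_dependence_set[of n] by blast
qed

lemma sub_algebras_past_future:
  assumes "k \<ge> 1"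
  shows "sub_algebras M (process_sigma M \<xi> {1..k}) (process_sigma M \<xi> {k + d..}) (\<alpha> d)"
proof
  show "subalgebra M (process_sigma M \<xi> {1..k})" "subalgebra M (process_sigma M \<xi> {k + d..})"
    using assms by (auto intro!: subalgebra_process_sigma)
  fix A B assume "A \<in> sets (process_sigma M \<xi> {1..k})" "B \<in> sets (process_sigma M \<xi> {k + d..})"
  then show "\<bar>prob (A \<inter> B) - prob A * prob B\<bar> \<le> \<alpha> d"
    unfolding mixing_coeff_def sets_process_sigma using assms
    by (intro cSup_upper[OF _ bdd_dependence_set]) blast
qed

text \<open>The factor 16 is the one of the covariance inequality for complex variables.\<close>

definition c :: "nat \<Rightarrow> real" where "c d = 16 * (if d = 0 then 1 else \<alpha> d)"

lemma c_nonneg: "c d \<ge> 0" using \<alpha>_nonneg by (simp add: c_def)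

text \<open>Lag 0 requires an absolute constant instead of a mixing coefficient. As
  \<open>\<alpha> n \<le> 1\<close>, the value 16 there keeps the sequence decreasing.\<close>

lemma c_antimono: "m \<le> n \<Longrightarrow> c n \<le> c m"
  using \<alpha>_antimono[of m n] \<alpha>_le_1[of n] by (cases "m = 0"; cases "n = 0") (simp_all add: c_def)

lemma c_summable: "summable c"
proof -
  have "summable (\<lambda>n. \<alpha> (Suc n))" using rate by (simp add: mixing_rate_def)
  then have "summable (\<lambda>n. c (Suc n))" unfolding c_def by (simp add: summable_mult)
  then show ?thesis by (simp add: summable_Suc_iff)
qed

lemma c_smallo: "(\<lambda>n. real n * c n) \<longlonglongrightarrow> 0"
  by (rule decreasing_summable_imp_smallo[OF c_antimono c_nonneg c_summable])

end

section \<open>Win probabilities and their covariances\<close>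

lemma space_borel_nonneg: "space borel_nonneg = {0..}"
  by (simp add: space_restrict_space)

lemma measurable_borel_nonneg_mult [measurable (raw)]:
  assumes "g \<in> measurable K borel_nonneg" "h \<in> measurable K borel_nonneg"
  shows "(\<lambda>x. g x * h x) \<in> measurable K borel_nonneg"
  using assms by (auto simp: measurable_restrict_space2_iff Pi_iff)

lemma measurable_win_function:
  assumes f: "win_function f" and g: "g \<in> measurable K borel_nonneg" and h: "h \<in> measurable K borel_nonneg"
  shows "(\<lambda>x. f (g x) (h x)) \<in> borel_measurable K"
proof -
  have "(\<lambda>(x, y). f x y) \<in> borel_measurable (borel_nonneg \<Otimes>\<^sub>M borel_nonneg)"
    using f unfolding win_function_def by blast
  from measurable_compose[OF measurable_Pair[OF g h] this] show ?thesis by simp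
qed

locale league_model = mixing_process M \<nu> \<xi>
  for M :: "'a measure" and \<nu> :: "real measure" and \<xi> :: "nat \<Rightarrow> 'a \<Rightarrow> real" +
  fixes f :: "real \<Rightarrow> real \<Rightarrow> real" and \<mu> :: "real measure" and s :: real
  assumes f: "win_function f"
    and prob_\<mu>: "prob_space \<mu>" and sets_\<mu> [measurable_cong]: "sets \<mu> = sets borel_nonneg"
    and prob_\<nu>: "prob_space \<nu>" and sets_\<nu> [measurable_cong]: "sets \<nu> = sets borel_nonneg"
    and s: "s \<ge> 0"
begin

sublocale mu: prob_space \<mu> by (rule prob_\<mu>)
sublocale nu: prob_space \<nu> by (rule prob_\<nu>)

lemma space_\<mu>: "space \<mu> = {0..}" and space_\<nu>: "space \<nu> = {0..}"
  using sets_eq_imp_space_eq[OF sets_\<mu>] sets_eq_imp_space_eq[OF sets_\<nu>] space_borel_nonneg by auto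

lemma measurable_s [measurable]: "(\<lambda>_. s) \<in> measurable K borel_nonneg"
  using s by (simp add: space_borel_nonneg)

lemma f_measurable [measurable (raw)]:
  "g \<in> measurable K borel_nonneg \<Longrightarrow> h \<in> measurable K borel_nonneg \<Longrightarrow> (\<lambda>x. f (g x) (h x)) \<in> borel_measurable K"
  by (rule measurable_win_function[OF f])

lemma f_01: "x \<ge> 0 \<Longrightarrow> y \<ge> 0 \<Longrightarrow> 0 \<le> f x y \<and> f x y \<le> 1"
  using f unfolding win_function_def by auto

abbreviation "\<Phi> \<equiv> F f \<nu> s"
abbreviation "\<Psi> \<equiv> F_tilde f \<nu> s"

definition mean_win :: "real \<Rightarrow> real" where "mean_win u = (\<integral>v. \<Phi> v u \<partial>\<nu>)"

text \<open>For \<open>k \<ge> 1\<close> this is the covariance of two results of team 0 that are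
  \<open>k\<close> days apart, against initial strengths \<open>u\<close> and \<open>u'\<close>. For
  \<open>k = 0\<close> and \<open>u = u'\<close> it is only the part of the variance of one result
  that stems from \<xi>; the Bernoulli variance comes on top.\<close>

definition C :: "nat \<Rightarrow> real \<Rightarrow> real \<Rightarrow> real" where
  "C k u u' = (\<integral>\<omega>. \<Psi> (\<xi> 1 \<omega>) u * \<Psi> (\<xi> (1 + k) \<omega>) u' \<partial>M)"

lemma \<Phi>_measurable [measurable (raw)]:
  assumes [measurable]: "g \<in> measurable K borel_nonneg" "h \<in> measurable K borel_nonneg"
  shows "(\<lambda>x. \<Phi> (g x) (h x)) \<in> borel_measurable K"
  unfolding F_def by measurable

lemma mean_win_measurable [measurable (raw)]:
  assumes [measurable]: "h \<in> measurable K borel_nonneg"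
  shows "(\<lambda>x. mean_win (h x)) \<in> borel_measurable K"
  unfolding mean_win_def by measurable

lemma \<Psi>_eq: "\<Psi> v u = \<Phi> v u - mean_win u"
  by (simp add: F_tilde_def mean_win_def)

lemma \<Psi>_measurable [measurable (raw)]:
  assumes [measurable]: "g \<in> measurable K borel_nonneg" "h \<in> measurable K borel_nonneg"
  shows "(\<lambda>x. \<Psi> (g x) (h x)) \<in> borel_measurable K"
  unfolding \<Psi>_eq by measurable

lemma \<xi>_measurable [measurable]: "\<xi> (Suc k) \<in> measurable M borel_nonneg"
  by (rule \<xi>_meas) simp

lemma C_measurable [measurable (raw)]:
  assumes [measurable]: "g \<in> measurable K borel_nonneg" "h \<in> measurable K borel_nonneg"
  shows "(\<lambda>x. C k (g x) (h x)) \<in> borel_measurable K"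
  unfolding C_def One_nat_def plus_nat.simps by measurable

lemma const_measurable: "u \<ge> 0 \<Longrightarrow> (\<lambda>_. u) \<in> measurable K borel_nonneg"
  by (simp add: space_borel_nonneg)

lemma unit_integral:
  assumes "prob_space K" "g \<in> borel_measurable K" "\<And>x. x \<in> space K \<Longrightarrow> 0 \<le> g x \<and> g x \<le> (1::real)"
  shows "integrable K g" "0 \<le> integral\<^sup>L K g" "integral\<^sup>L K g \<le> 1"
proof -
  interpret K: prob_space K by fact
  show int: "integrable K g" using assms by (intro K.integrable_bounded[where B=1]) auto
  show "0 \<le> integral\<^sup>L K g" using assms by (intro Bochner_Integration.integral_nonneg) auto
  show "integral\<^sup>L K g \<le> 1" using K.integral_le_const[OF int, of 1] assms(3) by auto
qed

lemma \<Phi>_01: assumes "x \<ge> 0" "y \<ge> 0" shows "0 \<le> \<Phi> x y" "\<Phi> x y \<le> 1"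
proof -
  note [measurable] = const_measurable[OF assms(1)] const_measurable[OF assms(2)]
  have "0 \<le> f (s * x) (y * v) \<and> f (s * x) (y * v) \<le> 1" if "v \<in> space \<nu>" for v
    using that assms s by (intro f_01) (auto simp: space_\<nu>)
  then show "0 \<le> \<Phi> x y" "\<Phi> x y \<le> 1"
    unfolding F_def by (intro unit_integral prob_\<nu>; measurable)+
qed

lemma mean_win_01: assumes "u \<ge> 0" shows "0 \<le> mean_win u" "mean_win u \<le> 1"
proof -
  note [measurable] = const_measurable[OF assms]
  show "0 \<le> mean_win u" "mean_win u \<le> 1"
    unfolding mean_win_def using \<Phi>_01 assms by (intro unit_integral prob_\<nu>; auto simp: space_\<nu>)+
qed

lemma \<Psi>_abs_le: "x \<ge> 0 \<Longrightarrow> u \<ge> 0 \<Longrightarrow> \<bar>\<Psi> x u\<bar> \<le> 1"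
  using \<Phi>_01[of x u] mean_win_01[of u] by (simp add: \<Psi>_eq abs_le_iff)

section \<open>Means and lag covariances of the conditional win probabilities\<close>

lemma integral_\<xi>:
  assumes l: "l \<ge> 1" and [measurable]: "g \<in> borel_measurable borel_nonneg"
  shows "(\<integral>\<omega>. g (\<xi> l \<omega>) \<partial>M) = (\<integral>v. g v \<partial>\<nu> :: 'b::{banach, second_countable_topology})"
proof -
  have "(\<integral>v. g v \<partial>\<nu>) = (\<integral>v. g v \<partial>distr M borel_nonneg (\<xi> l))" by (simp only: \<xi>_distr[OF l])
  also have "\<dots> = (\<integral>\<omega>. g (\<xi> l \<omega>) \<partial>M)" using \<xi>_meas[OF l] by (intro integral_distr) auto
  finally show ?thesis by simp
qed

lemma \<Phi>_mean: assumes "l \<ge> 1" "u \<ge> 0" shows "(\<integral>\<omega>. \<Phi> (\<xi> l \<omega>) u \<partial>M) = mean_win u"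
proof -
  note [measurable] = const_measurable[OF assms(2)]
  show ?thesis unfolding mean_win_def using assms(1) by (intro integral_\<xi>) measurable
qed

lemma \<Psi>_mean: assumes "l \<ge> 1" "u \<ge> 0" shows "(\<integral>\<omega>. \<Psi> (\<xi> l \<omega>) u \<partial>M) = 0"
proof -
  note [measurable] = const_measurable[OF assms(2)] \<xi>_meas[OF assms(1)]
  have "integrable M (\<lambda>\<omega>. \<Phi> (\<xi> l \<omega>) u)"
    using \<Phi>_01 \<xi>_nonneg assms by (intro integrable_bounded[where B=1]) auto
  then show ?thesis unfolding \<Psi>_eq using \<Phi>_mean[OF assms] by (simp add: prob_space)
qed

text \<open>The integral depends on the joint law of two days only, which is invariant under
  shifts.\<close>

lemma C_shift:
  assumes i: "i \<ge> 1" and u: "u \<ge> 0" "u' \<ge> 0"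
  shows "(\<integral>\<omega>. \<Psi> (\<xi> i \<omega>) u * \<Psi> (\<xi> (i + k) \<omega>) u' \<partial>M) = C k u u'"
proof -
  note [measurable] = const_measurable[OF u(1)] const_measurable[OF u(2)]
  let ?g = "\<lambda>z. \<Psi> (fst z) u * \<Psi> (snd z) u'"
  have *: "(\<integral>\<omega>. \<Psi> (\<xi> i \<omega>) u * \<Psi> (\<xi> (i + k) \<omega>) u' \<partial>M)
      = (\<integral>z. ?g z \<partial>distr M (borel_nonneg \<Otimes>\<^sub>M borel_nonneg) (\<lambda>\<omega>. (\<xi> i \<omega>, \<xi> (i + k) \<omega>)))" if "i \<ge> 1" for i
  proof -
    have [measurable]: "\<xi> i \<in> measurable M borel_nonneg" "\<xi> (i + k) \<in> measurable M borel_nonneg"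
      using that by (auto intro: \<xi>_meas)
    show ?thesis by (subst integral_distr) auto
  qed
  show ?thesis unfolding C_def *[OF i] *[OF order_refl] \<xi>_pair[OF i] ..
qed

lemma process_sigma_measurable:
  assumes "i \<in> I" "i \<ge> 1" shows "\<xi> i \<in> measurable (process_sigma M \<xi> I) borel_nonneg"
  by (rule measurable_process_sigma[where \<xi>=\<xi> and l=i, OF assms(1) \<xi>_meas[OF assms(2)]])

text \<open>The factors are centred, so for \<open>k \<ge> 1\<close> this is the real covariance
  inequality with constant 4. The bound is uniform in the strengths, which later makes
  \<open>c\<close> a dominating sequence for the sum over lags.\<close>

lemma C_abs_le:
  assumes u: "u \<ge> 0" "u' \<ge> 0"
  shows "\<bar>C k u u'\<bar> \<le> c k"
proof (cases "k = 0")
  case True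
  note [measurable] = const_measurable[OF u(1)] const_measurable[OF u(2)]
  have "norm (C k u u') \<le> 1"
    unfolding C_def using True u \<Psi>_abs_le \<xi>_nonneg[of 1]
    by (intro norm_expectation_le) (auto simp: abs_mult intro!: mult_le_one)
  then show ?thesis using True by (simp add: c_def)
next
  case False
  note [measurable] = const_measurable[OF u(1)] const_measurable[OF u(2)]
    process_sigma_measurable[of 1 "{1..1}"] process_sigma_measurable[of "1 + k" "{1 + k..}"]
  interpret sub_algebras M "process_sigma M \<xi> {1..1}" "process_sigma M \<xi> {1 + k..}" "\<alpha> k"
    by (rule sub_algebras_past_future) simp
  have "\<bar>(\<integral>\<omega>. \<Psi> (\<xi> 1 \<omega>) u * \<Psi> (\<xi> (1 + k) \<omega>) u' \<partial>M)
      - (\<integral>\<omega>. \<Psi> (\<xi> 1 \<omega>) u \<partial>M) * (\<integral>\<omega>. \<Psi> (\<xi> (1 + k) \<omega>) u' \<partial>M)\<bar> \<le> 4 * \<alpha> k"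
    using u \<xi>_nonneg by (intro covariance_real_le \<Psi>_abs_le \<Psi>_measurable) (auto intro: const_measurable process_sigma_measurable)
  then have "\<bar>C k u u'\<bar> \<le> 4 * \<alpha> k"
    unfolding C_def using \<Psi>_mean[of 1 u] u by simp
  also have "\<dots> \<le> c k" using False \<alpha>_nonneg[of k] by (simp add: c_def)
  finally show ?thesis .
qed

lemma C_0:
  assumes "u \<ge> 0" shows "C 0 u u = (\<integral>v. (\<Psi> v u)\<^sup>2 \<partial>\<nu>)"
proof -
  note [measurable] = const_measurable[OF assms]
  have "C 0 u u = (\<integral>\<omega>. (\<Psi> (\<xi> 1 \<omega>) u)\<^sup>2 \<partial>M)" by (simp add: C_def power2_eq_square)
  also have "\<dots> = (\<integral>v. (\<Psi> v u)\<^sup>2 \<partial>\<nu>)" by (intro integral_\<xi>) measurable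
  finally show ?thesis .
qed

text \<open>The law of total variance for a result whose win probability \<open>\<Phi> v u\<close>
  is itself random: the mean conditional variance, which averages to \<open>sigma_sq\<close>, plus
  the variance of the conditional mean, which averages to the first term of
  \<open>rho_sq\<close>.\<close>

lemma mean_win_variance:
  assumes u: "u \<ge> 0"
  shows "mean_win u - (mean_win u)\<^sup>2 = (\<integral>v. \<Phi> v u - (\<Phi> v u)\<^sup>2 \<partial>\<nu>) + C 0 u u"
proof -
  note [measurable] = const_measurable[OF u]
  have int: "integrable \<nu> (\<lambda>v. \<Phi> v u)" "integrable \<nu> (\<lambda>v. (\<Phi> v u)\<^sup>2)"
    using \<Phi>_01 u by (auto intro!: unit_integral(1) prob_\<nu> simp: space_\<nu> power_le_one)
  have eq: "(\<lambda>v. (\<Psi> v u)\<^sup>2) = (\<lambda>v. (\<Phi> v u)\<^sup>2 - 2 * mean_win u * \<Phi> v u + (mean_win u)\<^sup>2)"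
    by (auto simp: \<Psi>_eq power2_diff)
  have "(\<integral>v. \<Phi> v u \<partial>\<nu>) = mean_win u" by (simp add: mean_win_def)
  then show ?thesis unfolding C_0[OF u] eq using int by (simp add: nu.prob_space power2_eq_square)
qed

section \<open>Integral formulas for the limit variances\<close>

lemma rho_cov_eq: "rho_cov f \<mu> \<nu> M \<xi> s k = (\<integral>z. C k (fst z) (snd z) \<partial>(\<mu> \<Otimes>\<^sub>M \<mu>))"
proof -
  interpret mm: pair_prob_space \<mu> \<mu> ..
  interpret P: pair_prob_space M "\<mu> \<Otimes>\<^sub>M \<mu>" ..
  let ?g = "\<lambda>(\<omega>, u, u'). \<Psi> (\<xi> 1 \<omega>) u * \<Psi> (\<xi> (1 + k) \<omega>) u'"
  have [measurable]: "?g \<in> borel_measurable (M \<Otimes>\<^sub>M \<mu> \<Otimes>\<^sub>M \<mu>)"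
    unfolding One_nat_def plus_nat.simps by measurable
  have "integrable (M \<Otimes>\<^sub>M \<mu> \<Otimes>\<^sub>M \<mu>) ?g"
    using \<xi>_nonneg \<Psi>_abs_le
    by (intro P.P.integrable_bounded[where B=1])
      (auto simp: space_pair_measure space_\<mu> abs_mult intro!: mult_le_one)
  from P.integral_snd[OF this] show ?thesis
    unfolding rho_cov_def C_def by (simp add: case_prod_beta)
qed

lemma rho_cov_abs_le: "\<bar>rho_cov f \<mu> \<nu> M \<xi> s k\<bar> \<le> c k"
proof -
  interpret mm: pair_prob_space \<mu> \<mu> ..
  have "norm (\<integral>z. C k (fst z) (snd z) \<partial>(\<mu> \<Otimes>\<^sub>M \<mu>)) \<le> c k"
    using C_abs_le by (intro mm.P.norm_expectation_le) (auto simp: space_pair_measure space_\<mu>)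
  then show ?thesis by (simp add: rho_cov_eq)
qed

lemma rho_cov_summable: "summable (\<lambda>k. rho_cov f \<mu> \<nu> M \<xi> s (Suc k))"
proof (rule summable_comparison_test')
  show "summable (\<lambda>k. c (Suc k))" using c_summable by (simp add: summable_Suc_iff)
  show "norm (rho_cov f \<mu> \<nu> M \<xi> s (Suc k)) \<le> c (Suc k)" for k using rho_cov_abs_le by simp
qed

lemma integral_\<nu>\<mu>:
  assumes [measurable]: "(\<lambda>(v, u). g v u) \<in> borel_measurable (\<nu> \<Otimes>\<^sub>M \<mu>)"
    and "\<And>v u. v \<ge> 0 \<Longrightarrow> u \<ge> 0 \<Longrightarrow> \<bar>g v u\<bar> \<le> (1::real)"
  shows "integrable (\<nu> \<Otimes>\<^sub>M \<mu>) (\<lambda>(v, u). g v u)"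
    and "(\<integral>(v, u). g v u \<partial>(\<nu> \<Otimes>\<^sub>M \<mu>)) = (\<integral>u. \<integral>v. g v u \<partial>\<nu> \<partial>\<mu>)"
    and "(\<integral>(v, u). g v u \<partial>(\<nu> \<Otimes>\<^sub>M \<mu>)) = (\<integral>v. \<integral>u. g v u \<partial>\<mu> \<partial>\<nu>)"
proof -
  interpret nm: pair_prob_space \<nu> \<mu> ..
  show int: "integrable (\<nu> \<Otimes>\<^sub>M \<mu>) (\<lambda>(v, u). g v u)"
    using assms by (intro nm.P.integrable_bounded[where B=1]) (auto simp: space_pair_measure space_\<mu> space_\<nu>)
  show "(\<integral>(v, u). g v u \<partial>(\<nu> \<Otimes>\<^sub>M \<mu>)) = (\<integral>u. \<integral>v. g v u \<partial>\<nu> \<partial>\<mu>)"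
    by (rule nm.integral_snd[OF int, symmetric])
  show "(\<integral>(v, u). g v u \<partial>(\<nu> \<Otimes>\<^sub>M \<mu>)) = (\<integral>v. \<integral>u. g v u \<partial>\<mu> \<partial>\<nu>)"
    by (rule nm.integral_fst[OF int, symmetric])
qed

lemma \<Phi>_abs_le:
  assumes "v \<ge> 0" "u \<ge> 0"
  shows "\<bar>\<Phi> v u\<bar> \<le> 1" "\<bar>(\<Phi> v u)\<^sup>2\<bar> \<le> 1" "\<bar>\<Phi> v u - (\<Phi> v u)\<^sup>2\<bar> \<le> 1"
proof -
  note * = \<Phi>_01[OF assms] power_le_one[OF \<Phi>_01[OF assms], of 2] zero_le_power2[of "\<Phi> v u"]
  show "\<bar>\<Phi> v u\<bar> \<le> 1" "\<bar>(\<Phi> v u)\<^sup>2\<bar> \<le> 1" "\<bar>\<Phi> v u - (\<Phi> v u)\<^sup>2\<bar> \<le> 1" using * by linarith+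
qed

lemma sigma_sq_eq_integral: "sigma_sq f \<mu> \<nu> s = (\<integral>u. \<integral>v. \<Phi> v u - (\<Phi> v u)\<^sup>2 \<partial>\<nu> \<partial>\<mu>)"
  unfolding sigma_sq_def using \<Phi>_abs_le by (intro integral_\<nu>\<mu>(2)) auto

lemma square_\<Psi>_eq_integral: "(\<integral>(v, u). (\<Psi> v u)\<^sup>2 \<partial>(\<nu> \<Otimes>\<^sub>M \<mu>)) = (\<integral>u. C 0 u u \<partial>\<mu>)"
proof -
  have "(\<integral>(v, u). (\<Psi> v u)\<^sup>2 \<partial>(\<nu> \<Otimes>\<^sub>M \<mu>)) = (\<integral>u. \<integral>v. (\<Psi> v u)\<^sup>2 \<partial>\<nu> \<partial>\<mu>)"
    using \<Psi>_abs_le by (intro integral_\<nu>\<mu>(2)) (auto simp: abs_square_le_1)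
  also have "\<dots> = (\<integral>u. C 0 u u \<partial>\<mu>)"
    using C_0 by (intro Bochner_Integration.integral_cong) (auto simp: space_\<mu>)
  finally show ?thesis .
qed

lemma win_prob_eq: "win_prob f \<mu> \<nu> s = (\<integral>(v, u). \<Phi> v u \<partial>(\<nu> \<Otimes>\<^sub>M \<mu>))"
proof -
  interpret mn: pair_prob_space \<mu> \<nu> ..
  interpret P: pair_prob_space \<nu> "\<mu> \<Otimes>\<^sub>M \<nu>" ..
  let ?g = "\<lambda>(v, u, v'). f (s * v) (u * v')"
  have int: "integrable (\<nu> \<Otimes>\<^sub>M \<mu> \<Otimes>\<^sub>M \<nu>) ?g"
    using s f_01 by (intro P.P.integrable_bounded[where B=1]) (auto simp: space_pair_measure space_\<mu> space_\<nu>)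
  have "win_prob f \<mu> \<nu> s = (\<integral>v. \<integral>(u, v'). f (s * v) (u * v') \<partial>(\<mu> \<Otimes>\<^sub>M \<nu>) \<partial>\<nu>)"
    unfolding win_prob_def by (rule P.integral_fst[OF int, symmetric])
  also have "\<dots> = (\<integral>v. \<integral>u. \<Phi> v u \<partial>\<mu> \<partial>\<nu>)"
  proof (rule Bochner_Integration.integral_cong[OF refl])
    fix v assume "v \<in> space \<nu>"
    then have v: "v \<ge> 0" by (simp add: space_\<nu>)
    note [measurable] = const_measurable[OF v]
    have "integrable (\<mu> \<Otimes>\<^sub>M \<nu>) (\<lambda>(u, v'). f (s * v) (u * v'))"
      using s v f_01 by (intro mn.P.integrable_bounded[where B=1]) (auto simp: space_pair_measure space_\<mu> space_\<nu>)
    from mn.integral_fst[OF this] show "(\<integral>(u, v'). f (s * v) (u * v') \<partial>(\<mu> \<Otimes>\<^sub>M \<nu>)) = (\<integral>u. \<Phi> v u \<partial>\<mu>)"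
      by (simp add: F_def)
  qed
  also have "\<dots> = (\<integral>(v, u). \<Phi> v u \<partial>(\<nu> \<Otimes>\<^sub>M \<mu>))"
    using \<Phi>_abs_le by (intro integral_\<nu>\<mu>(3)[symmetric]) auto
  finally show ?thesis .
qed

lemma sigma_sq_eq: "sigma_sq f \<mu> \<nu> s = win_prob f \<mu> \<nu> s - (\<integral>(v, u). (\<Phi> v u)\<^sup>2 \<partial>(\<nu> \<Otimes>\<^sub>M \<mu>))"
proof -
  have "integrable (\<nu> \<Otimes>\<^sub>M \<mu>) (\<lambda>(v, u). \<Phi> v u)" "integrable (\<nu> \<Otimes>\<^sub>M \<mu>) (\<lambda>(v, u). (\<Phi> v u)\<^sup>2)"
    using \<Phi>_abs_le by (auto intro!: integral_\<nu>\<mu>(1))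
  then show ?thesis unfolding sigma_sq_def win_prob_eq by (simp add: case_prod_beta')
qed

end

section \<open>Integrating out the opponents\<close>

lemma norm_prod_le_1:
  fixes g :: "'i \<Rightarrow> 'c::{real_normed_field}"
  assumes "\<And>i. i \<in> I \<Longrightarrow> norm (g i) \<le> 1" shows "norm (\<Prod>i\<in>I. g i) \<le> 1"
  using assms prod_mono[of I "\<lambda>i. norm (g i)" "\<lambda>_. 1"] by (simp add: prod_norm)

lemma norm_convex_combination_le_1:
  fixes a b :: "'c::real_normed_vector" and x :: real
  assumes "0 \<le> x" "x \<le> 1" "norm a \<le> 1" "norm b \<le> 1"
  shows "norm (x *\<^sub>R a + (1 - x) *\<^sub>R b) \<le> 1"
proof -
  have "norm (x *\<^sub>R a + (1 - x) *\<^sub>R b) \<le> x * norm a + (1 - x) * norm b"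
    using norm_triangle_ineq[of "x *\<^sub>R a" "(1 - x) *\<^sub>R b"] assms by simp
  also have "\<dots> \<le> x * 1 + (1 - x) * 1" using assms by (intro add_mono mult_left_mono) auto
  finally show ?thesis by simp
qed

text \<open>The coordinates of \<open>Pi_pmf\<close> are independent. The target field stays general
  to serve both moments (real) and characteristic functions (complex).\<close>

lemma expectation_prod_Pi_pmf_bool:
  fixes h :: "'i \<Rightarrow> bool \<Rightarrow> 'c::{real_normed_field, banach, second_countable_topology}"
  assumes fin: "finite A" and p: "\<And>i. i \<in> A \<Longrightarrow> 0 \<le> p i \<and> p i \<le> 1" and h: "\<And>i b. norm (h i b) \<le> 1"
  shows "(\<integral>r. (\<Prod>i\<in>A. h i (r i)) \<partial>measure_pmf (Pi_pmf A False (\<lambda>i. bernoulli_pmf (p i))))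
    = (\<Prod>i\<in>A. p i *\<^sub>R h i True + (1 - p i) *\<^sub>R h i False)"
proof -
  let ?P = "Pi_pmf A False (\<lambda>i. bernoulli_pmf (p i))"
  have "(\<integral>r. (\<Prod>i\<in>A. h i (r i)) \<partial>?P) = (\<Prod>i\<in>A. \<integral>r. h i (r i) \<partial>?P)"
  proof (rule prob_space.indep_vars_lebesgue_integral[OF measure_pmf.prob_space_axioms fin])
    show "prob_space.indep_vars (measure_pmf ?P) (\<lambda>_. borel) (\<lambda>i r. h i (r i)) A"
      by (rule prob_space.indep_vars_compose2[OF measure_pmf.prob_space_axioms indep_vars_Pi_pmf[OF fin]]) auto
    show "integrable ?P (\<lambda>r. h i (r i))" for i
      using h by (intro measure_pmf.integrable_bounded[where B=1]) auto
  qed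
  also have "\<dots> = (\<Prod>i\<in>A. p i *\<^sub>R h i True + (1 - p i) *\<^sub>R h i False)"
  proof (rule prod.cong[OF refl])
    fix i assume i: "i \<in> A"
    have "(\<integral>r. h i (r i) \<partial>?P) = (\<integral>b. h i b \<partial>measure_pmf (map_pmf (\<lambda>r. r i) ?P))"
      by (simp add: integral_map_pmf)
    also have "map_pmf (\<lambda>r. r i) ?P = bernoulli_pmf (p i)"
      using i by (simp add: Pi_pmf_component[OF fin])
    also have "(\<integral>b. h i b \<partial>measure_pmf (bernoulli_pmf (p i))) = p i *\<^sub>R h i True + (1 - p i) *\<^sub>R h i False"
      using p[OF i] by (subst integral_measure_pmf[of UNIV]) (auto simp: UNIV_bool add.commute)
    finally show "(\<integral>r. h i (r i) \<partial>?P) = p i *\<^sub>R h i True + (1 - p i) *\<^sub>R h i False" .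
  qed
  finally show ?thesis .
qed

context league_model
begin

abbreviation "PL \<equiv> process_law M \<xi>"

lemma restrict_\<xi>_measurable: "(\<lambda>\<omega>. restrict (\<lambda>l. \<xi> l \<omega>) {1..}) \<in> measurable M (Pi\<^sub>M {1..} (\<lambda>_. borel_nonneg))"
  using \<xi>_meas by (intro measurable_restrict) auto

lemma sets_PL [measurable_cong]: "sets PL = sets (Pi\<^sub>M {1..} (\<lambda>_. borel_nonneg))"
  by (simp add: process_law_def)

lemma prob_space_PL: "prob_space PL"
  unfolding process_law_def by (intro prob_space_distr restrict_\<xi>_measurable)

lemma coordinate_PL: "p \<ge> 1 \<Longrightarrow> (\<lambda>z. z p) \<in> measurable PL borel_nonneg"
  unfolding measurable_cong_sets[OF sets_PL refl] by (intro measurable_component_singleton) simp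

lemma coordinate_PiM:
  assumes "i \<in> I" "p \<ge> 1" shows "(\<lambda>x. x i p) \<in> measurable (Pi\<^sub>M I (\<lambda>_. PL)) borel_nonneg"
  using measurable_compose[OF measurable_component_singleton[OF assms(1)] coordinate_PL[OF assms(2)]] .

lemma coordinate_nonneg:
  assumes "x \<in> space (Pi\<^sub>M I (\<lambda>_. PL))" "i \<in> I" "p \<ge> 1" shows "x i p \<ge> 0"
  using measurable_space[OF coordinate_PiM[OF assms(2,3)] assms(1)] by (simp add: space_borel_nonneg)

lemma coordinate_PL_nonneg: "z \<in> space PL \<Longrightarrow> p \<ge> 1 \<Longrightarrow> z p \<ge> 0"
  using measurable_space[OF coordinate_PL, of p z] by (simp add: space_borel_nonneg)

text \<open>With the process of team 0 fixed, the integrand is a product over the opponents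
  \<open>j\<close>, each factor using a single coordinate of the process of \<open>j\<close>, since
  \<open>q\<close> is injective. By independence the factors integrate separately, and only the
  one-day law \<nu> of the opponents is left.\<close>

lemma integral_processes:
  fixes \<phi> :: "nat \<Rightarrow> real \<Rightarrow> real \<Rightarrow> 'c::{real_normed_field, banach, second_countable_topology}"
  assumes m: "m \<ge> 1" and bij: "bij_betw q {1..<m} {1..<m}"
    and meas: "\<And>p. (\<lambda>z. \<phi> p (fst z) (snd z)) \<in> borel_measurable (borel_nonneg \<Otimes>\<^sub>M borel_nonneg)"
    and bound: "\<And>p u v. p \<in> {1..<m} \<Longrightarrow> u \<ge> 0 \<Longrightarrow> v \<ge> 0 \<Longrightarrow> norm (\<phi> p u v) \<le> 1"
  shows "(\<integral>x. (\<Prod>p\<in>{1..<m}. \<phi> p (x 0 p) (x (q p) p)) \<partial>Pi\<^sub>M {..<m} (\<lambda>_. PL))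
    = (\<integral>\<omega>. (\<Prod>p\<in>{1..<m}. \<integral>v. \<phi> p (\<xi> p \<omega>) v \<partial>\<nu>) \<partial>M)"
proof -
  interpret PL: prob_space PL by (rule prob_space_PL)
  interpret product_prob_space "\<lambda>_. PL" "{..<m}"
    by (simp add: product_prob_spaceI prob_space_PL)
  have meas' [measurable (raw)]: "(\<lambda>x. \<phi> p (g x) (h x)) \<in> borel_measurable K"
    if "g \<in> measurable K borel_nonneg" "h \<in> measurable K borel_nonneg" for p g h and K :: "'z measure"
    using measurable_compose[OF measurable_Pair[OF that] meas[of p]] by simp
  have q: "q p \<in> {1..<m}" if "p \<in> {1..<m}" for p using bij that bij_betwE by blast
  \<comment> \<open>The day on which team 0 meets a given opponent; it regroups the product from
    days to teams.\<close>
  define r where "r = the_inv_into {1..<m} q"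
  have rq: "r (q p) = p" if "p \<in> {1..<m}" for p
    using bij that unfolding r_def bij_betw_def by (simp add: the_inv_into_f_f)
  have r: "r j \<in> {1..<m}" if "j \<in> {1..<m}" for j
    using bij that unfolding r_def bij_betw_def by (metis subset_refl the_inv_into_into)
  let ?J = "{1..<m}" and ?f = "\<lambda>x. \<Prod>p\<in>{1..<m}. \<phi> p (x 0 p) (x (q p) p)"
  have split: "{..<m} = {0} \<union> ?J" using m by auto
  have meas_f: "?f \<in> borel_measurable (Pi\<^sub>M {..<m} (\<lambda>_. PL))"
  proof (intro borel_measurable_prod meas' coordinate_PiM)
    fix p assume p: "p \<in> ?J"
    then show "0 \<in> {..<m}" "q p \<in> {..<m}" "1 \<le> p" "1 \<le> p" using q[OF p] by auto
  qed
  have int: "integrable (Pi\<^sub>M {..<m} (\<lambda>_. PL)) ?f"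
  proof (rule P.integrable_bounded[OF meas_f norm_prod_le_1])
    fix x p assume "x \<in> space (Pi\<^sub>M {..<m} (\<lambda>_. PL))" "p \<in> ?J"
    then show "norm (\<phi> p (x 0 p) (x (q p) p)) \<le> 1"
      using q[of p] by (intro bound coordinate_nonneg) auto
  qed
  have inner: "(\<integral>y. ?f (merge {0} ?J (x, y)) \<partial>Pi\<^sub>M ?J (\<lambda>_. PL)) = (\<Prod>p\<in>?J. \<integral>v. \<phi> p (x 0 p) v \<partial>\<nu>)"
    if x: "x \<in> space (Pi\<^sub>M {0} (\<lambda>_. PL))" for x
  proof -
    have x0: "(\<lambda>_. x 0 p) \<in> measurable K borel_nonneg" "x 0 p \<ge> 0" if "p \<in> ?J" for p and K :: "'z measure"
      using coordinate_nonneg[OF x, of 0 p] that by (auto simp: const_measurable)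
    have "?f (merge {0} ?J (x, y)) = (\<Prod>j\<in>?J. \<phi> (r j) (x 0 (r j)) (y j (r j)))" for y
    proof -
      have "?f (merge {0} ?J (x, y)) = (\<Prod>p\<in>?J. \<phi> (r (q p)) (x 0 (r (q p))) (y (q p) (r (q p))))"
      proof (rule prod.cong[OF refl])
        fix p assume p: "p \<in> ?J"
        then have "q p \<noteq> 0" using q[OF p] by auto
        then show "\<phi> p (merge {0} ?J (x, y) 0 p) (merge {0} ?J (x, y) (q p) p)
            = \<phi> (r (q p)) (x 0 (r (q p))) (y (q p) (r (q p)))"
          using q[OF p] by (simp add: merge_def rq[OF p])
      qed
      also have "\<dots> = (\<Prod>j\<in>?J. \<phi> (r j) (x 0 (r j)) (y j (r j)))"
        by (rule prod.reindex_bij_betw[OF bij, of "\<lambda>j. \<phi> (r j) (x 0 (r j)) (y j (r j))"])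
      finally show ?thesis .
    qed
    then have "(\<integral>y. ?f (merge {0} ?J (x, y)) \<partial>Pi\<^sub>M ?J (\<lambda>_. PL))
        = (\<integral>y. (\<Prod>j\<in>?J. \<phi> (r j) (x 0 (r j)) (y j (r j))) \<partial>Pi\<^sub>M ?J (\<lambda>_. PL))" by (simp only:)
    also have "\<dots> = (\<Prod>j\<in>?J. \<integral>z. \<phi> (r j) (x 0 (r j)) (z (r j)) \<partial>PL)"
    proof (rule product_integral_prod)
      fix j assume "j \<in> ?J"
      then have rj: "r j \<in> ?J" by (rule r)
      then have "(\<lambda>z. z (r j)) \<in> measurable PL borel_nonneg" by (intro coordinate_PL) simp
      then show "integrable PL (\<lambda>z. \<phi> (r j) (x 0 (r j)) (z (r j)))"
        using rj by (intro PL.integrable_bounded[where B=1] meas' x0 bound coordinate_PL_nonneg) auto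
    qed simp
    also have "\<dots> = (\<Prod>p\<in>?J. \<integral>z. \<phi> (r (q p)) (x 0 (r (q p))) (z (r (q p))) \<partial>PL)"
      by (rule prod.reindex_bij_betw[OF bij, symmetric])
    also have "\<dots> = (\<Prod>p\<in>?J. \<integral>v. \<phi> p (x 0 p) v \<partial>\<nu>)"
    proof (rule prod.cong[OF refl])
      fix p assume p: "p \<in> ?J"
      then have p1: "p \<ge> 1" by simp
      have "(\<integral>z. \<phi> p (x 0 p) (z p) \<partial>PL) = (\<integral>\<omega>. \<phi> p (x 0 p) (\<xi> p \<omega>) \<partial>M)"
        unfolding process_law_def using p1
        by (subst integral_distr[OF restrict_\<xi>_measurable]) (auto intro!: meas' x0[OF p] measurable_component_singleton)
      also have "\<dots> = (\<integral>v. \<phi> p (x 0 p) v \<partial>\<nu>)"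
        by (intro integral_\<xi>[OF p1] meas' x0[OF p] measurable_ident_sets[OF refl])
      finally show "(\<integral>z. \<phi> (r (q p)) (x 0 (r (q p))) (z (r (q p))) \<partial>PL) = (\<integral>v. \<phi> p (x 0 p) v \<partial>\<nu>)"
        by (simp only: rq[OF p])
    qed
    finally show ?thesis .
  qed
  have outer_meas: "(\<lambda>z. \<Prod>p\<in>?J. \<integral>v. \<phi> p (z p) v \<partial>\<nu>) \<in> borel_measurable (Pi\<^sub>M {1..} (\<lambda>_. borel_nonneg))"
  proof (rule borel_measurable_prod)
    fix p assume "p \<in> ?J"
    then have [measurable]: "(\<lambda>z. z p) \<in> measurable (Pi\<^sub>M {1..} (\<lambda>_. borel_nonneg)) borel_nonneg"
      by (intro measurable_component_singleton) simp
    show "(\<lambda>z. \<integral>v. \<phi> p (z p) v \<partial>\<nu>) \<in> borel_measurable (Pi\<^sub>M {1..} (\<lambda>_. borel_nonneg))"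
      by measurable
  qed
  have "(\<integral>x. ?f x \<partial>Pi\<^sub>M {..<m} (\<lambda>_. PL))
      = (\<integral>x. (\<integral>y. ?f (merge {0} ?J (x, y)) \<partial>Pi\<^sub>M ?J (\<lambda>_. PL)) \<partial>Pi\<^sub>M {0} (\<lambda>_. PL))"
    unfolding split by (rule product_integral_fold) (use int in \<open>auto simp: split\<close>)
  also have "\<dots> = (\<integral>x. (\<Prod>p\<in>?J. \<integral>v. \<phi> p (x 0 p) v \<partial>\<nu>) \<partial>Pi\<^sub>M {0::nat} (\<lambda>_. PL))"
    by (rule Bochner_Integration.integral_cong[OF refl]) (rule inner)
  also have "\<dots> = (\<integral>z. (\<Prod>p\<in>?J. \<integral>v. \<phi> p (z p) v \<partial>\<nu>) \<partial>PL)"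
    using outer_meas by (intro product_integral_singleton) (simp add: measurable_cong_sets[OF sets_PL refl])
  also have "\<dots> = (\<integral>\<omega>. (\<Prod>p\<in>?J. \<integral>v. \<phi> p (restrict (\<lambda>l. \<xi> l \<omega>) {1..} p) v \<partial>\<nu>) \<partial>M)"
    unfolding process_law_def by (rule integral_distr[OF restrict_\<xi>_measurable outer_meas])
  also have "\<dots> = (\<integral>\<omega>. (\<Prod>p\<in>?J. \<integral>v. \<phi> p (\<xi> p \<omega>) v \<partial>\<nu>) \<partial>M)"
    by (intro Bochner_Integration.integral_cong refl prod.cong) auto
  finally show ?thesis .
qed

end

section \<open>A strong law for triangular arrays\<close>

context prob_space begin

text \<open>Nothing relates one row to another, so partial sums cannot be compared along
  \<open>n\<close>. Borel-Cantelli needs no such relation, only summable probabilities: for at most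
  \<open>2 * n\<close> variables with range of length 2, Hoeffding bounds a deviation of
  \<open>2 * n * \<epsilon>\<close> by \<open>2 * exp (- \<epsilon>\<^sup>2) ^ n\<close>.\<close>

lemma triangular_strong_law:
  fixes Y :: "nat \<Rightarrow> 'i \<Rightarrow> 'a \<Rightarrow> real" and A :: "nat \<Rightarrow> 'i set"
  assumes fin: "\<And>n. finite (A n)" and card: "\<And>n. card (A n) \<le> 2 * n"
    and indep: "\<And>n. n \<ge> 1 \<Longrightarrow> indep_vars (\<lambda>_. borel) (Y n) (A n)"
    and bound: "\<And>n i \<omega>. n \<ge> 1 \<Longrightarrow> i \<in> A n \<Longrightarrow> \<omega> \<in> space M \<Longrightarrow> \<bar>Y n i \<omega>\<bar> \<le> 1"
    and mean: "\<And>n i. n \<ge> 1 \<Longrightarrow> i \<in> A n \<Longrightarrow> expectation (Y n i) = e"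
  shows "AE \<omega> in M. (\<lambda>n. (\<Sum>i\<in>A n. Y n i \<omega> - e) / (2 * real n)) \<longlonglongrightarrow> 0"
proof -
  define Z where "Z n \<omega> = (\<Sum>i\<in>A n. Y n i \<omega>) - real (card (A n)) * e" for n \<omega>
  have ev: "AE \<omega> in M. \<forall>\<^sub>F n in sequentially. \<bar>Z n \<omega>\<bar> < \<epsilon> * (2 * real n)" if \<epsilon>: "\<epsilon> > 0" for \<epsilon>
  proof -
    define E where "E n = (if n \<ge> 1 then {\<omega> \<in> space M. \<epsilon> * (2 * real n) \<le> \<bar>Z n \<omega>\<bar>} else {})" for n
    have E_meas: "E n \<in> events" for n
    proof (cases "n \<ge> 1")
      case True
      have [measurable]: "Y n i \<in> borel_measurable M" if "i \<in> A n" for i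
        using indep[OF True] that unfolding indep_vars_def by blast
      have "(\<lambda>\<omega>. \<bar>Z n \<omega>\<bar>) \<in> borel_measurable M" unfolding Z_def by measurable
      then show ?thesis using True by (simp add: E_def)
    qed (simp add: E_def)
    have E_prob: "prob (E n) \<le> 2 * exp (- \<epsilon>\<^sup>2) ^ n" for n
    proof (cases "n \<ge> 1 \<and> card (A n) > 0")
      case True
      then have n: "n \<ge> 1" and pos: "card (A n) > 0" by auto
      interpret Hoeffding_ineq M "A n" "Y n" "\<lambda>_. - 1" "\<lambda>_. 1" "\<Sum>i\<in>A n. expectation (Y n i)"
        using fin indep[OF n] bound[OF n] by unfold_locales (auto simp: abs_le_iff intro!: AE_I2)
      have "prob (E n) = prob {\<omega> \<in> space M. \<epsilon> * (2 * real n) \<le> \<bar>(\<Sum>i\<in>A n. Y n i \<omega>) - (\<Sum>i\<in>A n. expectation (Y n i))\<bar>}"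
        using n mean[OF n] by (simp add: E_def Z_def)
      also have "\<dots> \<le> 2 * exp (- 2 * (\<epsilon> * (2 * real n))\<^sup>2 / (\<Sum>i\<in>A n. (1 - - 1)\<^sup>2))"
        using \<epsilon> pos by (intro Hoeffding_ineq_abs_ge) auto
      also have "\<dots> \<le> 2 * exp (- (real n * \<epsilon>\<^sup>2))"
      proof -
        have "real n * \<epsilon>\<^sup>2 \<le> 2 * (\<epsilon> * (2 * real n))\<^sup>2 / (real (card (A n)) * 4)"
        proof -
          have "real n * \<epsilon>\<^sup>2 * (real (card (A n)) * 4) \<le> real n * \<epsilon>\<^sup>2 * (real (2 * n) * 4)"
            using card[of n] by (intro mult_left_mono mult_right_mono) (simp_all only: of_nat_le_iff, auto)
          also have "\<dots> = 2 * (\<epsilon> * (2 * real n))\<^sup>2" by (simp add: power2_eq_square)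
          finally show ?thesis using pos by (simp add: field_simps)
        qed
        then show ?thesis by (simp add: power2_eq_square)
      qed
      also have "\<dots> = 2 * exp (- \<epsilon>\<^sup>2) ^ n" by (simp add: exp_of_nat_mult[symmetric])
      finally show ?thesis .
    next
      case False
      \<comment> \<open>An empty row has deviation 0, while Hoeffding's bound would divide by
        zero.\<close>
      then have "E n = {}"
        using \<epsilon> fin by (auto simp: E_def Z_def card_gt_0_iff mult_le_0_iff)
      then show ?thesis by simp
    qed
    have "summable (\<lambda>n. prob (E n))"
    proof (rule summable_comparison_test'[where N=0])
      show "summable (\<lambda>n. 2 * exp (- \<epsilon>\<^sup>2) ^ n)" using \<epsilon> by (intro summable_mult summable_geometric) auto
      show "norm (prob (E n)) \<le> 2 * exp (- \<epsilon>\<^sup>2) ^ n" for n using E_prob by simp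
    qed
    then have "AE \<omega> in M. \<forall>\<^sub>F n in sequentially. \<omega> \<in> space M - E n"
      using E_meas by (intro borel_cantelli_AE1) (auto simp: emeasure_eq_measure)
    then show ?thesis
    proof eventually_elim
      case (elim \<omega>)
      with eventually_ge_at_top[of 1] show ?case
        by eventually_elim (auto simp: E_def)
    qed
  qed
  \<comment> \<open>The exceptional null set depends on \<open>\<epsilon>\<close>, so
    \<open>\<epsilon>\<close> is restricted to a countable sequence tending to 0.\<close>
  have "AE \<omega> in M. \<forall>j::nat. \<forall>\<^sub>F n in sequentially. \<bar>Z n \<omega>\<bar> < 1 / real (Suc j) * (2 * real n)"
    unfolding AE_all_countable by (intro allI ev) simp
  then show ?thesis
  proof eventually_elim
    case (elim \<omega>)
    show ?case
    proof (rule tendstoI)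
      fix \<epsilon> :: real assume "\<epsilon> > 0"
      then obtain j where j: "1 / real (Suc j) < \<epsilon>" using nat_approx_posE by blast
      have "\<forall>\<^sub>F n in sequentially. \<bar>Z n \<omega>\<bar> < 1 / real (Suc j) * (2 * real n)" using elim by blast
      then show "\<forall>\<^sub>F n in sequentially. dist ((\<Sum>i\<in>A n. Y n i \<omega> - e) / (2 * real n)) 0 < \<epsilon>"
        using eventually_ge_at_top[of 1]
      proof eventually_elim
        case (elim n)
        have "\<bar>Z n \<omega>\<bar> < \<epsilon> * (2 * real n)"
          using elim j by (smt (verit) mult_right_mono of_nat_0_le_iff)
        then show ?case using elim(2) by (simp add: dist_real_def Z_def sum_subtractf abs_divide field_simps)
      qed
    qed
  qed
qed

end

section \<open>Averages over pairs of independent strengths\<close>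

context league_model
begin

abbreviation strengths :: "(nat \<Rightarrow> real) measure" where "strengths \<equiv> Pi\<^sub>M {1..} (\<lambda>_. \<mu>)"

lemma prob_space_strengths: "prob_space strengths"
  by (intro prob_space_PiM prob_\<mu>)

lemma distr_strength: "i \<ge> 1 \<Longrightarrow> distr strengths \<mu> (\<lambda>x. x i) = \<mu>"
  using prob_\<mu> by (intro distr_PiM_component) auto

lemma indep_strengths:
  "prob_space.indep_vars strengths (\<lambda>_. \<mu>) (\<lambda>i x. x i) {1..}"
proof -
  interpret S: prob_space strengths by (rule prob_space_strengths)
  have "distr strengths strengths (\<lambda>x. restrict (\<lambda>i. x i) {1..}) = distr strengths strengths (\<lambda>x. x)"
    by (intro distr_cong) (auto simp: space_PiM PiE_def extensional_restrict)
  also have "\<dots> = strengths" by (simp add: distr_id)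
  also have "\<dots> = (\<Pi>\<^sub>M i\<in>{1..}. distr strengths \<mu> (\<lambda>x. x i))"
    by (intro PiM_cong refl distr_strength[symmetric]) simp
  finally have "distr strengths strengths (\<lambda>x. \<lambda>i\<in>{1..}. x i) = (\<Pi>\<^sub>M i\<in>{1..}. distr strengths \<mu> (\<lambda>x. x i))" .
  then show ?thesis
    by (subst S.indep_vars_iff_distr_eq_PiM') auto
qed

lemma indep_strength_pairs:
  assumes g: "(\<lambda>z. g (fst z) (snd z)) \<in> borel_measurable (borel_nonneg \<Otimes>\<^sub>M borel_nonneg)"
    and K: "\<And>i. i \<in> L \<Longrightarrow> a i \<ge> 1 \<and> b i \<ge> 1" "disjoint_family_on (\<lambda>i. {a i, b i}) L"
  shows "prob_space.indep_vars strengths (\<lambda>_. borel) (\<lambda>i x. g (x (a i)) (x (b i)) :: real) L"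
proof -
  interpret S: prob_space strengths by (rule prob_space_strengths)
  have 1: "S.indep_vars (\<lambda>i. Pi\<^sub>M {a i, b i} (\<lambda>_. \<mu>)) (\<lambda>i x. restrict (\<lambda>j. x j) {a i, b i}) L"
    using K by (intro S.indep_vars_restrict[OF indep_strengths]) auto
  have "S.indep_vars (\<lambda>_. borel) (\<lambda>i x. (\<lambda>z. g (z (a i)) (z (b i))) (restrict (\<lambda>j. x j) {a i, b i})) L"
  proof (rule S.indep_vars_compose2[OF 1])
    fix i assume "i \<in> L"
    have "(\<lambda>z. (z (a i), z (b i))) \<in> measurable (Pi\<^sub>M {a i, b i} (\<lambda>_. \<mu>)) (borel_nonneg \<Otimes>\<^sub>M borel_nonneg)"
      by measurable
    from measurable_compose[OF this g]
    show "(\<lambda>z. g (z (a i)) (z (b i))) \<in> borel_measurable (Pi\<^sub>M {a i, b i} (\<lambda>_. \<mu>))" by simp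
  qed
  then show ?thesis by simp
qed

lemma expectation_strength_pair:
  assumes g: "(\<lambda>z. g (fst z) (snd z)) \<in> borel_measurable (borel_nonneg \<Otimes>\<^sub>M borel_nonneg)"
    and ab: "a \<ge> 1" "b \<ge> 1" "a \<noteq> b"
  shows "(\<integral>x. g (x a) (x b) \<partial>strengths) = (\<integral>z. g (fst z) (snd z) \<partial>(\<mu> \<Otimes>\<^sub>M \<mu>) :: real)"
proof -
  interpret S: prob_space strengths by (rule prob_space_strengths)
  have "S.indep_var (Pi\<^sub>M {a} (\<lambda>_. \<mu>)) (\<lambda>x. restrict (\<lambda>j. x j) {a}) (Pi\<^sub>M {b} (\<lambda>_. \<mu>)) (\<lambda>x. restrict (\<lambda>j. x j) {b})"
    using ab by (intro S.indep_var_restrict[OF indep_strengths]) auto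
  then have "S.indep_var \<mu> ((\<lambda>z. z a) \<circ> (\<lambda>x. restrict (\<lambda>j. x j) {a})) \<mu> ((\<lambda>z. z b) \<circ> (\<lambda>x. restrict (\<lambda>j. x j) {b}))"
    by (rule S.indep_var_compose) measurable
  then have "S.indep_var \<mu> (\<lambda>x. x a) \<mu> (\<lambda>x. x b)" by (simp add: comp_def)
  then have *: "distr strengths (\<mu> \<Otimes>\<^sub>M \<mu>) (\<lambda>x. (x a, x b)) = \<mu> \<Otimes>\<^sub>M \<mu>"
    unfolding S.indep_var_distribution_eq using ab by (simp add: distr_strength del: One_nat_def)
  have [measurable]: "(\<lambda>z. g (fst z) (snd z)) \<in> borel_measurable (\<mu> \<Otimes>\<^sub>M \<mu>)"
    using g by (simp add: measurable_cong_sets[OF sets_pair_measure_cong[OF sets_\<mu> sets_\<mu>] refl])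
  have "(\<integral>z. g (fst z) (snd z) \<partial>(\<mu> \<Otimes>\<^sub>M \<mu>)) = (\<integral>z. g (fst z) (snd z) \<partial>distr strengths (\<mu> \<Otimes>\<^sub>M \<mu>) (\<lambda>x. (x a, x b)))"
    by (simp only: *)
  also have "\<dots> = (\<integral>x. g (x a) (x b) \<partial>strengths)"
    using ab by (subst integral_distr) auto
  finally show ?thesis by simp
qed

text \<open>
  The pairs \<open>{i, i + k}\<close> are disjoint as long as \<open>i\<close> ranges over the indices with \<open>i div k\<close> even,
  or over those with \<open>i div k\<close> odd.
\<close>

lemma strength_pairs_lln:
  fixes q :: "nat \<Rightarrow> nat \<Rightarrow> nat" and g :: "real \<Rightarrow> real \<Rightarrow> real"
  assumes q: "\<And>n. n \<ge> 1 \<Longrightarrow> inj_on (q n) {1..<2 * n} \<and> q n ` {1..<2 * n} \<subseteq> {1..}"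
    and g: "(\<lambda>z. g (fst z) (snd z)) \<in> borel_measurable (borel_nonneg \<Otimes>\<^sub>M borel_nonneg)"
    and bound: "\<And>u u'. u \<ge> 0 \<Longrightarrow> u' \<ge> 0 \<Longrightarrow> \<bar>g u u'\<bar> \<le> 1"
    and k: "k \<ge> 1"
  shows "AE x in strengths. (\<lambda>n. (\<Sum>i\<in>{1..<2 * n - k}. g (x (q n i)) (x (q n (i + k)))) / (2 * real n))
    \<longlonglongrightarrow> (\<integral>z. g (fst z) (snd z) \<partial>(\<mu> \<Otimes>\<^sub>M \<mu>))"
proof -
  interpret S: prob_space strengths by (rule prob_space_strengths)
  define e where "e = (\<integral>z. g (fst z) (snd z) \<partial>(\<mu> \<Otimes>\<^sub>M \<mu>))"
  define A where "A c n = {i \<in> {1..<2 * n - k}. even (i div k) = c}" for c n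
  have nonneg: "x i \<ge> 0" if "x \<in> space strengths" "i \<ge> 1" for x i
    using that by (auto simp: space_PiM space_\<mu> PiE_iff)
  have part: "AE x in strengths. (\<lambda>n. (\<Sum>i\<in>A c n. g (x (q n i)) (x (q n (i + k))) - e) / (2 * real n)) \<longlonglongrightarrow> 0" for c
  proof (rule S.triangular_strong_law)
    show "finite (A c n)" for n by (simp add: A_def)
    have "card (A c n) \<le> card {1..<2 * n - k}" for n by (intro card_mono) (auto simp: A_def)
    then show "card (A c n) \<le> 2 * n" for n by (rule order_trans) simp
    fix n :: nat assume n: "n \<ge> 1"
    have ge1: "q n i \<ge> 1" "q n (i + k) \<ge> 1" if "i \<in> A c n" for i
    proof -
      have "i \<in> {1..<2 * n}" "i + k \<in> {1..<2 * n}" using that by (auto simp: A_def)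
      then show "q n i \<ge> 1" "q n (i + k) \<ge> 1" using q[OF n] by blast+
    qed
    have eq: "q n i = q n j \<longleftrightarrow> i = j" if "i \<in> {1..<2 * n}" "j \<in> {1..<2 * n}" for i j
      using q[OF n] that by (auto dest: inj_onD)
    have disj: "disjoint_family_on (\<lambda>i. {q n i, q n (i + k)}) (A c n)"
      unfolding disjoint_family_on_def
    proof (intro ballI impI)
      fix i j assume *: "i \<in> A c n" "j \<in> A c n" "i \<noteq> j"
      \<comment> \<open>Adding \<open>k\<close> raises the quotient by \<open>k\<close> by exactly
        one and so flips its parity.\<close>
      have "i + k \<noteq> j" "j + k \<noteq> i" using * k by (auto simp: A_def)
      moreover have "i \<in> {1..<2 * n}" "i + k \<in> {1..<2 * n}" "j \<in> {1..<2 * n}" "j + k \<in> {1..<2 * n}"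
        using * by (auto simp: A_def)
      ultimately show "{q n i, q n (i + k)} \<inter> {q n j, q n (j + k)} = {}"
        using \<open>i \<noteq> j\<close> by (auto simp: eq)
    qed
    show "S.indep_vars (\<lambda>_. borel) (\<lambda>i x. g (x (q n i)) (x (q n (i + k)))) (A c n)"
      using ge1 by (intro indep_strength_pairs g disj) blast
    fix i assume i: "i \<in> A c n"
    have "i \<in> {1..<2 * n}" "i + k \<in> {1..<2 * n}" using i by (auto simp: A_def)
    then have "q n i \<noteq> q n (i + k)" using k by (simp add: eq)
    then show "S.expectation (\<lambda>x. g (x (q n i)) (x (q n (i + k)))) = e"
      unfolding e_def using ge1[OF i] by (intro expectation_strength_pair g)
    fix x assume "x \<in> space strengths"
    then show "\<bar>g (x (q n i)) (x (q n (i + k)))\<bar> \<le> 1"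
      using ge1[OF i] by (intro bound nonneg)
  qed
  from part[of True] part[of False] show ?thesis
  proof eventually_elim
    case (elim x)
    let ?g = "\<lambda>n i. g (x (q n i)) (x (q n (i + k)))"
    have "(\<Sum>i\<in>A True n. ?g n i - e) / (2 * real n) + (\<Sum>i\<in>A False n. ?g n i - e) / (2 * real n)
        + real (2 * n - k - 1) * e / (2 * real n) = (\<Sum>i\<in>{1..<2 * n - k}. ?g n i) / (2 * real n)" for n
    proof -
      have "(\<Sum>i\<in>{1..<2 * n - k}. ?g n i - e) = (\<Sum>i\<in>A True n \<union> A False n. ?g n i - e)"
        by (intro sum.cong) (auto simp: A_def)
      also have "\<dots> = (\<Sum>i\<in>A True n. ?g n i - e) + (\<Sum>i\<in>A False n. ?g n i - e)"
        by (intro sum.union_disjoint) (auto simp: A_def)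
      finally show ?thesis by (simp add: sum_subtractf add_divide_distrib[symmetric] diff_diff_left[symmetric])
    qed
    \<comment> \<open>The centring subtracts \<open>e\<close> once for each of the
      \<open>2 * n - k - 1\<close> indices. The truncated subtraction agrees with the real one as
      soon as \<open>n > k\<close>.\<close>
    moreover have "(\<lambda>n. real (2 * n - k - 1) * e / (2 * real n)) \<longlonglongrightarrow> e"
    proof -
      have "(\<lambda>n. (2 * real n - real k - 1) * e / (2 * real n)) \<longlonglongrightarrow> e" by real_asymp
      then show ?thesis
      proof (rule Lim_transform_eventually)
        show "\<forall>\<^sub>F n in sequentially. (2 * real n - real k - 1) * e / (2 * real n) = real (2 * n - k - 1) * e / (2 * real n)"
          by (rule eventually_mono[OF eventually_ge_at_top[of "k + 1"]]) (auto simp: of_nat_diff)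
      qed
    qed
    from tendsto_add[OF tendsto_add[OF elim] this]
    have "(\<lambda>n. (\<Sum>i\<in>A True n. ?g n i - e) / (2 * real n) + (\<Sum>i\<in>A False n. ?g n i - e) / (2 * real n)
        + real (2 * n - k - 1) * e / (2 * real n)) \<longlonglongrightarrow> e" by simp
    ultimately show ?case by (simp add: e_def)
  qed
qed

end

section \<open>The league with fixed initial strengths\<close>

locale league_row = league_model M \<nu> \<xi> f \<mu> s
  for M :: "'a measure" and \<nu> \<xi> f \<mu> s +
  fixes n :: nat and opp :: "nat \<Rightarrow> nat \<Rightarrow> nat" and a :: "nat \<Rightarrow> real"
  assumes n: "n \<ge> 1" and cal: "calendar n opp" and a0: "a 0 = s" and a_nonneg: "\<And>i. a i \<ge> 0"
begin

abbreviation "D \<equiv> {1..<2 * n}"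
abbreviation "q p \<equiv> opp p 0"
abbreviation "P \<equiv> league f M \<xi> n opp a"
abbreviation "Procs \<equiv> Pi\<^sub>M {..<2 * n} (\<lambda>_. PL)"
abbreviation "R \<equiv> count_space (results n opp)"

lemma q_props: assumes "p \<in> D" shows "q p < 2 * n" "q p \<noteq> 0" "q p \<in> D"
proof -
  have "0 < 2 * n" using n by simp
  then show "q p < 2 * n" "q p \<noteq> 0" using cal assms unfolding calendar_def by blast+
  then show "q p \<in> D" by simp
qed

lemma q_bij: "bij_betw q D D"
proof -
  have ex1: "\<exists>!p. p \<in> D \<and> opp p 0 = j" if "j \<in> D" for j
  proof -
    have "0 < 2 * n" "j < 2 * n" "0 \<noteq> j" using that by auto
    then show ?thesis using cal unfolding calendar_def by blast
  qed
  show ?thesis unfolding bij_betw_def inj_on_def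
  proof (intro conjI ballI impI equalityI subsetI)
    fix p p' assume "p \<in> D" "p' \<in> D" "q p = q p'"
    then show "p = p'" using ex1[OF q_props(3)[of p]] by metis
  next
    fix j assume "j \<in> q ` D" then show "j \<in> D" using q_props(3) by blast
  next
    fix j assume "j \<in> D" then show "j \<in> q ` D" using ex1 by blast
  qed
qed

sublocale L: prob_space P
  by (rule prob_space_league[OF f admissible a_nonneg])

lemma measurable_P: "measurable P K = measurable (Procs \<Otimes>\<^sub>M R) K"
  unfolding league_def by (rule measurable_cong_sets) simp_all

lemma result_measurable: "(\<lambda>\<omega>. h (snd \<omega>)) \<in> measurable P K" if "\<And>r. r \<in> results n opp \<Longrightarrow> h r \<in> space K"
  unfolding measurable_P using that by (intro measurable_compose[OF measurable_snd]) auto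

text \<open>A match lists the smaller team first, so the matches of team 0 are exactly the triples
  with middle entry 0, one for each day.\<close>

lemma match_prod:
  fixes G :: "nat \<times> nat \<times> nat \<Rightarrow> 'c::comm_monoid_mult"
  assumes "\<And>p i j. (p, i, j) \<in> matches n opp \<Longrightarrow> i \<noteq> 0 \<Longrightarrow> G (p, i, j) = 1"
  shows "(\<Prod>m\<in>matches n opp. G m) = (\<Prod>p\<in>D. G (p, 0, q p))"
proof -
  have sub: "(\<lambda>p. (p, 0, q p)) ` D \<subseteq> matches n opp"
    using q_props by (auto simp: matches_def)
  have "G m = 1" if "m \<in> matches n opp - (\<lambda>p. (p, 0, q p)) ` D" for m
  proof -
    obtain p i j where m: "m = (p, i, j)" by (cases m)
    have "i \<noteq> 0" using that unfolding m by (auto simp: matches_def)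
    then show ?thesis using assms that unfolding m by blast
  qed
  then have "(\<Prod>m\<in>matches n opp. G m) = (\<Prod>m\<in>(\<lambda>p. (p, 0, q p)) ` D. G m)"
    using sub finite_matches by (intro prod.mono_neutral_right) auto
  also have "\<dots> = (\<Prod>p\<in>D. G (p, 0, q p))" by (subst prod.reindex) (auto simp: inj_on_def)
  finally show ?thesis .
qed

text \<open>All other matches are given the factor 1, so they drop out of the product over
  independent results.\<close>

lemma results_expectation:
  fixes h :: "nat \<Rightarrow> bool \<Rightarrow> 'c::{real_normed_field, banach, second_countable_topology}"
  assumes h: "\<And>p b. norm (h p b) \<le> 1" and x: "x \<in> space Procs"
  shows "(\<integral>r. (\<Prod>p\<in>D. h p (r (p, 0, q p))) \<partial>measure_pmf (results_pmf f n opp a x)) =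
    (\<Prod>p\<in>D. f (s * x 0 p) (a (q p) * x (q p) p) *\<^sub>R h p True + (1 - f (s * x 0 p) (a (q p) * x (q p) p)) *\<^sub>R h p False)"
proof -
  let ?w = "\<lambda>(p, i, j). f (a i * x i p) (a j * x j p)"
  let ?h = "\<lambda>(p, i::nat, j::nat) b. if i = 0 then h p b else 1"
  have w: "0 \<le> ?w m \<and> ?w m \<le> 1" if "m \<in> matches n opp" for m
  proof -
    obtain p i j where m: "m = (p, i, j)" by (cases m)
    have "i \<in> {..<2 * n}" "j \<in> {..<2 * n}" "p \<ge> 1" using that m by (auto simp: matches_def)
    then show ?thesis
      unfolding m using coordinate_nonneg[OF x] a_nonneg f_01 by (simp add: mult_nonneg_nonneg)
  qed
  have "(\<integral>r. (\<Prod>p\<in>D. h p (r (p, 0, q p))) \<partial>measure_pmf (results_pmf f n opp a x))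
      = (\<integral>r. (\<Prod>m\<in>matches n opp. ?h m (r m)) \<partial>measure_pmf (Pi_pmf (matches n opp) False (\<lambda>m. bernoulli_pmf (?w m))))"
  proof -
    have "(\<lambda>(p, i, j). bernoulli_pmf (f (a i * x i p) (a j * x j p))) = (\<lambda>m. bernoulli_pmf (?w m))"
      by auto
    moreover have "(\<Prod>m\<in>matches n opp. ?h m (r m)) = (\<Prod>p\<in>D. h p (r (p, 0, q p)))" for r
      by (subst match_prod) auto
    ultimately show ?thesis unfolding results_pmf_def by simp
  qed
  also have "\<dots> = (\<Prod>m\<in>matches n opp. ?w m *\<^sub>R ?h m True + (1 - ?w m) *\<^sub>R ?h m False)"
    using h by (intro expectation_prod_Pi_pmf_bool finite_matches w) auto
  also have "\<dots> = (\<Prod>p\<in>D. f (s * x 0 p) (a (q p) * x (q p) p) *\<^sub>R h p True + (1 - f (s * x 0 p) (a (q p) * x (q p) p)) *\<^sub>R h p False)"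
    by (subst match_prod) (auto simp: a0 simp flip: scaleR_add_left)
  finally show ?thesis .
qed

lemma set_results_pmf: "set_pmf (results_pmf f n opp a x) \<subseteq> results n opp"
  unfolding results_pmf_def results_eq_PiE_dflt
  using set_Pi_pmf_subset'[OF finite_matches] by (fastforce simp: PiE_dflt_def)

text \<open>Integration in two stages, over the results given the processes and then over the
  processes: the density with respect to the counting measure is the conditional law of the
  results.\<close>

lemma league_integral:
  fixes H :: "(nat \<times> nat \<times> nat \<Rightarrow> bool) \<Rightarrow> 'c::{banach, second_countable_topology}"
  assumes H: "\<And>r. norm (H r) \<le> B"
  shows "(\<integral>\<omega>. H (snd \<omega>) \<partial>P) = (\<integral>x. (\<integral>r. H r \<partial>measure_pmf (results_pmf f n opp a x)) \<partial>Procs)"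
proof -
  let ?g = "\<lambda>z. pmf (results_pmf f n opp a (fst z)) (snd z)"
  interpret product_prob_space "\<lambda>_. PL" "{..<2 * n}"
    by (simp add: product_prob_spaceI prob_space_PL)
  interpret R: sigma_finite_measure R
    by (intro sigma_finite_measure_count_space_finite finite_results)
  interpret XR: pair_sigma_finite Procs R ..
  have g': "(\<lambda>z. ennreal (?g z)) \<in> borel_measurable (Procs \<Otimes>\<^sub>M R)"
    using measurable_league_density[OF f a_nonneg] by (simp add: case_prod_beta')
  have g: "?g \<in> borel_measurable (Procs \<Otimes>\<^sub>M R)"
    using borel_measurable_enn2real[OF g'] by simp
  have P: "P = density (Procs \<Otimes>\<^sub>M R) ?g"
    by (simp add: league_def case_prod_beta')
  have Hm: "(\<lambda>\<omega>. H (snd \<omega>)) \<in> borel_measurable P" by (rule result_measurable) simp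
  then have Hm': "(\<lambda>\<omega>. H (snd \<omega>)) \<in> borel_measurable (Procs \<Otimes>\<^sub>M R)" by (simp add: measurable_P)
  have "integrable P (\<lambda>\<omega>. H (snd \<omega>))" using Hm H by (intro L.integrable_bounded) auto
  then have int: "integrable (Procs \<Otimes>\<^sub>M R) (\<lambda>z. ?g z *\<^sub>R H (snd z))"
    unfolding P using Hm' g by (subst (asm) integrable_density) auto
  have "(\<integral>\<omega>. H (snd \<omega>) \<partial>P) = (\<integral>z. ?g z *\<^sub>R H (snd z) \<partial>(Procs \<Otimes>\<^sub>M R))"
    unfolding P using Hm' g by (intro integral_density) auto
  also have "\<dots> = (\<integral>x. \<integral>r. ?g (x, r) *\<^sub>R H (snd (x, r)) \<partial>R \<partial>Procs)"
    using int by (intro XR.integral_fst'[symmetric]) simp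
  also have "\<dots> = (\<integral>x. (\<integral>r. H r \<partial>measure_pmf (results_pmf f n opp a x)) \<partial>Procs)"
  proof (rule Bochner_Integration.integral_cong[OF refl])
    fix x
    show "(\<integral>r. ?g (x, r) *\<^sub>R H (snd (x, r)) \<partial>R) = (\<integral>r. H r \<partial>measure_pmf (results_pmf f n opp a x))"
      using set_results_pmf by (subst integral_measure_pmf[OF finite_results[of n opp]])
        (auto simp: lebesgue_integral_count_space_finite[OF finite_results])
  qed
  finally show ?thesis .
qed

text \<open>The conditional mean of a factor is affine in the win probability. Averaging over the
  strength of the opponent on that day therefore just replaces \<open>f\<close> by its mean
  \<open>\<Phi>\<close>.\<close>

lemma league_expectation_all:
  fixes h :: "nat \<Rightarrow> bool \<Rightarrow> 'c::{real_normed_field, banach, second_countable_topology}"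
  assumes h: "\<And>p b. norm (h p b) \<le> 1"
  shows "(\<integral>\<omega>. (\<Prod>p\<in>D. h p (snd \<omega> (p, 0, q p))) \<partial>P) =
    (\<integral>\<omega>. (\<Prod>p\<in>D. \<Phi> (\<xi> p \<omega>) (a (q p)) *\<^sub>R h p True + (1 - \<Phi> (\<xi> p \<omega>) (a (q p))) *\<^sub>R h p False) \<partial>M)"
proof -
  let ?\<phi> = "\<lambda>p u v. f (s * u) (a (q p) * v) *\<^sub>R h p True + (1 - f (s * u) (a (q p) * v)) *\<^sub>R h p False"
  have "(\<integral>\<omega>. (\<Prod>p\<in>D. h p (snd \<omega> (p, 0, q p))) \<partial>P)
      = (\<integral>x. (\<integral>r. (\<Prod>p\<in>D. h p (r (p, 0, q p))) \<partial>measure_pmf (results_pmf f n opp a x)) \<partial>Procs)"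
    by (rule league_integral[where B=1 and H="\<lambda>r. \<Prod>p\<in>D. h p (r (p, 0, q p))"]) (intro norm_prod_le_1 h)
  also have "\<dots> = (\<integral>x. (\<Prod>p\<in>D. ?\<phi> p (x 0 p) (x (q p) p)) \<partial>Procs)"
    by (intro Bochner_Integration.integral_cong refl results_expectation h)
  also have "\<dots> = (\<integral>\<omega>. (\<Prod>p\<in>D. \<integral>v. ?\<phi> p (\<xi> p \<omega>) v \<partial>\<nu>) \<partial>M)"
  proof (rule integral_processes[OF _ q_bij])
    show "1 \<le> 2 * n" using n by simp
    fix p :: nat
    note [measurable] = const_measurable[OF a_nonneg]
    show "(\<lambda>z. ?\<phi> p (fst z) (snd z)) \<in> borel_measurable (borel_nonneg \<Otimes>\<^sub>M borel_nonneg)" by measurable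
    fix u v :: real assume "u \<ge> 0" "v \<ge> 0"
    then show "norm (?\<phi> p u v) \<le> 1"
      using f_01[of "s * u" "a (q p) * v"] s a_nonneg h by (intro norm_convex_combination_le_1) auto
  qed
  also have "\<dots> = (\<integral>\<omega>. (\<Prod>p\<in>D. \<Phi> (\<xi> p \<omega>) (a (q p)) *\<^sub>R h p True + (1 - \<Phi> (\<xi> p \<omega>) (a (q p))) *\<^sub>R h p False) \<partial>M)"
  proof (intro Bochner_Integration.integral_cong refl prod.cong)
    fix p \<omega> assume p: "p \<in> D" and \<omega>: "\<omega> \<in> space M"
    have x: "\<xi> p \<omega> \<ge> 0" using \<xi>_nonneg[of p] p \<omega> by simp
    note [measurable] = const_measurable[OF a_nonneg] const_measurable[OF x]
    have "integrable \<nu> (\<lambda>v. f (s * \<xi> p \<omega>) (a (q p) * v))"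
      using f_01 s x a_nonneg by (intro unit_integral prob_\<nu>) (auto simp: space_\<nu>)
    then show "(\<integral>v. ?\<phi> p (\<xi> p \<omega>) v \<partial>\<nu>) = \<Phi> (\<xi> p \<omega>) (a (q p)) *\<^sub>R h p True + (1 - \<Phi> (\<xi> p \<omega>) (a (q p))) *\<^sub>R h p False"
      by (simp add: F_def nu.prob_space)
  qed
  finally show ?thesis .
qed

text \<open>Days outside \<open>I\<close> receive the constant factor 1, whose convex combination is
  again 1.\<close>

lemma league_expectation:
  fixes h :: "nat \<Rightarrow> bool \<Rightarrow> 'c::{real_normed_field, banach, second_countable_topology}"
  assumes h: "\<And>p b. norm (h p b) \<le> 1" and I: "I \<subseteq> D"
  shows "(\<integral>\<omega>. (\<Prod>p\<in>I. h p (snd \<omega> (p, 0, q p))) \<partial>P) =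
    (\<integral>\<omega>. (\<Prod>p\<in>I. \<Phi> (\<xi> p \<omega>) (a (q p)) *\<^sub>R h p True + (1 - \<Phi> (\<xi> p \<omega>) (a (q p))) *\<^sub>R h p False) \<partial>M)"
proof -
  let ?h = "\<lambda>p b. if p \<in> I then h p b else 1"
  have restr: "(\<Prod>p\<in>D. if p \<in> I then g p else 1) = (\<Prod>p\<in>I. g p)" for g :: "nat \<Rightarrow> 'c"
    using I by (simp add: prod.inter_restrict[symmetric] Int_absorb1)
  have "(\<integral>\<omega>. (\<Prod>p\<in>I. h p (snd \<omega> (p, 0, q p))) \<partial>P) = (\<integral>\<omega>. (\<Prod>p\<in>D. ?h p (snd \<omega> (p, 0, q p))) \<partial>P)"
    by (simp only: restr)
  also have "\<dots> = (\<integral>\<omega>. (\<Prod>p\<in>D. \<Phi> (\<xi> p \<omega>) (a (q p)) *\<^sub>R ?h p True + (1 - \<Phi> (\<xi> p \<omega>) (a (q p))) *\<^sub>R ?h p False) \<partial>M)"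
    using h by (intro league_expectation_all) auto
  also have "\<dots> = (\<integral>\<omega>. (\<Prod>p\<in>D. if p \<in> I then \<Phi> (\<xi> p \<omega>) (a (q p)) *\<^sub>R h p True + (1 - \<Phi> (\<xi> p \<omega>) (a (q p))) *\<^sub>R h p False else 1) \<partial>M)"
    by (intro Bochner_Integration.integral_cong refl prod.cong) (auto simp flip: scaleR_add_left)
  finally show ?thesis by (simp only: restr)
qed

end

text \<open>When \<open>m\<close> grows by one, each lag \<open>k < m\<close> gains the single term
  \<open>e (m - k) m\<close>, and lag \<open>m\<close> has no pairs yet. Together these are the
  entries of the new column, and by symmetry of the new row.\<close>

lemma sum_symmetric_by_lag:
  fixes e :: "nat \<Rightarrow> nat \<Rightarrow> real"
  assumes sym: "\<And>i j. e i j = e j i" and m: "m \<ge> 1"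
  shows "(\<Sum>i\<in>{1..<m}. \<Sum>j\<in>{1..<m}. e i j)
    = (\<Sum>i\<in>{1..<m}. e i i) + 2 * (\<Sum>k\<in>{1..<m}. \<Sum>i\<in>{1..<m - k}. e i (i + k))"
  using m
proof (induction m rule: dec_induct)
  case base
  then show ?case by simp
next
  case (step m)
  let ?D = "{1..<m}"
  have D: "{1..<Suc m} = insert m ?D" using step(1) by auto
  have "(\<Sum>k\<in>{1..<Suc m}. \<Sum>i\<in>{1..<Suc m - k}. e i (i + k)) = (\<Sum>k\<in>?D. \<Sum>i\<in>{1..<Suc m - k}. e i (i + k))"
    unfolding D by simp
  also have "\<dots> = (\<Sum>k\<in>?D. (\<Sum>i\<in>{1..<m - k}. e i (i + k)) + e (m - k) m)"
  proof (rule sum.cong[OF refl])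
    fix k assume "k \<in> ?D"
    then have "{1..<Suc m - k} = insert (m - k) {1..<m - k}" "m - k + k = m" by auto
    then show "(\<Sum>i\<in>{1..<Suc m - k}. e i (i + k)) = (\<Sum>i\<in>{1..<m - k}. e i (i + k)) + e (m - k) m"
      by simp
  qed
  also have "\<dots> = (\<Sum>k\<in>?D. \<Sum>i\<in>{1..<m - k}. e i (i + k)) + (\<Sum>k\<in>?D. e (m - k) m)"
    by (rule sum.distrib)
  also have "(\<Sum>k\<in>?D. e (m - k) m) = (\<Sum>i\<in>?D. e i m)"
    by (rule sum.reindex_bij_witness[of _ "\<lambda>i. m - i" "\<lambda>k. m - k"]) auto
  finally have R: "(\<Sum>k\<in>{1..<Suc m}. \<Sum>i\<in>{1..<Suc m - k}. e i (i + k))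
      = (\<Sum>k\<in>?D. \<Sum>i\<in>{1..<m - k}. e i (i + k)) + (\<Sum>i\<in>?D. e i m)" .
  have "(\<Sum>i\<in>{1..<Suc m}. \<Sum>j\<in>{1..<Suc m}. e i j)
      = e m m + (\<Sum>j\<in>?D. e m j) + (\<Sum>i\<in>?D. e i m) + (\<Sum>i\<in>?D. \<Sum>j\<in>?D. e i j)"
    unfolding D by (simp add: sum.distrib)
  also have "(\<Sum>j\<in>?D. e m j) = (\<Sum>i\<in>?D. e i m)" by (simp only: sym[of m])
  finally show ?case unfolding R step.IH unfolding D by simp
qed

text \<open>Truncated subtraction leaves an empty sum for large lags. The index set of the series no
  longer depends on \<open>m\<close>, as dominated summation over the lags requires.\<close>

lemma sum_symmetric_suminf:
  fixes e :: "nat \<Rightarrow> nat \<Rightarrow> real"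
  assumes "\<And>i j. e i j = e j i" "m \<ge> 1"
  shows "(\<Sum>i\<in>{1..<m}. \<Sum>j\<in>{1..<m}. e i j)
    = (\<Sum>i\<in>{1..<m}. e i i) + 2 * (\<Sum>k. \<Sum>i\<in>{1..<m - Suc k}. e i (i + Suc k))"
proof -
  have "(\<Sum>k. \<Sum>i\<in>{1..<m - Suc k}. e i (i + Suc k)) = (\<Sum>k\<in>{..<m - 1}. \<Sum>i\<in>{1..<m - Suc k}. e i (i + Suc k))"
    by (rule suminf_finite) auto
  also have "\<dots> = (\<Sum>k\<in>{1..<m}. \<Sum>i\<in>{1..<m - k}. e i (i + k))"
    by (rule sum.reindex_bij_witness[of _ "\<lambda>k. k - 1" Suc]) auto
  finally show ?thesis using sum_symmetric_by_lag[OF assms] by simp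
qed

section \<open>The centred results of team 0 form a mixing row\<close>

context league_row
begin

abbreviation "u p \<equiv> a (q p)"

definition X :: "nat \<Rightarrow> (nat \<Rightarrow> nat \<Rightarrow> real) \<times> (nat \<times> nat \<times> nat \<Rightarrow> bool) \<Rightarrow> real" where
  "X p \<omega> = of_bool (snd \<omega> (p, 0, q p)) - mean_win (u p)"

lemma X_measurable: "X p \<in> borel_measurable P"
  unfolding X_def[abs_def] by (rule result_measurable) simp

lemma of_bool_mean_win_le: "\<bar>of_bool b - mean_win (u p)\<bar> \<le> 1"
  using mean_win_01[OF a_nonneg, of "q p"] by (cases b) auto

lemma X_abs_le: "\<bar>X p \<omega>\<bar> \<le> 1"
  unfolding X_def by (rule of_bool_mean_win_le)

text \<open>Given \<xi>, the factor is \<open>1 - mean_win (u p)\<close> with probability \<Phi> and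
  \<open>- mean_win (u p)\<close> otherwise, which has mean \<Psi>.\<close>

lemma expectation_prod_X:
  assumes I: "I \<subseteq> D"
  shows "(\<integral>\<omega>. (\<Prod>p\<in>I. X p \<omega>) \<partial>P) = (\<integral>\<omega>. (\<Prod>p\<in>I. \<Psi> (\<xi> p \<omega>) (u p)) \<partial>M)"
proof -
  have "(\<integral>\<omega>. (\<Prod>p\<in>I. of_bool (snd \<omega> (p, 0, q p)) - mean_win (u p)) \<partial>P)
      = (\<integral>\<omega>. (\<Prod>p\<in>I. \<Phi> (\<xi> p \<omega>) (u p) *\<^sub>R (of_bool True - mean_win (u p))
          + (1 - \<Phi> (\<xi> p \<omega>) (u p)) *\<^sub>R (of_bool False - mean_win (u p))) \<partial>M)"
    using of_bool_mean_win_le by (intro league_expectation[OF _ I]) simp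
  also have "\<dots> = (\<integral>\<omega>. (\<Prod>p\<in>I. \<Psi> (\<xi> p \<omega>) (u p)) \<partial>M)"
    by (intro Bochner_Integration.integral_cong refl prod.cong) (simp add: \<Psi>_eq algebra_simps)
  finally show ?thesis by (simp only: X_def)
qed

lemma expectation_X: "p \<in> D \<Longrightarrow> (\<integral>\<omega>. X p \<omega> \<partial>P) = 0"
  using expectation_prod_X[of "{p}"] \<Psi>_mean[of p "u p"] a_nonneg by simp

lemma expectation_XX:
  assumes "i \<in> D" "j \<in> D" "i < j"
  shows "(\<integral>\<omega>. X i \<omega> * X j \<omega> \<partial>P) = C (j - i) (u i) (u j)"
  using expectation_prod_X[of "{i, j}"] C_shift[of i "u i" "u j" "j - i"] a_nonneg assms by simp

text \<open>On the diagonal both factors belong to the same match, so the product formula does not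
  apply; the square enters \<open>league_expectation\<close> as one factor.\<close>

lemma expectation_X_square:
  assumes p: "p \<in> D"
  shows "(\<integral>\<omega>. X p \<omega> * X p \<omega> \<partial>P) = mean_win (u p) - (mean_win (u p))\<^sup>2"
proof -
  let ?m = "mean_win (u p)"
  have p1: "p \<ge> 1" using p by simp
  note [measurable] = const_measurable[OF a_nonneg] \<xi>_meas[OF p1]
  have "integrable M (\<lambda>\<omega>. \<Phi> (\<xi> p \<omega>) (u p))"
    using \<Phi>_01 \<xi>_nonneg[OF p1] a_nonneg by (intro integrable_bounded[where B=1]) auto
  then have \<Phi>: "(\<integral>\<omega>. \<Phi> (\<xi> p \<omega>) (u p) * (1 - 2 * ?m) + ?m\<^sup>2 \<partial>M) = ?m * (1 - 2 * ?m) + ?m\<^sup>2"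
    using \<Phi>_mean[OF p1 a_nonneg] by (simp add: prob_space)
  have "norm ((of_bool b - mean_win (u p))\<^sup>2) \<le> 1" for b p
    using of_bool_mean_win_le[of b p] by (simp add: abs_square_le_1)
  then have "(\<integral>\<omega>. (\<Prod>p\<in>{p}. (of_bool (snd \<omega> (p, 0, q p)) - mean_win (u p))\<^sup>2) \<partial>P)
      = (\<integral>\<omega>. (\<Prod>p\<in>{p}. \<Phi> (\<xi> p \<omega>) (u p) *\<^sub>R (of_bool True - mean_win (u p))\<^sup>2
          + (1 - \<Phi> (\<xi> p \<omega>) (u p)) *\<^sub>R (of_bool False - mean_win (u p))\<^sup>2) \<partial>M)"
    using p by (intro league_expectation) auto
  then have "(\<integral>\<omega>. X p \<omega> * X p \<omega> \<partial>P) = (\<integral>\<omega>. \<Phi> (\<xi> p \<omega>) (u p) * (1 - ?m)\<^sup>2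
          + (1 - \<Phi> (\<xi> p \<omega>) (u p)) * ?m\<^sup>2 \<partial>M)"
    by (simp add: X_def power2_eq_square)
  also have "\<dots> = (\<integral>\<omega>. \<Phi> (\<xi> p \<omega>) (u p) * (1 - 2 * ?m) + ?m\<^sup>2 \<partial>M)"
    by (simp add: power2_eq_square algebra_simps)
  finally show ?thesis unfolding \<Phi> by (simp add: power2_eq_square algebra_simps)
qed

text \<open>The characteristic function of \<open>X p\<close> at \<open>t\<close>, conditionally on
  the event that the process of team 0 takes the value \<open>x\<close> on day
  \<open>p\<close>.\<close>

definition G :: "real \<Rightarrow> nat \<Rightarrow> real \<Rightarrow> complex" where
  "G t p x = \<Phi> x (u p) *\<^sub>R iexp (t * (of_bool True - mean_win (u p)))
    + (1 - \<Phi> x (u p)) *\<^sub>R iexp (t * (of_bool False - mean_win (u p)))"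

lemma G_measurable [measurable (raw)]:
  assumes [measurable]: "g \<in> measurable K borel_nonneg" shows "(\<lambda>x. G t p (g x)) \<in> borel_measurable K"
proof -
  note [measurable] = const_measurable[OF a_nonneg]
  show ?thesis unfolding G_def by measurable
qed

lemma G_norm_le: "x \<ge> 0 \<Longrightarrow> norm (G t p x) \<le> 1"
  unfolding G_def using \<Phi>_01[OF _ a_nonneg] by (intro norm_convex_combination_le_1) auto

lemma char_X:
  assumes I: "I \<subseteq> D"
  shows "(\<integral>\<omega>. iexp (t * (\<Sum>p\<in>I. X p \<omega>)) \<partial>P) = (\<integral>\<omega>. (\<Prod>p\<in>I. G t p (\<xi> p \<omega>)) \<partial>M)"
proof -
  have fin: "finite I" using I finite_subset by blast
  have "iexp (t * (\<Sum>p\<in>I. X p \<omega>)) = (\<Prod>p\<in>I. iexp (t * (of_bool (snd \<omega> (p, 0, q p)) - mean_win (u p))))" for \<omega>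
    using fin by (simp add: X_def sum_distrib_left exp_sum)
  then have "(\<integral>\<omega>. iexp (t * (\<Sum>p\<in>I. X p \<omega>)) \<partial>P)
      = (\<integral>\<omega>. (\<Prod>p\<in>I. iexp (t * (of_bool (snd \<omega> (p, 0, q p)) - mean_win (u p)))) \<partial>P)"
    by (simp only:)
  also have "\<dots> = (\<integral>\<omega>. (\<Prod>p\<in>I. G t p (\<xi> p \<omega>)) \<partial>M)"
    unfolding G_def by (rule league_expectation[OF _ I]) simp
  finally show ?thesis .
qed

lemma row_eq: "{1..2 * n - 1} = D" by auto

text \<open>By \<open>char_X\<close> the characteristic function of a set of days is the integral
  over \<open>M\<close> of a product of values \<open>G t p (\<xi> p \<omega>)\<close>. Such a
  product is measurable for the past or the future of \<xi>, where the complex covariance inequality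
  applies.\<close>

lemma mixing_row_league: "mixing_row P X (2 * n - 1) c"
proof (unfold_locales, unfold row_eq)
  show "X i \<in> borel_measurable P" "\<bar>X i \<omega>\<bar> \<le> 1" for i \<omega> by (rule X_measurable X_abs_le)+
  show "i \<in> D \<Longrightarrow> (\<integral>\<omega>. X i \<omega> \<partial>P) = 0" for i by (rule expectation_X)
  show "summable c" "0 \<le> c k" for k by (rule c_summable c_nonneg)+
next
  fix i j assume ij: "i \<in> D" "j \<in> D" "i \<le> j"
  show "\<bar>\<integral>\<omega>. X i \<omega> * X j \<omega> \<partial>P\<bar> \<le> c (j - i)"
  proof (cases "i = j")
    case True
    have "norm (\<integral>\<omega>. X i \<omega> * X i \<omega> \<partial>P) \<le> 1"
    proof (intro L.norm_expectation_le borel_measurable_times X_measurable)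
      show "norm (X i \<omega> * X i \<omega>) \<le> 1" for \<omega>
        unfolding real_norm_def abs_mult by (intro mult_le_one X_abs_le abs_ge_zero)
    qed
    then show ?thesis using True by (simp add: c_def)
  next
    case False
    then show ?thesis using expectation_XX[OF ij(1,2)] ij C_abs_le[OF a_nonneg a_nonneg] by simp
  qed
next
  fix I J d t
  assume I: "I \<subseteq> D" and J: "J \<subseteq> D" and d: "d \<ge> 1" and sep: "\<And>i j. i \<in> I \<Longrightarrow> j \<in> J \<Longrightarrow> i + d \<le> j"
  have fin: "finite I" "finite J" using I J finite_subset by blast+
  show "norm ((\<integral>\<omega>. iexp (t * (\<Sum>i\<in>I \<union> J. X i \<omega>)) \<partial>P)
    - (\<integral>\<omega>. iexp (t * (\<Sum>i\<in>I. X i \<omega>)) \<partial>P) * (\<integral>\<omega>. iexp (t * (\<Sum>i\<in>J. X i \<omega>)) \<partial>P)) \<le> c d"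
  proof (cases "I = {}")
    case True
    then show ?thesis using c_nonneg[of d] by (simp add: L.prob_space)
  next
    case False
    \<comment> \<open>The last day of \<open>I\<close> separates past from future. An empty
      \<open>I\<close> has none, but there both terms of the difference coincide.\<close>
    define k where "k = Max I"
    have kI: "k \<in> I" unfolding k_def by (rule Max_in[OF fin(1) False])
    have k: "I \<subseteq> {1..k}" "k \<ge> 1" "J \<subseteq> {k + d..}"
      using fin I kI sep[OF kI] by (auto simp: k_def)
    interpret sub_algebras M "process_sigma M \<xi> {1..k}" "process_sigma M \<xi> {k + d..}" "\<alpha> d"
      by (rule sub_algebras_past_future[OF k(2)])
    have disj: "I \<inter> J = {}"
    proof (rule ccontr)
      assume "I \<inter> J \<noteq> {}"
      then obtain x where "x \<in> I" "x \<in> J" by blast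
      then show False using sep[of x x] d by simp
    qed
    have IJ: "I \<union> J \<subseteq> D" using I J by simp
    have meas: "(\<lambda>\<omega>. \<Prod>p\<in>I'. G t p (\<xi> p \<omega>)) \<in> borel_measurable (process_sigma M \<xi> K)"
      if "I' \<subseteq> K" "K \<subseteq> {1..}" for I' K
      using that by (intro borel_measurable_prod G_measurable process_sigma_measurable) auto
    have le: "norm (\<Prod>p\<in>I'. G t p (\<xi> p \<omega>)) \<le> 1" if "I' \<subseteq> D" "\<omega> \<in> space M" for I' \<omega>
      using that by (intro norm_prod_le_1 G_norm_le \<xi>_nonneg) auto
    have "norm ((\<integral>\<omega>. (\<Prod>p\<in>I. G t p (\<xi> p \<omega>)) * (\<Prod>p\<in>J. G t p (\<xi> p \<omega>)) \<partial>M)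
        - (\<integral>\<omega>. (\<Prod>p\<in>I. G t p (\<xi> p \<omega>)) \<partial>M) * (\<integral>\<omega>. (\<Prod>p\<in>J. G t p (\<xi> p \<omega>)) \<partial>M)) \<le> 16 * \<alpha> d"
      using k by (intro covariance_complex_le meas le I J) auto
    also have "16 * \<alpha> d = c d" using d by (simp add: c_def)
    finally show ?thesis
      unfolding char_X[OF I] char_X[OF J] char_X[OF IJ] by (simp only: prod.union_disjoint[OF fin disj])
  qed
qed

lemma V_league:
  "mixing_row.V P X {1..2 * n - 1} = (\<Sum>i\<in>D. mean_win (u i) - (mean_win (u i))\<^sup>2)
    + 2 * (\<Sum>k. \<Sum>i\<in>{1..<2 * n - Suc k}. C (Suc k) (u i) (u (i + Suc k)))"
proof -
  interpret row: mixing_row P X "2 * n - 1" c by (rule mixing_row_league)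
  let ?e = "\<lambda>i j. \<integral>\<omega>. X i \<omega> * X j \<omega> \<partial>P"
  have "row.V {1..2 * n - 1} = (\<Sum>i\<in>D. \<Sum>j\<in>D. ?e i j)"
    by (subst row.V_eq) (simp_all only: row_eq order_refl)
  also have "\<dots> = (\<Sum>i\<in>D. ?e i i) + 2 * (\<Sum>k. \<Sum>i\<in>{1..<2 * n - Suc k}. ?e i (i + Suc k))"
    using n by (intro sum_symmetric_suminf) (auto simp: mult.commute)
  also have "(\<Sum>i\<in>D. ?e i i) = (\<Sum>i\<in>D. mean_win (u i) - (mean_win (u i))\<^sup>2)"
    by (intro sum.cong refl expectation_X_square)
  also have "(\<lambda>k. \<Sum>i\<in>{1..<2 * n - Suc k}. ?e i (i + Suc k))
      = (\<lambda>k. \<Sum>i\<in>{1..<2 * n - Suc k}. C (Suc k) (u i) (u (i + Suc k)))"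
  proof (intro ext sum.cong refl)
    fix k i assume "i \<in> {1..<2 * n - Suc k}"
    then have "i \<in> D" "i + Suc k \<in> D" by (auto simp: less_diff_conv)
    then show "?e i (i + Suc k) = C (Suc k) (u i) (u (i + Suc k))"
      using expectation_XX[of i "i + Suc k"] by simp
  qed
  finally show ?thesis .
qed

lemma W_centered:
  "\<omega> \<in> space P \<Longrightarrow> W n opp \<omega> - integral\<^sup>L P (W n opp) = (\<Sum>p\<in>{1..2 * n - 1}. X p \<omega>)"
proof -
  have W: "W n opp \<omega> = (\<Sum>p\<in>D. X p \<omega>) + (\<Sum>p\<in>D. mean_win (u p))" for \<omega>
  proof -
    \<comment> \<open>Team 0 has the smallest number, so \<open>wins\<close> always takes its first
      branch.\<close>
    have "W n opp \<omega> = real (card {p \<in> D. snd \<omega> (p, 0, q p)})"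
      unfolding W_def wins_def case_prod_beta
      by (intro arg_cong[where f="\<lambda>A. real (card A)"] Collect_cong conj_cong refl) (simp add: q_props(2))
    also have "\<dots> = (\<Sum>p\<in>D. of_bool (snd \<omega> (p, 0, q p)))"
      by (simp add: sum_of_bool_eq Int_def)
    finally show ?thesis by (simp add: X_def sum_subtractf)
  qed
  have "integrable P (X p)" for p
    using X_measurable X_abs_le by (intro L.integrable_bounded[where B=1]) auto
  then have "integral\<^sup>L P (W n opp) = (\<Sum>p\<in>D. mean_win (u p))"
    unfolding ext[OF W] using expectation_X by (simp add: Bochner_Integration.integral_sum L.prob_space)
  then show ?thesis unfolding row_eq by (simp add: W)
qed

text \<open>The expression is the variance of the sum of the \<open>\<Psi> (\<xi> i) (u i)\<close>; it makes the limit \<open>\<rho>(s)\<^sup>2\<close> nonnegative.\<close>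

lemma variance_of_\<Psi>:
  "0 \<le> (\<Sum>i\<in>D. C 0 (u i) (u i)) + 2 * (\<Sum>k. \<Sum>i\<in>{1..<2 * n - Suc k}. C (Suc k) (u i) (u (i + Suc k)))"
proof -
  let ?e = "\<lambda>i j. \<integral>\<omega>. \<Psi> (\<xi> i \<omega>) (u i) * \<Psi> (\<xi> j \<omega>) (u j) \<partial>M"
  have int: "integrable M (\<lambda>\<omega>. \<Psi> (\<xi> i \<omega>) (u i) * \<Psi> (\<xi> j \<omega>) (u j))" if "i \<in> D" "j \<in> D" for i j
  proof -
    have ij: "i \<ge> 1" "j \<ge> 1" using that by auto
    note [measurable] = const_measurable[OF a_nonneg] \<xi>_meas[OF ij(1)] \<xi>_meas[OF ij(2)]
    show ?thesis
      using \<Psi>_abs_le a_nonneg \<xi>_nonneg[OF ij(1)] \<xi>_nonneg[OF ij(2)]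
      by (intro integrable_bounded[where B=1]) (auto simp: abs_mult intro!: mult_le_one)
  qed
  have "0 \<le> (\<integral>\<omega>. (\<Sum>i\<in>D. \<Psi> (\<xi> i \<omega>) (u i))\<^sup>2 \<partial>M)" by simp
  also have "\<dots> = (\<integral>\<omega>. (\<Sum>i\<in>D. \<Sum>j\<in>D. \<Psi> (\<xi> i \<omega>) (u i) * \<Psi> (\<xi> j \<omega>) (u j)) \<partial>M)"
    by (simp add: power2_eq_square sum_product)
  also have "\<dots> = (\<Sum>i\<in>D. \<Sum>j\<in>D. ?e i j)"
    using int by (subst Bochner_Integration.integral_sum)
      (auto intro!: sum.cong Bochner_Integration.integral_sum Bochner_Integration.integrable_sum)
  also have "\<dots> = (\<Sum>i\<in>D. ?e i i) + 2 * (\<Sum>k. \<Sum>i\<in>{1..<2 * n - Suc k}. ?e i (i + Suc k))"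
    using n by (intro sum_symmetric_suminf) (auto simp: mult.commute)
  also have "(\<Sum>i\<in>D. ?e i i) = (\<Sum>i\<in>D. C 0 (u i) (u i))"
    using C_shift[where k=0] a_nonneg by (intro sum.cong) auto
  also have "(\<lambda>k. \<Sum>i\<in>{1..<2 * n - Suc k}. ?e i (i + Suc k))
      = (\<lambda>k. \<Sum>i\<in>{1..<2 * n - Suc k}. C (Suc k) (u i) (u (i + Suc k)))"
    using a_nonneg by (intro ext sum.cong refl C_shift) auto
  finally show ?thesis .
qed

end

section \<open>The limit theorem\<close>

locale league_sequence = league_model M \<nu> \<xi> f \<mu> s
  for M :: "'a measure" and \<nu> \<xi> f \<mu> s +
  fixes opp :: "nat \<Rightarrow> nat \<Rightarrow> nat \<Rightarrow> nat"
  assumes calendar: "\<forall>n\<ge>1. calendar n (opp n)"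
begin

definition lag_sum :: "(nat \<Rightarrow> real) \<Rightarrow> nat \<Rightarrow> nat \<Rightarrow> real" where
  "lag_sum a k n = (\<Sum>i\<in>{1..<2 * n - k}. C k (a (opp n i 0)) (a (opp n (i + k) 0)))"

lemma league_rowI:
  assumes "n \<ge> 1" "a 0 = s" "\<And>i. a i \<ge> 0" shows "league_row M \<nu> \<xi> f \<mu> s n (opp n) a"
  using assms calendar by unfold_locales auto

lemma opponents:
  assumes "n \<ge> 1" shows "inj_on (\<lambda>p. opp n p 0) {1..<2 * n} \<and> (\<lambda>p. opp n p 0) ` {1..<2 * n} \<subseteq> {1..}"
proof -
  \<comment> \<open>Only the calendar matters here; the constant strengths are a convenient instance
    of the locale.\<close>
  interpret league_row M \<nu> \<xi> f \<mu> s n "opp n" "\<lambda>_. s"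
    using s by (intro league_rowI[OF assms]) auto
  show ?thesis using q_bij unfolding bij_betw_def by auto
qed

lemma opp_ge_1: "n \<ge> 1 \<Longrightarrow> i \<in> {1..<2 * n} \<Longrightarrow> opp n i 0 \<ge> 1"
  using opponents[of n] by fastforce

lemma C_abs_le_1: "u \<ge> 0 \<Longrightarrow> u' \<ge> 0 \<Longrightarrow> \<bar>C k u u'\<bar> \<le> 1"
proof -
  assume u: "u \<ge> 0" "u' \<ge> 0"
  note [measurable] = const_measurable[OF u(1)] const_measurable[OF u(2)]
  have "norm (C k u u') \<le> 1"
    unfolding C_def using u \<Psi>_abs_le \<xi>_nonneg
    by (intro norm_expectation_le) (auto simp: abs_mult intro!: mult_le_one)
  then show ?thesis by simp
qed

lemma AE_lag_sum:
  assumes "k \<ge> 1"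
  shows "AE x in strengths. (\<lambda>n. (\<Sum>i\<in>{1..<2 * n - k}. C k (x (opp n i 0)) (x (opp n (i + k) 0))) / (2 * real n))
    \<longlonglongrightarrow> rho_cov f \<mu> \<nu> M \<xi> s k"
  unfolding rho_cov_eq
  using C_abs_le_1 by (intro strength_pairs_lln[OF opponents _ _ assms]) measurable

text \<open>The statement on pairs with lag 1, for a function that ignores the second strength. It
  misses the last day, whose single term is negligible.\<close>

lemma AE_mean:
  assumes [measurable]: "g \<in> borel_measurable borel_nonneg" and g: "\<And>u. u \<ge> 0 \<Longrightarrow> \<bar>g u\<bar> \<le> (1::real)"
  shows "AE x in strengths. (\<lambda>n. (\<Sum>i\<in>{1..<2 * n}. g (x (opp n i 0))) / (2 * real n)) \<longlonglongrightarrow> (\<integral>u. g u \<partial>\<mu>)"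
proof -
  interpret mm: pair_prob_space \<mu> \<mu> ..
  have int: "(\<integral>z. g (fst z) \<partial>(\<mu> \<Otimes>\<^sub>M \<mu>)) = (\<integral>u. g u \<partial>\<mu>)"
  proof -
    have "integrable (\<mu> \<Otimes>\<^sub>M \<mu>) (\<lambda>z. g (fst z))"
      using g by (intro mm.P.integrable_bounded[where B=1]) (auto simp: space_pair_measure space_\<mu>)
    from mm.integral_fst'[OF this] show ?thesis by (simp add: mu.prob_space)
  qed
  have "AE x in strengths. (\<lambda>n. (\<Sum>i\<in>{1..<2 * n - 1}. g (x (opp n i 0))) / (2 * real n))
      \<longlonglongrightarrow> (\<integral>u. g u \<partial>\<mu>)"
    using strength_pairs_lln[OF opponents, of "\<lambda>u _. g u" 1] g int by simp
  from this AE_space show ?thesis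
  proof eventually_elim
    case (elim x)
    have "(\<lambda>n. g (x (opp n (2 * n - 1) 0)) / (2 * real n)) \<longlonglongrightarrow> 0"
    proof (rule tendsto_rabs_zero_cancel, rule tendsto_sandwich[OF _ _ tendsto_const])
      show "(\<lambda>n. 1 / (2 * real n)) \<longlonglongrightarrow> 0" by real_asymp
      show "\<forall>\<^sub>F n in sequentially. \<bar>g (x (opp n (2 * n - 1) 0)) / (2 * real n)\<bar> \<le> 1 / (2 * real n)"
      proof (rule eventually_mono[OF eventually_ge_at_top[of 1]])
        fix n :: nat assume n: "n \<ge> 1"
        then have "opp n (2 * n - 1) 0 \<ge> 1" by (intro opp_ge_1) auto
        then have "x (opp n (2 * n - 1) 0) \<ge> 0" using elim(2) by (auto simp: space_PiM space_\<mu> PiE_iff)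
        from g[OF this] show "\<bar>g (x (opp n (2 * n - 1) 0)) / (2 * real n)\<bar> \<le> 1 / (2 * real n)"
          by (simp add: abs_divide divide_right_mono)
      qed
    qed simp
    from tendsto_add[OF elim(1) this] have
      "(\<lambda>n. (\<Sum>i\<in>{1..<2 * n - 1}. g (x (opp n i 0))) / (2 * real n) + g (x (opp n (2 * n - 1) 0)) / (2 * real n))
        \<longlonglongrightarrow> (\<integral>u. g u \<partial>\<mu>)" by simp
    then show ?case
    proof (rule Lim_transform_eventually)
      show "\<forall>\<^sub>F n in sequentially. (\<Sum>i\<in>{1..<2 * n - 1}. g (x (opp n i 0))) / (2 * real n) + g (x (opp n (2 * n - 1) 0)) / (2 * real n)
          = (\<Sum>i\<in>{1..<2 * n}. g (x (opp n i 0))) / (2 * real n)"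
      proof (rule eventually_mono[OF eventually_ge_at_top[of 1]])
        fix n :: nat assume "n \<ge> 1"
        then have "{1..<2 * n} = insert (2 * n - 1) {1..<2 * n - 1}" by auto
        then show "(\<Sum>i\<in>{1..<2 * n - 1}. g (x (opp n i 0))) / (2 * real n) + g (x (opp n (2 * n - 1) 0)) / (2 * real n)
          = (\<Sum>i\<in>{1..<2 * n}. g (x (opp n i 0))) / (2 * real n)"
          by (simp add: add_divide_distrib add.commute)
      qed
    qed
  qed
qed

text \<open>A lag has fewer than \<open>2 * n\<close> pairs, each bounded by
  \<open>c (Suc k)\<close>, so after normalisation \<open>c (Suc k)\<close> dominates for every
  \<open>n\<close> and every sequence of strengths.\<close>

lemma lag_sum_limit:
  assumes a: "\<And>i. a i \<ge> 0"
    and lim: "\<And>k. (\<lambda>n. lag_sum a (Suc k) n / (2 * real n)) \<longlonglongrightarrow> rho_cov f \<mu> \<nu> M \<xi> s (Suc k)"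
  shows "(\<lambda>n. (\<Sum>k. lag_sum a (Suc k) n) / (2 * real n)) \<longlonglongrightarrow> (\<Sum>k. rho_cov f \<mu> \<nu> M \<xi> s (Suc k))"
proof -
  have le: "norm (lag_sum a (Suc k) n / (2 * real n)) \<le> c (Suc k)" for k n
  proof -
    have "\<bar>lag_sum a (Suc k) n\<bar> \<le> (\<Sum>i\<in>{1..<2 * n - Suc k}. c (Suc k))"
      unfolding lag_sum_def using a by (intro order_trans[OF sum_abs] sum_mono C_abs_le) auto
    also have "\<dots> \<le> real (2 * n) * c (Suc k)"
      unfolding sum_constant using c_nonneg by (intro mult_right_mono) auto
    finally show ?thesis
      using c_nonneg[of "Suc k"] by (cases "n = 0") (simp_all add: abs_divide field_simps)
  qed
  have "summable (\<lambda>k. c (Suc k))" using c_summable by (simp add: summable_Suc_iff)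
  then have "(\<lambda>n. \<Sum>k. lag_sum a (Suc k) n / (2 * real n)) \<longlonglongrightarrow> (\<Sum>k. rho_cov f \<mu> \<nu> M \<xi> s (Suc k))"
    using tannerys_theorem[OF lim always_eventually, where M="\<lambda>k. c (Suc k)"] le by simp
  moreover have "(\<Sum>k. lag_sum a (Suc k) n / (2 * real n)) = (\<Sum>k. lag_sum a (Suc k) n) / (2 * real n)" for n
  proof (rule suminf_divide)
    have "lag_sum a (Suc k) n = 0" if "k \<notin> {..<2 * n}" for k using that by (simp add: lag_sum_def)
    then show "summable (\<lambda>k. lag_sum a (Suc k) n)" by (intro summable_finite[of "{..<2 * n}"]) auto
  qed
  ultimately show ?thesis by simp
qed

lemma integral_variance:
  "(\<integral>u. mean_win u - (mean_win u)\<^sup>2 \<partial>\<mu>) = sigma_sq f \<mu> \<nu> s + (\<integral>u. C 0 u u \<partial>\<mu>)"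
proof -
  have "integrable \<mu> (\<lambda>u. \<integral>v. \<Phi> v u - (\<Phi> v u)\<^sup>2 \<partial>\<nu>)"
  proof (rule mu.integrable_bounded[where B=1])
    show "(\<lambda>u. \<integral>v. \<Phi> v u - (\<Phi> v u)\<^sup>2 \<partial>\<nu>) \<in> borel_measurable \<mu>" by measurable
    fix u assume "u \<in> space \<mu>"
    then have u: "u \<ge> 0" by (simp add: space_\<mu>)
    note [measurable] = const_measurable[OF u]
    show "norm (\<integral>v. \<Phi> v u - (\<Phi> v u)\<^sup>2 \<partial>\<nu>) \<le> 1"
      using \<Phi>_abs_le(3) u by (intro nu.norm_expectation_le) (auto simp: space_\<nu>)
  qed
  moreover have "integrable \<mu> (\<lambda>u. C 0 u u)"
    using C_abs_le_1 by (intro mu.integrable_bounded[where B=1]) (auto simp: space_\<mu>)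
  moreover have "(\<integral>u. mean_win u - (mean_win u)\<^sup>2 \<partial>\<mu>) = (\<integral>u. (\<integral>v. \<Phi> v u - (\<Phi> v u)\<^sup>2 \<partial>\<nu>) + C 0 u u \<partial>\<mu>)"
    by (intro Bochner_Integration.integral_cong refl mean_win_variance) (simp add: space_\<mu>)
  ultimately show ?thesis unfolding sigma_sq_eq_integral by simp
qed

lemma rho_sq_eq: "rho_sq f \<mu> \<nu> M \<xi> s = (\<integral>u. C 0 u u \<partial>\<mu>) + 2 * (\<Sum>k. rho_cov f \<mu> \<nu> M \<xi> s (Suc k))"
  unfolding rho_sq_def square_\<Psi>_eq_integral ..

text \<open>There are countably many lags, so one null set serves all. The averages of
  \<open>C 0\<close> determine the sign of \<open>rho_sq\<close>, those of the Bernoulli variances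
  the limit variance.\<close>

lemma AE_good_strengths:
  "AE x in strengths. x \<in> space strengths
    \<and> (\<forall>k. (\<lambda>n. lag_sum x (Suc k) n / (2 * real n)) \<longlonglongrightarrow> rho_cov f \<mu> \<nu> M \<xi> s (Suc k))
    \<and> (\<lambda>n. (\<Sum>i\<in>{1..<2 * n}. C 0 (x (opp n i 0)) (x (opp n i 0))) / (2 * real n)) \<longlonglongrightarrow> (\<integral>u. C 0 u u \<partial>\<mu>)
    \<and> (\<lambda>n. (\<Sum>i\<in>{1..<2 * n}. mean_win (x (opp n i 0)) - (mean_win (x (opp n i 0)))\<^sup>2) / (2 * real n))
        \<longlonglongrightarrow> (\<integral>u. mean_win u - (mean_win u)\<^sup>2 \<partial>\<mu>)"
proof -
  have "\<bar>mean_win u - (mean_win u)\<^sup>2\<bar> \<le> 1" if "u \<ge> 0" for u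
    using mean_win_01[OF that] power_le_one[OF mean_win_01[OF that], of 2] zero_le_power2[of "mean_win u"] by linarith
  then have "AE x in strengths. (\<lambda>n. (\<Sum>i\<in>{1..<2 * n}. mean_win (x (opp n i 0)) - (mean_win (x (opp n i 0)))\<^sup>2) / (2 * real n))
        \<longlonglongrightarrow> (\<integral>u. mean_win u - (mean_win u)\<^sup>2 \<partial>\<mu>)"
    by (intro AE_mean) measurable
  moreover have "AE x in strengths. (\<lambda>n. (\<Sum>i\<in>{1..<2 * n}. C 0 (x (opp n i 0)) (x (opp n i 0))) / (2 * real n)) \<longlonglongrightarrow> (\<integral>u. C 0 u u \<partial>\<mu>)"
    using C_abs_le_1 by (intro AE_mean) measurable
  moreover have "AE x in strengths. \<forall>k. (\<lambda>n. lag_sum x (Suc k) n / (2 * real n)) \<longlonglongrightarrow> rho_cov f \<mu> \<nu> M \<xi> s (Suc k)"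
    unfolding AE_all_countable lag_sum_def by (intro allI AE_lag_sum) simp
  moreover have "AE x in strengths. x \<in> space strengths" by (rule AE_space)
  ultimately show ?thesis by eventually_elim blast
qed

text \<open>Team 0 is never its own opponent, so its own strength does not enter.\<close>

lemma lag_sum_update: "n \<ge> 1 \<Longrightarrow> lag_sum (x(0 := s)) k n = lag_sum x k n"
  unfolding lag_sum_def
proof (rule sum.cong[OF refl])
  fix i assume "n \<ge> 1" "i \<in> {1..<2 * n - k}"
  then have "opp n i 0 \<noteq> 0" "opp n (i + k) 0 \<noteq> 0"
    using opp_ge_1[of n i] opp_ge_1[of n "i + k"] by (auto simp: less_diff_conv)
  then show "C k ((x(0 := s)) (opp n i 0)) ((x(0 := s)) (opp n (i + k) 0)) = C k (x (opp n i 0)) (x (opp n (i + k) 0))"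
    by simp
qed

text \<open>\<open>rho_sq\<close> is a limit of normalised variances along any good sequence of
  strengths. Its sign does not depend on the sequence, and under a probability measure an almost
  sure statement that is constant must hold.\<close>

lemma rho_sq_nonneg: "rho_sq f \<mu> \<nu> M \<xi> s \<ge> 0"
  and weak_convergence: "AE svec in strengths. weak_conv_m
           (\<lambda>n. let P = league f M \<xi> n (opp n) (svec(0 := s)) in
              distr P borel (\<lambda>\<omega>. (W n (opp n) \<omega> - integral\<^sup>L P (W n (opp n))) / sqrt (2 * real n)))
           (centered_gaussian (sigma_sq f \<mu> \<nu> s + rho_sq f \<mu> \<nu> M \<xi> s))"
proof -
  interpret S: prob_space strengths by (rule prob_space_strengths)
  let ?rho = "\<Sum>k. rho_cov f \<mu> \<nu> M \<xi> s (Suc k)"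
  have good: "rho_sq f \<mu> \<nu> M \<xi> s \<ge> 0 \<and> weak_conv_m
           (\<lambda>n. let P = league f M \<xi> n (opp n) (x(0 := s)) in
              distr P borel (\<lambda>\<omega>. (W n (opp n) \<omega> - integral\<^sup>L P (W n (opp n))) / sqrt (2 * real n)))
           (centered_gaussian (sigma_sq f \<mu> \<nu> s + rho_sq f \<mu> \<nu> M \<xi> s))"
    if x: "x \<in> space strengths"
      and lag: "\<And>k. (\<lambda>n. lag_sum x (Suc k) n / (2 * real n)) \<longlonglongrightarrow> rho_cov f \<mu> \<nu> M \<xi> s (Suc k)"
      and C0: "(\<lambda>n. (\<Sum>i\<in>{1..<2 * n}. C 0 (x (opp n i 0)) (x (opp n i 0))) / (2 * real n)) \<longlonglongrightarrow> (\<integral>u. C 0 u u \<partial>\<mu>)"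
      and mv: "(\<lambda>n. (\<Sum>i\<in>{1..<2 * n}. mean_win (x (opp n i 0)) - (mean_win (x (opp n i 0)))\<^sup>2) / (2 * real n))
        \<longlonglongrightarrow> (\<integral>u. mean_win u - (mean_win u)\<^sup>2 \<partial>\<mu>)" for x
  proof -
    \<comment> \<open>The product space has no coordinate 0, so \<open>x 0\<close> is
      \<open>undefined\<close>; the update puts the strength of team 0 there.\<close>
    define a where "a = x(0 := s)"
    have a: "a 0 = s" "\<And>i. a i \<ge> 0"
      using x s by (auto simp: a_def space_PiM space_\<mu> PiE_iff)
    have row: "league_row M \<nu> \<xi> f \<mu> s n (opp n) a" if "n \<ge> 1" for n
      by (rule league_rowI) (use that a in auto)
    have ax: "a (opp n i 0) = x (opp n i 0)" if "n \<ge> 1" "i \<in> {1..<2 * n}" for n i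
      using opp_ge_1[OF that] by (simp add: a_def)
    have lag_a: "(\<lambda>n. lag_sum a (Suc k) n / (2 * real n)) \<longlonglongrightarrow> rho_cov f \<mu> \<nu> M \<xi> s (Suc k)" for k
      by (rule Lim_transform_eventually[OF lag eventually_mono[OF eventually_ge_at_top[of 1]]])
        (simp add: a_def lag_sum_update)
    have sum_lag: "(\<lambda>n. (\<Sum>k. lag_sum a (Suc k) n) / (2 * real n)) \<longlonglongrightarrow> ?rho"
      by (rule lag_sum_limit[OF a(2) lag_a])
    have transfer: "(\<lambda>n. (\<Sum>i\<in>{1..<2 * n}. g (a (opp n i 0))) / (2 * real n)) \<longlonglongrightarrow> l"
      if "(\<lambda>n. (\<Sum>i\<in>{1..<2 * n}. g (x (opp n i 0))) / (2 * real n)) \<longlonglongrightarrow> l" for g :: "real \<Rightarrow> real" and l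
      by (rule Lim_transform_eventually[OF that eventually_mono[OF eventually_ge_at_top[of 1]]])
        (simp add: ax)
    have total: "(\<lambda>n. (A n + 2 * (\<Sum>k. lag_sum a (Suc k) n)) / (2 * real n)) \<longlonglongrightarrow> l + 2 * ?rho"
      if "(\<lambda>n. A n / (2 * real n)) \<longlonglongrightarrow> l" for A l
      using tendsto_add[OF that tendsto_mult[OF tendsto_const[of 2] sum_lag]] by (simp add: add_divide_distrib)
    have "rho_sq f \<mu> \<nu> M \<xi> s \<ge> 0"
      unfolding rho_sq_eq
    proof (rule tendsto_lowerbound[OF total[OF transfer[OF C0]]])
      show "\<forall>\<^sub>F n in sequentially. 0 \<le> ((\<Sum>i\<in>{1..<2 * n}. C 0 (a (opp n i 0)) (a (opp n i 0)))
          + 2 * (\<Sum>k. lag_sum a (Suc k) n)) / (2 * real n)"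
        by (rule eventually_mono[OF eventually_ge_at_top[of 1]])
          (use league_row.variance_of_\<Psi>[OF row] in \<open>simp add: lag_sum_def\<close>)
    qed simp
    moreover have "weak_conv_m
           (\<lambda>n. let P = league f M \<xi> n (opp n) a in
              distr P borel (\<lambda>\<omega>. (W n (opp n) \<omega> - integral\<^sup>L P (W n (opp n))) / sqrt (2 * real n)))
           (centered_gaussian (sigma_sq f \<mu> \<nu> s + rho_sq f \<mu> \<nu> M \<xi> s))"
      unfolding Let_def
    proof (rule mixing_rows_weak_conv[where P="\<lambda>n. league f M \<xi> n (opp n) a"
          and X="\<lambda>n. league_row.X \<nu> f s (opp n) a" and N="\<lambda>n. 2 * n - 1" and c=c])
      show "mixing_row (league f M \<xi> n (opp n) a) (league_row.X \<nu> f s (opp n) a) (2 * n - 1) c" if "n \<ge> 1" for n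
        by (rule league_row.mixing_row_league[OF row[OF that]])
      show "2 * n - 1 \<le> 2 * n" for n :: nat by simp
      show "(\<lambda>k. real k * c k) \<longlonglongrightarrow> 0" by (rule c_smallo)
      have "(\<lambda>n. ((\<Sum>i\<in>{1..<2 * n}. mean_win (a (opp n i 0)) - (mean_win (a (opp n i 0)))\<^sup>2)
            + 2 * (\<Sum>k. lag_sum a (Suc k) n)) / (2 * real n))
          \<longlonglongrightarrow> (sigma_sq f \<mu> \<nu> s + (\<integral>u. C 0 u u \<partial>\<mu>)) + 2 * ?rho"
        by (rule total[OF transfer[OF mv[unfolded integral_variance]]])
      also have "(sigma_sq f \<mu> \<nu> s + (\<integral>u. C 0 u u \<partial>\<mu>)) + 2 * ?rho = sigma_sq f \<mu> \<nu> s + rho_sq f \<mu> \<nu> M \<xi> s"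
        by (simp add: rho_sq_eq)
      finally show "(\<lambda>n. mixing_row.V (league f M \<xi> n (opp n) a) (league_row.X \<nu> f s (opp n) a) {1..2 * n - 1} / (2 * real n))
          \<longlonglongrightarrow> sigma_sq f \<mu> \<nu> s + rho_sq f \<mu> \<nu> M \<xi> s"
      proof (rule Lim_transform_eventually[OF _ eventually_mono[OF eventually_ge_at_top[of 1]]])
        fix n :: nat assume "1 \<le> n"
        from league_row.V_league[OF row[OF this]]
        show "((\<Sum>i\<in>{1..<2 * n}. mean_win (a (opp n i 0)) - (mean_win (a (opp n i 0)))\<^sup>2)
            + 2 * (\<Sum>k. lag_sum a (Suc k) n)) / (2 * real n)
          = mixing_row.V (league f M \<xi> n (opp n) a) (league_row.X \<nu> f s (opp n) a) {1..2 * n - 1} / (2 * real n)"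
          by (simp only: lag_sum_def)
      qed
    next
      fix n
      interpret L: prob_space "league f M \<xi> n (opp n) a"
        by (rule prob_space_league[OF f admissible a(2)])
      have [measurable]: "W n (opp n) \<in> borel_measurable (league f M \<xi> n (opp n) a)"
      proof -
        have eq: "W n (opp n) = (\<lambda>\<omega>. real (wins n (opp n) (snd \<omega>) 0))" by (auto simp: W_def)
        have "snd \<in> measurable (league f M \<xi> n (opp n) a) (count_space (results n (opp n)))"
          unfolding league_def by simp
        then show ?thesis
          unfolding eq by (rule measurable_compose[where g="\<lambda>r. real (wins n (opp n) r 0)"]) simp
      qed
      show "real_distribution (distr (league f M \<xi> n (opp n) a) borel
         (\<lambda>\<omega>. (W n (opp n) \<omega> - L.expectation (W n (opp n))) / sqrt (2 * real n)))"
        by (intro L.real_distribution_distr) measurable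
      assume n: "n \<ge> 1"
      show "distr (league f M \<xi> n (opp n) a) borel (\<lambda>\<omega>. (W n (opp n) \<omega> - L.expectation (W n (opp n))) / sqrt (2 * real n))
          = distr (league f M \<xi> n (opp n) a) borel (\<lambda>\<omega>. (\<Sum>i\<in>{1..2 * n - 1}. league_row.X \<nu> f s (opp n) a i \<omega>) / sqrt (2 * real n))"
        by (intro distr_cong refl) (simp only: league_row.W_centered[OF row[OF n]])
    qed
    ultimately show ?thesis unfolding a_def by blast
  qed
  have AE: "AE x in strengths. rho_sq f \<mu> \<nu> M \<xi> s \<ge> 0 \<and> weak_conv_m
           (\<lambda>n. let P = league f M \<xi> n (opp n) (x(0 := s)) in
              distr P borel (\<lambda>\<omega>. (W n (opp n) \<omega> - integral\<^sup>L P (W n (opp n))) / sqrt (2 * real n)))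
           (centered_gaussian (sigma_sq f \<mu> \<nu> s + rho_sq f \<mu> \<nu> M \<xi> s))"
    using AE_good_strengths by (rule AE_mp) (intro AE_I2 impI good; blast)
  then have "AE x in strengths. rho_sq f \<mu> \<nu> M \<xi> s \<ge> 0" by eventually_elim blast
  then show "rho_sq f \<mu> \<nu> M \<xi> s \<ge> 0" by (simp add: S.AE_const)
  show "AE svec in strengths. weak_conv_m
           (\<lambda>n. let P = league f M \<xi> n (opp n) (svec(0 := s)) in
              distr P borel (\<lambda>\<omega>. (W n (opp n) \<omega> - integral\<^sup>L P (W n (opp n))) / sqrt (2 * real n)))
           (centered_gaussian (sigma_sq f \<mu> \<nu> s + rho_sq f \<mu> \<nu> M \<xi> s))"
    using AE by eventually_elim blast
qed

end

theorem theorem1p4: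
  fixes f :: "real \<Rightarrow> real \<Rightarrow> real"
    and \<mu> \<nu> :: "real measure"
    and M :: "'a measure"
    and \<xi> :: "nat \<Rightarrow> 'a \<Rightarrow> real"
    and opp :: "nat \<Rightarrow> nat \<Rightarrow> nat \<Rightarrow> nat"
    and s :: real
  assumes f: "win_function f"
    and \<mu>: "prob_space \<mu>" "sets \<mu> = sets borel_nonneg"
    and \<nu>: "prob_space \<nu>" "sets \<nu> = sets borel_nonneg"
    and \<xi>: "admissible_process \<nu> M \<xi>"
    and mixing: "mixing_rate (mixing_coeff M \<xi>)"
    and calendar: "\<forall>n\<ge>1. calendar n (opp n)"
    and s: "s \<ge> 0"
  shows "sigma_sq f \<mu> \<nu> s = win_prob f \<mu> \<nu> s - (\<integral>(v, u). (F f \<nu> s v u)\<^sup>2 \<partial>(\<nu> \<Otimes>\<^sub>M \<mu>))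
    \<and> summable (\<lambda>k. rho_cov f \<mu> \<nu> M \<xi> s (Suc k))
    \<and> rho_sq f \<mu> \<nu> M \<xi> s \<ge> 0
    \<and> (AE svec in Pi\<^sub>M {1..} (\<lambda>_. \<mu>).
         weak_conv_m
           (\<lambda>n. let P = league f M \<xi> n (opp n) (svec(0 := s)) in
              distr P borel (\<lambda>\<omega>. (W n (opp n) \<omega> - integral\<^sup>L P (W n (opp n))) / sqrt (2 * real n)))
           (centered_gaussian (sigma_sq f \<mu> \<nu> s + rho_sq f \<mu> \<nu> M \<xi> s)))"
proof -
  have M: "prob_space M" using \<xi> unfolding admissible_process_def by blast
  interpret league_sequence M \<nu> \<xi> f \<mu> s opp
    by (intro league_sequence.intro league_model.intro mixing_process.intro league_model_axioms.intro
        mixing_process_axioms.intro league_sequence_axioms.intro assms M)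
  show ?thesis
    using sigma_sq_eq rho_cov_summable rho_sq_nonneg weak_convergence by blast
qed

end
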